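(* For every $\epsilon>0$ there exists an instance $\mathcal I$ with homogeneous departures such that every Markovian policy $\pi$ satisfies \[V(\pi,\mathcal I)<\left(\tfrac12+\epsilon\right)\mathrm{OFF}(\mathcal I).\]
   Context: Model. An instance $\mathcal I=(\mathcal T,\lambda,\mu,r)$ consists of a finite set $\mathcal T$ of agent types, arrival rates $\lambda_i>0$, abandonment rates $\mu_i>0$ and rewards $r_{ij}\in\mathbb R$. Agents of type $i$ arrive according to independent Poisson processes of rate $\lambda_i$; an agent $a$ of type $i_a$ arriving at time $t_a$ has an independent maximum sojourn time $s_a\sim\mathrm{Exp}(\mu_{i_a})$ and abandons unmatched at $d_a=t_a+s_a$ unless matched earlier. An agent is present from arrival until matched or abandoned; two present agents may be matched, and matching an agent of type $i$ with a later-arriving agent of type $j$ (an $(i,j)$ match) earns $r_{ij}$. Omniscient benchmark. For $t>0$ let $G(t)$ be the graph on the agents arriving in $[0,t]$, with an edge between distinct $a,b$ whenever $[t_a,d_a]\cap[t_b,d_b]\ne\emptyset$, of weight $r_{i_ai_b}$ when $a$ arrived before $b$. $\mathrm{OFF}(\mathcal I,t)=\frac1t\mathbb E[\text{maximum weight of a matching of }G(t)]$, $\mathrm{OFF}(\mathcal I)=\lim_{t\to\infty}\mathrm{OFF}(\mathcal I,t)$. Markovian policies. For an online matching policy $\pi$ (deciding matches in real time using only information revealed so far), let $N^\pi_i(t)$ be the number of type-$i$ agents present at time $t$ and $X^\pi_{ij}(t)$ the number of $(i,j)$ matches made by time $t$. $\pi$ is Markovian if $N^\pi(t)=(N^\pi_i(t))_i$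 is a continuous-time Markov chain. Its long-run reward rate is $V(\pi,\mathcal I)=\sum_{i,j}r_{ij}x^\pi_{ij}$ with $x^\pi_{ij}=\lim_{t\to\infty}\frac1t\mathbb E[X^\pi_{ij}(t)]$. Homogeneous departures. $\mathcal I$ is bipartite if $\mathcal T$ can be partitioned into $\mathcal T_1,\mathcal T_2$ with $r_{ij}\le0$ whenever $\{i,j\}\subseteq\mathcal T_1$ or $\{i,j\}\subseteq\mathcal T_2$. $\mathcal I$ has homogeneous departures if either all $\mu_i$ are equal, or $\mathcal I$ is bipartite and $\mu_i=\mu_j$ whenever $i,j$ lie in the same part. *)

theory Defs
  imports "HOL-Probability.Probability"
begin

record 'a matching_instance =
  agent_types :: "'a set"
  arr_rate :: "'a \<Rightarrow> real"
  ab_rate :: "'a \<Rightarrow> real"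
  reward :: "'a \<Rightarrow> 'a \<Rightarrow> real"

definition valid_instance :: "'a matching_instance \<Rightarrow> bool" where
  "valid_instance I \<longleftrightarrow> finite (agent_types I) \<and>
     (\<forall>i\<in>agent_types I. 0 < arr_rate I i \<and> 0 < ab_rate I i)"

definition bipartition :: "'a matching_instance \<Rightarrow> 'a set \<Rightarrow> 'a set \<Rightarrow> bool" where
  "bipartition I T1 T2 \<longleftrightarrow> T1 \<union> T2 = agent_types I \<and> T1 \<inter> T2 = {} \<and>
     (\<forall>i j. {i, j} \<subseteq> T1 \<or> {i, j} \<subseteq> T2 \<longrightarrow> reward I i j \<le> 0)"

definition homogeneous_departures :: "'a matching_instance \<Rightarrow> bool" where
  "homogeneous_departures I \<longleftrightarrow>
     (\<forall>i\<in>agent_types I. \<forall>j\<in>agent_types I. ab_rate I i = ab_rate I j) \<or>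
     (\<exists>T1 T2. bipartition I T1 T2 \<and>
        (\<forall>i j. {i, j} \<subseteq> T1 \<or> {i, j} \<subseteq> T2 \<longrightarrow> ab_rate I i = ab_rate I j))"


text \<open>
  The agent \<open>(i, k)\<close> is the \<open>k\<close>-th arrival (counting from 0) of type \<open>i\<close>. An outcome
  \<open>(g, s, u)\<close> records the inter-arrival times \<open>g\<close> within each type, the maximum sojourn times
  \<open>s\<close>, and a seed \<open>u\<close>, which is the private randomness that a policy may use. The Poisson
  process of arrivals of type \<open>i\<close> is given by its i.i.d. exponential inter-arrival times.
\<close>

type_synonym 'a agent = "'a \<times> nat"
type_synonym 'a outcome = "('a agent \<Rightarrow> real) \<times> ('a agent \<Rightarrow> real) \<times> real"

definition agents :: "'a matching_instance \<Rightarrow> 'a agent set" where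
  "agents I = agent_types I \<times> UNIV"

definition gap :: "'a outcome \<Rightarrow> 'a agent \<Rightarrow> real" where
  "gap \<omega> = fst \<omega>"

definition sojourn :: "'a outcome \<Rightarrow> 'a agent \<Rightarrow> real" where
  "sojourn \<omega> = fst (snd \<omega>)"

definition seed :: "'a outcome \<Rightarrow> real" where
  "seed \<omega> = snd (snd \<omega>)"

definition arrival :: "'a outcome \<Rightarrow> 'a agent \<Rightarrow> real" where
  "arrival \<omega> a = (\<Sum>l\<le>snd a. gap \<omega> (fst a, l))"

definition departure :: "'a outcome \<Rightarrow> 'a agent \<Rightarrow> real" where
  "departure \<omega> a = arrival \<omega> a + sojourn \<omega> a"

definition exponential_measure :: "real \<Rightarrow> real measure" where
  "exponential_measure l = density lborel (\<lambda>x. ennreal (exponential_density l x))"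

definition full_outcome_measure :: "'a matching_instance \<Rightarrow> 'a outcome measure" where
  "full_outcome_measure I =
     (\<Pi>\<^sub>M a\<in>agents I. exponential_measure (arr_rate I (fst a))) \<Otimes>\<^sub>M
     ((\<Pi>\<^sub>M a\<in>agents I. exponential_measure (ab_rate I (fst a))) \<Otimes>\<^sub>M
      uniform_measure lborel {0..1})"

definition regular_outcome :: "'a matching_instance \<Rightarrow> 'a outcome \<Rightarrow> bool" where
  "regular_outcome I \<omega> \<longleftrightarrow>
     (\<forall>a\<in>agents I. 0 < gap \<omega> a \<and> 0 < sojourn \<omega> a) \<and>
     (\<forall>t. finite {a \<in> agents I. arrival \<omega> a \<le> t})"

text \<open>Almost every outcome is regular, so restricting to these leaves a probability space.\<close>

definition outcome_space :: "'a matching_instance \<Rightarrow> 'a outcome measure" where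
  "outcome_space I = restrict_space (full_outcome_measure I) {\<omega>. regular_outcome I \<omega>}"


text \<open>
  Edges are stored as ordered pairs (earlier agent, later agent), which is what the reward
  depends on. Simultaneous arrivals, which carry no order, have probability zero.
\<close>

definition offline_edges ::
  "'a matching_instance \<Rightarrow> 'a outcome \<Rightarrow> real \<Rightarrow> ('a agent \<times> 'a agent) set" where
  "offline_edges I \<omega> t = {(a, b). a \<in> agents I \<and> b \<in> agents I \<and>
     arrival \<omega> a < arrival \<omega> b \<and> arrival \<omega> b \<le> t \<and>
     {arrival \<omega> a..departure \<omega> a} \<inter> {arrival \<omega> b..departure \<omega> b} \<noteq> {}}"

definition is_matching :: "('v \<times> 'v) set \<Rightarrow> bool" where
  "is_matching M \<longleftrightarrow>
     (\<forall>e\<in>M. \<forall>f\<in>M. e \<noteq> f \<longrightarrow> {fst e, snd e} \<inter> {fst f, snd f} = {})"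

definition matching_weight ::
  "'a matching_instance \<Rightarrow> ('a agent \<times> 'a agent) set \<Rightarrow> real" where
  "matching_weight I M = (\<Sum>(a, b)\<in>M. reward I (fst a) (fst b))"

definition max_matching_weight ::
  "'a matching_instance \<Rightarrow> 'a outcome \<Rightarrow> real \<Rightarrow> real" where
  "max_matching_weight I \<omega> t =
     Max (matching_weight I ` {M. M \<subseteq> offline_edges I \<omega> t \<and> is_matching M})"

definition OFF_upto :: "'a matching_instance \<Rightarrow> real \<Rightarrow> real" where
  "OFF_upto I t = (1 / t) * (\<integral>\<omega>. max_matching_weight I \<omega> t \<partial>outcome_space I)"

definition has_OFF :: "'a matching_instance \<Rightarrow> real \<Rightarrow> bool" where
  "has_OFF I v \<longleftrightarrow> (OFF_upto I \<longlongrightarrow> v) at_top"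


text \<open>
  A policy is represented by the matches it makes: \<open>\<pi> \<omega> t\<close> is the set of pairs
  (earlier agent, later agent) matched exactly at time \<open>t\<close>.
\<close>

type_synonym 'a policy = "'a outcome \<Rightarrow> real \<Rightarrow> ('a agent \<times> 'a agent) set"

definition matched_at :: "'a policy \<Rightarrow> 'a outcome \<Rightarrow> 'a agent \<Rightarrow> real \<Rightarrow> bool" where
  "matched_at \<pi> \<omega> a s \<longleftrightarrow> (\<exists>(b, c)\<in>\<pi> \<omega> s. a = b \<or> a = c)"

text \<open>
  An agent can be matched from its arrival on, but only strictly before its departure time:
  observing an abandonment is too late.
\<close>

definition feasible_policy :: "'a matching_instance \<Rightarrow> 'a policy \<Rightarrow> bool" where
  "feasible_policy I \<pi> \<longleftrightarrow> (\<forall>\<omega>\<in>space (outcome_space I). \<forall>t.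
     is_matching (\<pi> \<omega> t) \<and>
     (\<forall>(a, b)\<in>\<pi> \<omega> t. a \<in> agents I \<and> b \<in> agents I \<and>
        arrival \<omega> a < arrival \<omega> b \<and> arrival \<omega> b \<le> t \<and>
        t < departure \<omega> a \<and> t < departure \<omega> b \<and>
        (\<forall>s<t. \<not> matched_at \<pi> \<omega> a s \<and> \<not> matched_at \<pi> \<omega> b s)))"

definition measurable_policy :: "'a matching_instance \<Rightarrow> 'a policy \<Rightarrow> bool" where
  "measurable_policy I \<pi> \<longleftrightarrow> (\<forall>t. \<forall>a\<in>agents I. \<forall>b\<in>agents I.
     {\<omega> \<in> space (outcome_space I). \<exists>s\<le>t. (a, b) \<in> \<pi> \<omega> s} \<in> sets (outcome_space I))"

text \<open>
  What is known when deciding at time \<open>t\<close>: the seed, the arrivals and the abandonments up to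
  and including \<open>t\<close>, and the matches made before \<open>t\<close>. The departure time of a matched agent is
  never revealed.
\<close>

definition history :: "'a matching_instance \<Rightarrow> 'a policy \<Rightarrow> 'a outcome \<Rightarrow> real \<Rightarrow>
    real \<times> ('a agent \<times> real) set \<times> ('a agent \<times> real) set \<times>
    (real \<times> 'a agent \<times> 'a agent) set" where
  "history I \<pi> \<omega> t =
     (seed \<omega>,
      {(a, s). a \<in> agents I \<and> s = arrival \<omega> a \<and> s \<le> t},
      {(a, s). a \<in> agents I \<and> s = departure \<omega> a \<and> s \<le> t \<and>
         (\<forall>s'<s. \<not> matched_at \<pi> \<omega> a s')},
      {(s, a, b). s < t \<and> (a, b) \<in> \<pi> \<omega> s})"

definition nonanticipating_policy :: "'a matching_instance \<Rightarrow> 'a policy \<Rightarrow> bool" where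
  "nonanticipating_policy I \<pi> \<longleftrightarrow>
     (\<forall>\<omega>\<in>space (outcome_space I). \<forall>\<omega>'\<in>space (outcome_space I). \<forall>t\<ge>0.
        history I \<pi> \<omega> t = history I \<pi> \<omega>' t \<longrightarrow> \<pi> \<omega> t = \<pi> \<omega>' t)"

definition online_policy :: "'a matching_instance \<Rightarrow> 'a policy \<Rightarrow> bool" where
  "online_policy I \<pi> \<longleftrightarrow>
     feasible_policy I \<pi> \<and> measurable_policy I \<pi> \<and> nonanticipating_policy I \<pi>"

definition num_present ::
  "'a matching_instance \<Rightarrow> 'a policy \<Rightarrow> real \<Rightarrow> 'a outcome \<Rightarrow> 'a \<Rightarrow> nat" where
  "num_present I \<pi> t \<omega> i = card {a \<in> agents I. fst a = i \<and>
     arrival \<omega> a \<le> t \<and> t < departure \<omega> a \<and> (\<forall>s\<le>t. \<not> matched_at \<pi> \<omega> a s)}"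

definition num_matches :: "'a policy \<Rightarrow> 'a \<Rightarrow> 'a \<Rightarrow> real \<Rightarrow> 'a outcome \<Rightarrow> nat" where
  "num_matches \<pi> i j t \<omega> =
     card {(a, b). fst a = i \<and> fst b = j \<and> (\<exists>s\<le>t. (a, b) \<in> \<pi> \<omega> s)}"

text \<open>
  A time-homogeneous continuous-time Markov chain on a countable state space, in terms of
  finite-dimensional distributions: \<open>K h x\<close> is the law of the state a time \<open>h\<close> after state \<open>x\<close>.
  The Markov property is stated as a product formula, avoiding conditioning on null events.
\<close>

definition markov_chain :: "'w measure \<Rightarrow> (real \<Rightarrow> 'w \<Rightarrow> 's) \<Rightarrow> bool" where
  "markov_chain M Y \<longleftrightarrow> (\<exists>K :: real \<Rightarrow> 's \<Rightarrow> 's pmf.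
     \<forall>(n::nat) (\<tau> :: nat \<Rightarrow> real) (x :: nat \<Rightarrow> 's).
       0 \<le> \<tau> 0 \<and> (\<forall>k\<le>n. \<tau> k < \<tau> (Suc k)) \<longrightarrow>
       measure M {\<omega> \<in> space M. \<forall>k\<le>Suc n. Y (\<tau> k) \<omega> = x k} =
       measure M {\<omega> \<in> space M. \<forall>k\<le>n. Y (\<tau> k) \<omega> = x k} *
       pmf (K (\<tau> (Suc n) - \<tau> n) (x n)) (x (Suc n)))"

definition markovian_policy :: "'a matching_instance \<Rightarrow> 'a policy \<Rightarrow> bool" where
  "markovian_policy I \<pi> \<longleftrightarrow>
     online_policy I \<pi> \<and> markov_chain (outcome_space I) (num_present I \<pi>)"

definition has_reward_rate :: "'a matching_instance \<Rightarrow> 'a policy \<Rightarrow> real \<Rightarrow> bool" where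
  "has_reward_rate I \<pi> v \<longleftrightarrow> (\<exists>x :: 'a \<Rightarrow> 'a \<Rightarrow> real.
     (\<forall>i\<in>agent_types I. \<forall>j\<in>agent_types I.
        ((\<lambda>t. (1 / t) * (\<integral>\<omega>. real (num_matches \<pi> i j t \<omega>) \<partial>outcome_space I))
           \<longlongrightarrow> x i j) at_top) \<and>
     v = (\<Sum>i\<in>agent_types I. \<Sum>j\<in>agent_types I. reward I i j * x i j))"

end

theory Submission
  imports Defs "HOL-Real_Asymp.Real_Asymp"
begin

text \<open>
  The instance embeds the tight example of the prophet inequality: a scarce agent can take reward
  1 from a companion that is present anyway, or wait for a jackpot \<open>n\<^sup>2\<close> that arrives during its
  life with probability about \<open>1 / n\<^sup>2\<close>. The omniscient matching obtains about \<open>1 + 1\<close> per scarce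
  agent. Online, an unmatched scarce agent abandons at rate 1 and meets a jackpot at rate
  \<open>1 / n\<^sup>2\<close>, so that the expected jackpot reward is at most the probability of abandoning and the
  total is at most 1; both rates are obtained by resampling a single exponential variable, which
  a non-anticipating policy cannot have seen. The limit defining the omniscient value exists
  because the expected maximum weight is superadditive in the horizon: by memorylessness the
  arrivals after any time are distributed like the whole process.
\<close>

section \<open>Exponential variables and product measures\<close>

text \<open>Both online rates are multiples of one quantity, the expected waiting time W of a scarce
  agent: it abandons with probability exactly 1 * W and is matched to a later jackpot with
  probability at most W / n^2. Multiplying the second bound by the jackpot reward n^2 makes W drop
  out. The obstacle is to speak of rates for a policy that is merely a function of the whole
  outcome. Conditioning on histories is avoided by redrawing one coordinate of a product space and
  showing that the state just before a time does not react to a clock that has not yet rung. Rewards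
  depend on the order of arrival: a jackpot pays only if it arrives after the scarce agent. Jackpots
  live for a time of mean n^2, so otherwise a policy could stockpile them. On the offline side the
  limit is also the supremum over all horizons, so the single horizon n is enough. It is long
  compared with the mean life 1 of a scarce agent and short compared with the time scale n^2 of the
  rare arrivals, so that only the first agent of each type has to be looked at.\<close>

lemma sets_exponential_measure [simp, measurable_cong]:
  "sets (exponential_measure l) = sets borel"
  by (simp add: exponential_measure_def)

lemma space_exponential_measure [simp]: "space (exponential_measure l) = UNIV"
  by (simp add: exponential_measure_def)

lemma prob_space_exponential_measure: "0 < l \<Longrightarrow> prob_space (exponential_measure l)"
  unfolding exponential_measure_def by (rule prob_space_exponential_density)

lemma nn_integral_exponential_measure:
  assumes "f \<in> borel_measurable borel"
  shows "(\<integral>\<^sup>+x. f x \<partial>exponential_measure l) =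
    (\<integral>\<^sup>+x. ennreal (exponential_density l x) * f x \<partial>lborel)"
  unfolding exponential_measure_def by (rule nn_integral_density) (use assms in auto)

text \<open>Memorylessness in integral form: past \<open>v\<close> the density is
  \<open>exp (- l * v)\<close> times its own translate. This is the fact behind restarting the
  arrival processes at a fixed time.\<close>

lemma nn_integral_exponential_indicator_Ioi:
  assumes "0 < l" "0 \<le> v" and f [measurable]: "f \<in> borel_measurable borel"
  shows "(\<integral>\<^sup>+x. indicator {v<..} x * f (x - v) \<partial>exponential_measure l) =
    ennreal (exp (- l * v)) * (\<integral>\<^sup>+x. f x \<partial>exponential_measure l)"
proof -
  have "(\<integral>\<^sup>+x. indicator {v<..} x * f (x - v) \<partial>exponential_measure l) =
      (\<integral>\<^sup>+x. ennreal (exponential_density l x) * (indicator {v<..} x * f (x - v)) \<partial>lborel)"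
    by (rule nn_integral_exponential_measure) auto
  also have "\<dots> = (\<integral>\<^sup>+x. ennreal (exponential_density l (v + 1 * x)) *
      (indicator {v<..} (v + 1 * x) * f ((v + 1 * x) - v)) \<partial>lborel)"
    by (subst nn_integral_real_affine[where c = 1 and t = v]) auto
  also have "\<dots> = (\<integral>\<^sup>+x. ennreal (exp (- l * v)) * (ennreal (exponential_density l x) * f x) \<partial>lborel)"
  proof (rule nn_integral_cong_AE)
    \<comment> \<open>The density equals \<open>l\<close> at 0, while the open half-line leaves out
      its endpoint \<open>v\<close>; the two integrands differ at this one point.\<close>
    have "AE x in lborel. x \<noteq> (0::real)"
      by (rule AE_lborel_singleton)
    then show "AE x in lborel. ennreal (exponential_density l (v + 1 * x)) *
        (indicator {v<..} (v + 1 * x) * f ((v + 1 * x) - v)) =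
        ennreal (exp (- l * v)) * (ennreal (exponential_density l x) * f x)"
    proof eventually_elim
      case (elim x)
      have shift: "exponential_density l (v + x) = exp (- l * v) * exponential_density l x" if "0 < x"
        using assms that by (simp add: exponential_density_def algebra_simps exp_add[symmetric])
      have nonneg: "0 \<le> exponential_density l x"
        using assms by (simp add: exponential_density_nonneg)
      show ?case
      proof (cases "0 < x")
        case True
        then show ?thesis
          using shift nonneg by (simp add: ennreal_mult mult.assoc)
      next
        case False
        then have "exponential_density l x = 0"
          using elim by (simp add: exponential_density_def)
        then show ?thesis using False by simp
      qed
    qed
  qed
  also have "\<dots> = ennreal (exp (- l * v)) * (\<integral>\<^sup>+x. f x \<partial>exponential_measure l)"
    by (subst nn_integral_cmult) (auto simp: nn_integral_exponential_measure)
  finally show ?thesis .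
qed

lemma emeasure_exponential_Ioi:
  assumes "0 < l" "0 \<le> v"
  shows "emeasure (exponential_measure l) {v<..} = ennreal (exp (- l * v))"
  using nn_integral_exponential_indicator_Ioi[OF assms, of "\<lambda>_. 1"]
    prob_space.emeasure_space_1[OF prob_space_exponential_measure[OF assms(1)]]
  by simp

lemma emeasure_exponential_Ici:
  assumes "0 < l" "0 \<le> v"
  shows "emeasure (exponential_measure l) {v..} = ennreal (exp (- l * v))"
proof -
  have "{v} \<in> null_sets (exponential_measure l)"
    unfolding exponential_measure_def
  proof (subst null_sets_density_iff, safe)
    show "AE x in lborel. x \<in> {v} \<longrightarrow> ennreal (exponential_density l x) = 0"
      using AE_lborel_singleton[of v] by eventually_elim simp
  qed auto
  then have "emeasure (exponential_measure l) ({v<..} \<union> {v}) = emeasure (exponential_measure l) {v<..}"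
    by (intro emeasure_Un_null_set) auto
  moreover have "{v<..} \<union> {v} = {v..}" by auto
  ultimately show ?thesis
    using emeasure_exponential_Ioi[OF assms] by simp
qed

text \<open>The compensator identity for one exponential variable: the event that \<open>Z\<close> holds at the
  exponential time \<open>x\<close> has hazard rate \<open>l\<close> while \<open>Z x\<close> holds.\<close>

lemma exponential_compensator:
  fixes Z :: "real \<Rightarrow> real \<Rightarrow> bool"
  assumes l: "0 < l" and [measurable]: "Measurable.pred borel (\<lambda>x. Z x x)"
    and pred: "\<And>v x. 0 < v \<Longrightarrow> v \<le> x \<Longrightarrow> Z x v = Z v v"
  shows "(\<integral>\<^sup>+x. indicator {x. 0 < x \<and> Z x x} x \<partial>exponential_measure l) =
    ennreal l * (\<integral>\<^sup>+x. (\<integral>\<^sup>+v. indicator {v. 0 < v \<and> v \<le> x \<and> Z x v} v \<partial>lborel) \<partial>exponential_measure l)"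
proof -
  interpret E: prob_space "exponential_measure l" by (rule prob_space_exponential_measure[OF l])
  interpret P: pair_sigma_finite "exponential_measure l" lborel ..
  define A where "A = {x. 0 < x \<and> Z x x}"
  have [measurable]: "A \<in> sets borel" unfolding A_def by measurable
  have "(\<integral>\<^sup>+x. (\<integral>\<^sup>+v. indicator {v. 0 < v \<and> v \<le> x \<and> Z x v} v \<partial>lborel) \<partial>exponential_measure l) =
     (\<integral>\<^sup>+x. (\<integral>\<^sup>+v. indicator A v * indicator {v..} x \<partial>lborel) \<partial>exponential_measure l)"
  proof (intro nn_integral_cong)
    fix x v
    \<comment> \<open>Predictability: the state at \<open>v\<close> may be read in the scenario
      where the clock rings exactly at \<open>v\<close>. What remains of \<open>x\<close> is the
      condition \<open>v \<le> x\<close>, which Fubini turns into a survival probability.\<close>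
    have "0 < v \<and> v \<le> x \<and> Z x v \<longleftrightarrow> v \<in> A \<and> x \<in> {v..}"
      using pred[of v x] by (auto simp: A_def)
    then show "(indicator {v. 0 < v \<and> v \<le> x \<and> Z x v} v :: ennreal) = indicator A v * indicator {v..} x"
      by (simp add: indicator_def)
  qed
  also have "\<dots> = (\<integral>\<^sup>+v. (\<integral>\<^sup>+x. indicator A v * indicator {v..} x \<partial>exponential_measure l) \<partial>lborel)"
    by (rule P.Fubini'[symmetric]) (simp add: indicator_def, measurable)
  also have "\<dots> = (\<integral>\<^sup>+v. indicator A v * ennreal (exp (- l * v)) \<partial>lborel)"
    by (intro nn_integral_cong, subst nn_integral_cmult)
      (auto simp: emeasure_exponential_Ici[OF l] A_def indicator_def)
  finally have "ennreal l * (\<integral>\<^sup>+x. (\<integral>\<^sup>+v. indicator {v. 0 < v \<and> v \<le> x \<and> Z x v} v \<partial>lborel)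
      \<partial>exponential_measure l) = (\<integral>\<^sup>+v. ennreal l * (indicator A v * ennreal (exp (- l * v))) \<partial>lborel)"
    by (simp add: nn_integral_cmult)
  also have "\<dots> = (\<integral>\<^sup>+v. ennreal (exponential_density l v) * indicator A v \<partial>lborel)"
    using l by (intro nn_integral_cong)
      (auto simp: A_def indicator_def exponential_density_def ennreal_mult[symmetric] algebra_simps)
  also have "\<dots> = (\<integral>\<^sup>+x. indicator A x \<partial>exponential_measure l)"
    by (rule nn_integral_exponential_measure[symmetric]) auto
  finally show ?thesis unfolding A_def by simp
qed

text \<open>Tilting by \<open>exp (- x)\<close> turns the density of rate \<open>l\<close> into
  \<open>l / (1 + l)\<close> times the density of rate \<open>1 + l\<close>. That the value is below
  1 will rule out accumulating arrivals.\<close>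

lemma nn_integral_exponential_laplace:
  assumes "0 < l"
  shows "(\<integral>\<^sup>+x. ennreal (exp (- x)) \<partial>exponential_measure l) = ennreal (l / (1 + l))"
proof -
  have "(\<integral>\<^sup>+x. ennreal (exp (- x)) \<partial>exponential_measure l) =
    (\<integral>\<^sup>+x. ennreal (exponential_density l x) * ennreal (exp (- x)) \<partial>lborel)"
    by (rule nn_integral_exponential_measure) auto
  also have "\<dots> = (\<integral>\<^sup>+x. ennreal (l / (1 + l)) * (ennreal (exponential_density (1 + l) x) * 1) \<partial>lborel)"
    using assms by (intro nn_integral_cong)
      (auto simp: exponential_density_def ennreal_mult[symmetric] exp_add[symmetric] field_simps)
  also have "\<dots> = ennreal (l / (1 + l)) * (\<integral>\<^sup>+x. 1 \<partial>exponential_measure (1 + l))"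
    by (subst nn_integral_cmult) (auto simp: nn_integral_exponential_measure simp del: nn_integral_const)
  also have "(\<integral>\<^sup>+x. 1 \<partial>exponential_measure (1 + l)) = 1"
    using prob_space.emeasure_space_1[OF prob_space_exponential_measure, of "1 + l"] assms by simp
  finally show ?thesis by simp
qed

lemma emeasure_PiM_Collect:
  assumes M: "\<And>i. i \<in> I \<Longrightarrow> prob_space (M i)"
    and J: "J \<subseteq> I" "finite J" and A: "\<And>i. i \<in> J \<Longrightarrow> A i \<in> sets (M i)"
  shows "emeasure (PiM I M) {x \<in> space (PiM I M). \<forall>i\<in>J. x i \<in> A i} = (\<Prod>i\<in>J. emeasure (M i) (A i))"
proof -
  have "{x \<in> space (PiM I M). \<forall>i\<in>J. x i \<in> A i} = prod_emb I M J (Pi\<^sub>E J A)"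
    using J by (auto simp: prod_emb_def space_PiM PiE_iff restrict_def extensional_def)
  then show ?thesis using emeasure_PiM_emb[OF assms] by simp
qed

lemma distr_PiM_resample:
  assumes M: "\<And>i. i \<in> I \<Longrightarrow> prob_space (M i)" and a: "a \<in> I"
  shows "distr (M a \<Otimes>\<^sub>M PiM I M) (PiM I M) (\<lambda>(x, X). X(a := x)) = PiM I M"
  using distr_pair_PiM_eq_PiM[of I M a] M a by (simp add: insert_absorb)

lemma measurable_PiM_upd:
  assumes "a \<in> I"
  shows "(\<lambda>(x, X). X(a := x)) \<in> measurable (M a \<Otimes>\<^sub>M PiM I M) (PiM I M)"
  unfolding split_beta'
  by (rule measurable_fun_upd[where J = I]) (use assms in auto)

lemma measurable_PiM_splice:
  assumes f: "\<And>i. i \<in> I \<Longrightarrow> i \<notin> D \<Longrightarrow> f i \<in> I \<and> M (f i) = M i"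
  shows "(\<lambda>(X, Y). \<lambda>i\<in>I. if i \<in> D then X i else Y (f i)) \<in>
    measurable (PiM I M \<Otimes>\<^sub>M PiM I M) (PiM I M)"
proof (subst split_beta', rule measurable_restrict)
  fix i assume i: "i \<in> I"
  show "(\<lambda>x. if i \<in> D then fst x i else snd x (f i)) \<in> measurable (PiM I M \<Otimes>\<^sub>M PiM I M) (M i)"
  proof (cases "i \<in> D")
    case False
    have "(\<lambda>X. X (f i)) \<in> measurable (PiM I M) (M (f i))"
      using f[OF i False] by (intro measurable_component_singleton) auto
    then have "(\<lambda>X. X (f i)) \<in> measurable (PiM I M) (M i)"
      using f[OF i False] by simp
    then show ?thesis
      using False by (auto intro: measurable_compose[OF measurable_snd])
  qed (use i in simp)
qed

text \<open>Each new coordinate is read from a single coordinate of the pair, and none is read twice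
  because \<open>f\<close> is injective off \<open>D\<close>; independence and marginal laws are
  inherited. On cylinders the preimage is a rectangle, one side for \<open>D\<close> and one for its
  complement.\<close>

lemma distr_PiM_splice:
  assumes M: "\<And>i. i \<in> I \<Longrightarrow> prob_space (M i)"
    and f: "\<And>i. i \<in> I \<Longrightarrow> i \<notin> D \<Longrightarrow> f i \<in> I \<and> M (f i) = M i" and inj: "inj_on f (I - D)"
  shows "distr (PiM I M \<Otimes>\<^sub>M PiM I M) (PiM I M) (\<lambda>(X, Y). \<lambda>i\<in>I. if i \<in> D then X i else Y (f i)) = PiM I M"
    (is "distr ?P _ ?g = _")
proof (rule measure_eqI_PiM_infinite[symmetric, OF refl])
  interpret P: prob_space "PiM I M" by (rule prob_space_PiM[OF M])
  interpret PP: pair_sigma_finite "PiM I M" "PiM I M" ..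
  show "finite_measure (PiM I M)" by unfold_locales
  fix A J assume J: "finite J" "J \<subseteq> I" and A: "\<And>i. i \<in> J \<Longrightarrow> A i \<in> sets (M i)"
  have g: "?g \<in> measurable ?P (PiM I M)" by (rule measurable_PiM_splice[OF f])
  let ?S1 = "{X \<in> space (PiM I M). \<forall>i\<in>J \<inter> D. X i \<in> A i}"
  let ?B = "\<lambda>j. A (the_inv_into (I - D) f j)"
  let ?S2 = "{Y \<in> space (PiM I M). \<forall>j\<in>f ` (J - D). Y j \<in> ?B j}"
  have inv: "the_inv_into (I - D) f (f i) = i" if "i \<in> J" "i \<notin> D" for i
    using that J by (intro the_inv_into_f_f[OF inj]) auto
  have sp: "?g x \<in> space (PiM I M)" if "x \<in> space ?P" for x
    using measurable_space[OF g that] .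
  have "?g -` prod_emb I M J (Pi\<^sub>E J A) \<inter> space ?P = ?S1 \<times> ?S2"
  proof (intro set_eqI)
    fix x
    have "x \<in> ?g -` prod_emb I M J (Pi\<^sub>E J A) \<inter> space ?P \<longleftrightarrow>
       x \<in> space ?P \<and> (\<forall>i\<in>J. ?g x i \<in> A i)"
      using sp[of x] J by (auto simp: prod_emb_def space_PiM PiE_iff)
    also have "\<dots> \<longleftrightarrow> x \<in> ?S1 \<times> ?S2"
      using J inv by (auto simp: split_beta space_pair_measure subset_eq split: if_splits)
    finally show "x \<in> ?g -` prod_emb I M J (Pi\<^sub>E J A) \<inter> space ?P \<longleftrightarrow> x \<in> ?S1 \<times> ?S2" .
  qed
  moreover have B: "?B j \<in> sets (M j)" if "j \<in> f ` (J - D)" for j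
    using that inv A f J by (auto simp: subset_eq)
  have fJ: "f ` (J - D) \<subseteq> I" using f J by auto
  have "?S1 \<in> sets (PiM I M)" "?S2 \<in> sets (PiM I M)"
    using J A B fJ by (auto intro!: sets.sets_Collect_finite_All' simp: subset_eq)
  moreover have "emeasure (PiM I M) ?S1 = (\<Prod>i\<in>J \<inter> D. emeasure (M i) (A i))"
    using J A by (intro emeasure_PiM_Collect M) auto
  moreover have "emeasure (PiM I M) ?S2 = (\<Prod>j\<in>f ` (J - D). emeasure (M j) (?B j))"
    using J B fJ by (intro emeasure_PiM_Collect M) auto
  moreover have "(\<Prod>j\<in>f ` (J - D). emeasure (M j) (?B j)) = (\<Prod>i\<in>J - D. emeasure (M i) (A i))"
    using inj J inv f by (subst prod.reindex) (auto intro: inj_on_subset intro!: prod.cong simp: subset_eq)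
  moreover have "prod_emb I M J (Pi\<^sub>E J A) \<in> sets (PiM I M)"
    using J A by (intro sets_PiM_I) auto
  ultimately have "emeasure (distr ?P (PiM I M) ?g) (prod_emb I M J (Pi\<^sub>E J A)) =
      (\<Prod>i\<in>J \<inter> D. emeasure (M i) (A i)) * (\<Prod>i\<in>J - D. emeasure (M i) (A i))"
    by (simp add: emeasure_distr[OF g] P.emeasure_pair_measure_Times)
  also have "\<dots> = (\<Prod>i\<in>J. emeasure (M i) (A i))"
    using J by (simp add: prod.Int_Diff[of J _ D])
  also have "\<dots> = emeasure (PiM I M) (prod_emb I M J (Pi\<^sub>E J A))"
    using J A by (intro emeasure_PiM_emb[symmetric] M) auto
  finally show "emeasure (PiM I M) (prod_emb I M J (Pi\<^sub>E J A)) =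
    emeasure (distr ?P (PiM I M) ?g) (prod_emb I M J (Pi\<^sub>E J A))" by simp
qed simp

text \<open>This replaces conditioning on all other coordinates: the inner integral sees a fresh
  \<open>x\<close> with everything else frozen.\<close>

lemma nn_integral_PiM_resample:
  assumes M: "\<And>i. i \<in> I \<Longrightarrow> prob_space (M i)" and a: "a \<in> I"
    and F [measurable]: "F \<in> borel_measurable (PiM I M)"
  shows "(\<integral>\<^sup>+X. F X \<partial>PiM I M) = (\<integral>\<^sup>+X. (\<integral>\<^sup>+x. F (X(a := x)) \<partial>M a) \<partial>PiM I M)"
proof -
  interpret A: prob_space "M a" by (rule M[OF a])
  interpret P: prob_space "PiM I M" by (rule prob_space_PiM[OF M])
  interpret PP: pair_sigma_finite "M a" "PiM I M" ..
  note [measurable] = measurable_PiM_upd[OF a]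
  have "(\<integral>\<^sup>+X. F X \<partial>PiM I M) =
      (\<integral>\<^sup>+X. F X \<partial>distr (M a \<Otimes>\<^sub>M PiM I M) (PiM I M) (\<lambda>(x, X). X(a := x)))"
    by (subst distr_PiM_resample[of I M a, OF M a]) auto
  also have "\<dots> = (\<integral>\<^sup>+z. F ((snd z)(a := fst z)) \<partial>(M a \<Otimes>\<^sub>M PiM I M))"
    by (subst nn_integral_distr) (auto simp: split_beta')
  also have "\<dots> = (\<integral>\<^sup>+X. (\<integral>\<^sup>+x. F (X(a := x)) \<partial>M a) \<partial>PiM I M)"
    using measurable_compose[OF measurable_PiM_upd[OF a, of M] F]
    by (subst PP.nn_integral_snd[symmetric]) (auto simp: split_beta')
  finally show ?thesis .
qed

section \<open>The outcome space\<close>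

locale matching_model =
  fixes I :: "'a::countable matching_instance"
  assumes valid: "valid_instance I"
begin

abbreviation "L \<equiv> full_outcome_measure I"
abbreviation "G \<equiv> PiM (agents I) (\<lambda>a. exponential_measure (arr_rate I (fst a)))"
abbreviation "S \<equiv> PiM (agents I) (\<lambda>a. exponential_measure (ab_rate I (fst a)))"
abbreviation "U \<equiv> uniform_measure lborel {0..1::real}"

lemma finite_types: "finite (agent_types I)"
  using valid by (simp add: valid_instance_def)

lemma countable_agents: "countable (agents I)"
  using finite_types by (simp add: agents_def countable_finite)

lemma agents_iff: "a \<in> agents I \<longleftrightarrow> fst a \<in> agent_types I"
  by (cases a) (simp add: agents_def)

lemma rates_pos:
  assumes "i \<in> agent_types I"
  shows "0 < arr_rate I i" "0 < ab_rate I i"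
  using valid assms by (auto simp: valid_instance_def)

lemma prob_space_gap: "a \<in> agents I \<Longrightarrow> prob_space (exponential_measure (arr_rate I (fst a)))"
  by (intro prob_space_exponential_measure rates_pos) (simp add: agents_iff)

lemma prob_space_sojourn: "a \<in> agents I \<Longrightarrow> prob_space (exponential_measure (ab_rate I (fst a)))"
  by (intro prob_space_exponential_measure rates_pos) (simp add: agents_iff)

lemma prob_space_U: "prob_space U"
  by (rule prob_space_uniform_measure) auto

sublocale G: prob_space G by (rule prob_space_PiM) (rule prob_space_gap)
sublocale S: prob_space S by (rule prob_space_PiM) (rule prob_space_sojourn)
sublocale U: prob_space U by (rule prob_space_U)
sublocale SU: pair_prob_space S U ..
sublocale GSU: pair_prob_space G "S \<Otimes>\<^sub>M U" ..

sublocale L: prob_space L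
  unfolding full_outcome_measure_def by unfold_locales

lemma measurable_gap [measurable]: "a \<in> agents I \<Longrightarrow> (\<lambda>\<omega>. gap \<omega> a) \<in> borel_measurable L"
  unfolding gap_def full_outcome_measure_def
  by (rule measurable_compose[OF measurable_fst])
    (use measurable_component_singleton[of a "agents I" "\<lambda>a. exponential_measure (arr_rate I (fst a))"]
      in \<open>simp cong: measurable_cong_sets\<close>)

lemma measurable_sojourn [measurable]: "a \<in> agents I \<Longrightarrow> (\<lambda>\<omega>. sojourn \<omega> a) \<in> borel_measurable L"
  unfolding sojourn_def full_outcome_measure_def
  by (rule measurable_compose[OF measurable_compose[OF measurable_snd measurable_fst]])
    (use measurable_component_singleton[of a "agents I" "\<lambda>a. exponential_measure (ab_rate I (fst a))"]
      in \<open>simp cong: measurable_cong_sets\<close>)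

lemma measurable_arrival [measurable]: "a \<in> agents I \<Longrightarrow> (\<lambda>\<omega>. arrival \<omega> a) \<in> borel_measurable L"
  unfolding arrival_def by (intro borel_measurable_sum measurable_gap) (simp add: agents_iff)

lemma measurable_departure [measurable]: "a \<in> agents I \<Longrightarrow> (\<lambda>\<omega>. departure \<omega> a) \<in> borel_measurable L"
  unfolding departure_def by measurable

text \<open>The time at which the clock \<open>gap\<close> of \<open>a\<close> starts to run: 0 for
  the first agent of a type, otherwise the preceding arrival of that type. It is not affected by
  redrawing the gap of \<open>a\<close>.\<close>

definition prev_arrival :: "'a outcome \<Rightarrow> 'a agent \<Rightarrow> real" where
  "prev_arrival \<omega> a = (\<Sum>l<snd a. gap \<omega> (fst a, l))"

lemma arrival_eq: "arrival \<omega> a = prev_arrival \<omega> a + gap \<omega> a"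
  by (cases a) (simp add: arrival_def prev_arrival_def flip: lessThan_Suc_atMost)

lemma prev_arrival_0: "prev_arrival \<omega> (i, 0) = 0"
  by (simp add: prev_arrival_def)

lemma prev_arrival_Suc: "prev_arrival \<omega> (i, Suc k) = arrival \<omega> (i, k)"
  by (simp add: prev_arrival_def arrival_def lessThan_Suc_atMost)

lemma measurable_prev_arrival [measurable]:
  "a \<in> agents I \<Longrightarrow> (\<lambda>\<omega>. prev_arrival \<omega> a) \<in> borel_measurable L"
  unfolding prev_arrival_def by (intro borel_measurable_sum measurable_gap) (simp add: agents_iff)

section \<open>Redrawing a single gap or sojourn time\<close>

definition upd_gap :: "'a agent \<Rightarrow> 'a outcome \<Rightarrow> real \<Rightarrow> 'a outcome" where
  "upd_gap a \<omega> x = ((fst \<omega>)(a := x), snd \<omega>)"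

definition upd_sojourn :: "'a agent \<Rightarrow> 'a outcome \<Rightarrow> real \<Rightarrow> 'a outcome" where
  "upd_sojourn a \<omega> x = (fst \<omega>, (fst (snd \<omega>))(a := x), snd (snd \<omega>))"

lemma measurable_upd_gap [measurable]:
  assumes a: "a \<in> agents I"
  shows "(\<lambda>(\<omega>, x). upd_gap a \<omega> x) \<in> measurable (L \<Otimes>\<^sub>M borel) L"
proof -
  have "(\<lambda>(\<omega>, x). (fst \<omega>)(a := x)) \<in> measurable (L \<Otimes>\<^sub>M borel) G"
    unfolding full_outcome_measure_def split_beta'
    by (rule measurable_fun_upd[where J = "agents I"]) (use a in auto)
  then show ?thesis
    unfolding full_outcome_measure_def upd_gap_def split_beta' by measurable
qed

lemma measurable_upd_sojourn [measurable]:
  assumes a: "a \<in> agents I"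
  shows "(\<lambda>(\<omega>, x). upd_sojourn a \<omega> x) \<in> measurable (L \<Otimes>\<^sub>M borel) L"
proof -
  have "(\<lambda>(\<omega>, x). (fst (snd \<omega>))(a := x)) \<in> measurable (L \<Otimes>\<^sub>M borel) S"
    unfolding full_outcome_measure_def split_beta'
    by (rule measurable_fun_upd[where J = "agents I"]) (use a in auto)
  then show ?thesis
    unfolding full_outcome_measure_def upd_sojourn_def split_beta' by measurable
qed

text \<open>The gaps form the outermost factor of \<open>L\<close>, whereas the redrawn gap has to
  be integrated innermost; Fubini moves it past the sojourn times and the seed.\<close>

lemma nn_integral_resample_gap:
  assumes a: "a \<in> agents I" and F: "F \<in> borel_measurable L"
  shows "(\<integral>\<^sup>+\<omega>. F \<omega> \<partial>L) =
    (\<integral>\<^sup>+\<omega>. (\<integral>\<^sup>+x. F (upd_gap a \<omega> x) \<partial>exponential_measure (arr_rate I (fst a))) \<partial>L)"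
proof -
  interpret E: prob_space "exponential_measure (arr_rate I (fst a))" by (rule prob_space_gap[OF a])
  interpret SUE: pair_prob_space "exponential_measure (arr_rate I (fst a))" "S \<Otimes>\<^sub>M U" ..
  have F' [measurable]: "F \<in> borel_measurable (G \<Otimes>\<^sub>M (S \<Otimes>\<^sub>M U))"
    using F by (simp add: full_outcome_measure_def)
  have up: "(\<lambda>z. F ((fst (fst z))(a := snd z), snd (fst z))) \<in>
      borel_measurable ((G \<Otimes>\<^sub>M (S \<Otimes>\<^sub>M U)) \<Otimes>\<^sub>M exponential_measure (arr_rate I (fst a)))"
    using measurable_compose[OF measurable_upd_gap[OF a] F]
    unfolding split_beta' upd_gap_def full_outcome_measure_def by (simp cong: measurable_cong_sets)
  have "(\<integral>\<^sup>+\<omega>. F \<omega> \<partial>L) = (\<integral>\<^sup>+p. (\<integral>\<^sup>+q. F (p, q) \<partial>(S \<Otimes>\<^sub>M U)) \<partial>G)"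
    unfolding full_outcome_measure_def by (subst SU.nn_integral_fst[symmetric]) auto
  also have "\<dots> = (\<integral>\<^sup>+p. (\<integral>\<^sup>+x. (\<integral>\<^sup>+q. F (p(a := x), q) \<partial>(S \<Otimes>\<^sub>M U))
      \<partial>exponential_measure (arr_rate I (fst a))) \<partial>G)"
    by (rule nn_integral_PiM_resample[OF prob_space_gap a]) auto
  also have "\<dots> = (\<integral>\<^sup>+p. (\<integral>\<^sup>+q. (\<integral>\<^sup>+x. F (p(a := x), q)
      \<partial>exponential_measure (arr_rate I (fst a))) \<partial>(S \<Otimes>\<^sub>M U)) \<partial>G)"
  proof (rule nn_integral_cong, rule SUE.Fubini'[symmetric])
    fix p assume p: "p \<in> space G"
    have "(\<lambda>z. ((p, snd z), fst z)) \<in> measurable (exponential_measure (arr_rate I (fst a)) \<Otimes>\<^sub>M (S \<Otimes>\<^sub>M U))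
      ((G \<Otimes>\<^sub>M (S \<Otimes>\<^sub>M U)) \<Otimes>\<^sub>M exponential_measure (arr_rate I (fst a)))"
      using p by measurable
    from measurable_compose[OF this up]
    show "(\<lambda>(x, q). F (p(a := x), q)) \<in>
       borel_measurable (exponential_measure (arr_rate I (fst a)) \<Otimes>\<^sub>M (S \<Otimes>\<^sub>M U))"
      by (simp add: split_beta')
  qed
  also have "\<dots> = (\<integral>\<^sup>+\<omega>. (\<integral>\<^sup>+x. F (upd_gap a \<omega> x) \<partial>exponential_measure (arr_rate I (fst a))) \<partial>L)"
    unfolding full_outcome_measure_def upd_gap_def
    using E.borel_measurable_nn_integral_fst[OF up]
    by (subst SU.nn_integral_fst[symmetric]) auto
  finally show ?thesis .
qed

lemma nn_integral_resample_sojourn: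
  assumes a: "a \<in> agents I" and F: "F \<in> borel_measurable L"
  shows "(\<integral>\<^sup>+\<omega>. F \<omega> \<partial>L) =
    (\<integral>\<^sup>+\<omega>. (\<integral>\<^sup>+x. F (upd_sojourn a \<omega> x) \<partial>exponential_measure (ab_rate I (fst a))) \<partial>L)"
proof -
  let ?E = "exponential_measure (ab_rate I (fst a))"
  interpret E: prob_space ?E by (rule prob_space_sojourn[OF a])
  interpret UE: pair_prob_space ?E U ..
  have F' [measurable]: "F \<in> borel_measurable (G \<Otimes>\<^sub>M (S \<Otimes>\<^sub>M U))"
    using F by (simp add: full_outcome_measure_def)
  have up: "(\<lambda>z. F (fst (fst z), (fst (snd (fst z)))(a := snd z), snd (snd (fst z)))) \<in>
      borel_measurable ((G \<Otimes>\<^sub>M (S \<Otimes>\<^sub>M U)) \<Otimes>\<^sub>M ?E)"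
    using measurable_compose[OF measurable_upd_sojourn[OF a] F]
    unfolding split_beta' upd_sojourn_def full_outcome_measure_def by (simp cong: measurable_cong_sets)
  have "(\<integral>\<^sup>+\<omega>. F \<omega> \<partial>L) = (\<integral>\<^sup>+p. (\<integral>\<^sup>+s. (\<integral>\<^sup>+u. F (p, s, u) \<partial>U) \<partial>S) \<partial>G)"
    unfolding full_outcome_measure_def
    by (subst SU.nn_integral_fst[symmetric], simp)
      (intro nn_integral_cong, subst U.nn_integral_fst[symmetric], auto)
  also have "\<dots> = (\<integral>\<^sup>+p. (\<integral>\<^sup>+s. (\<integral>\<^sup>+x. (\<integral>\<^sup>+u. F (p, s(a := x), u) \<partial>U) \<partial>?E) \<partial>S) \<partial>G)"
    by (rule nn_integral_cong, rule nn_integral_PiM_resample[OF prob_space_sojourn a]) auto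
  also have "\<dots> = (\<integral>\<^sup>+p. (\<integral>\<^sup>+s. (\<integral>\<^sup>+u. (\<integral>\<^sup>+x. F (p, s(a := x), u) \<partial>?E) \<partial>U) \<partial>S) \<partial>G)"
  proof (rule nn_integral_cong, rule nn_integral_cong, rule UE.Fubini'[symmetric])
    fix p s assume p: "p \<in> space G" "s \<in> space S"
    have "(\<lambda>z. ((p, s, snd z), fst z)) \<in> measurable (?E \<Otimes>\<^sub>M U) ((G \<Otimes>\<^sub>M (S \<Otimes>\<^sub>M U)) \<Otimes>\<^sub>M ?E)"
      using p by measurable
    from measurable_compose[OF this up]
    show "(\<lambda>(x, u). F (p, s(a := x), u)) \<in> borel_measurable (?E \<Otimes>\<^sub>M U)"
      by (simp add: split_beta')
  qed
  also have "\<dots> = (\<integral>\<^sup>+\<omega>. (\<integral>\<^sup>+x. F (upd_sojourn a \<omega> x) \<partial>?E) \<partial>L)"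
  proof -
    have m [measurable]: "(\<lambda>\<omega>. \<integral>\<^sup>+x. F (fst \<omega>, (fst (snd \<omega>))(a := x), snd (snd \<omega>)) \<partial>?E) \<in>
        borel_measurable (G \<Otimes>\<^sub>M (S \<Otimes>\<^sub>M U))"
      using E.borel_measurable_nn_integral_fst[OF up] by simp
    show ?thesis
      unfolding full_outcome_measure_def upd_sojourn_def
      apply (subst SU.nn_integral_fst[symmetric], simp)
      apply (intro nn_integral_cong)
      subgoal for p
        apply (subst U.nn_integral_fst[symmetric])
        subgoal using measurable_compose[OF measurable_Pair1' m, of p] by simp
        subgoal by simp
        done
      done
  qed
  finally show ?thesis .
qed

section \<open>Regular outcomes have full measure\<close>

abbreviation "regular \<equiv> regular_outcome I"

lemma arrival_Suc: "arrival \<omega> (i, Suc k) = arrival \<omega> (i, k) + gap \<omega> (i, Suc k)"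
  by (simp add: arrival_def)

lemma regular_gap_pos: "regular \<omega> \<Longrightarrow> a \<in> agents I \<Longrightarrow> 0 < gap \<omega> a"
  by (simp add: regular_outcome_def)

lemma regular_sojourn_pos: "regular \<omega> \<Longrightarrow> a \<in> agents I \<Longrightarrow> 0 < sojourn \<omega> a"
  by (simp add: regular_outcome_def)

lemma regular_finite: "regular \<omega> \<Longrightarrow> finite {a \<in> agents I. arrival \<omega> a \<le> t}"
  by (simp add: regular_outcome_def)

lemma strict_mono_arrival:
  assumes "\<forall>a\<in>agents I. 0 < gap \<omega> a" "i \<in> agent_types I"
  shows "strict_mono (\<lambda>k. arrival \<omega> (i, k))"
  using assms by (intro strict_monoI_Suc) (simp add: arrival_Suc agents_iff)

lemma prev_arrival_nonneg:
  assumes "regular \<omega>" "a \<in> agents I"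
  shows "0 \<le> prev_arrival \<omega> a"
  unfolding prev_arrival_def
  by (intro sum_nonneg less_imp_le regular_gap_pos) (use assms in \<open>auto simp: agents_iff\<close>)

lemma arrival_pos:
  assumes "regular \<omega>" "a \<in> agents I"
  shows "0 < arrival \<omega> a"
  using prev_arrival_nonneg[OF assms] regular_gap_pos[OF assms] by (simp add: arrival_eq)

text \<open>With positive gaps, finitely many arrivals up to every real time means unbounded
  arrivals of each of the finitely many types. This form involves only countably many conditions, so
  it is measurable and can be checked almost surely one condition at a time.\<close>

lemma regular_iff:
  "regular \<omega> \<longleftrightarrow> (\<forall>a\<in>agents I. 0 < gap \<omega> a \<and> 0 < sojourn \<omega> a) \<and>
     (\<forall>i\<in>agent_types I. \<forall>n::nat. \<exists>k. real n < arrival \<omega> (i, k))" (is "_ \<longleftrightarrow> ?P \<and> ?Q")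
proof
  assume r: "regular \<omega>"
  have "\<exists>k. real n < arrival \<omega> (i, k)" if i: "i \<in> agent_types I" for i n
  proof (rule ccontr)
    assume "\<nexists>k. real n < arrival \<omega> (i, k)"
    then have "range (Pair i) \<subseteq> {a \<in> agents I. arrival \<omega> a \<le> real n}"
      using i by (auto simp: agents_iff not_less)
    then have "finite (range (Pair i :: nat \<Rightarrow> _))"
      using regular_finite[OF r] by (rule finite_subset)
    then show False
      by (simp add: finite_image_iff inj_on_def)
  qed
  then show "?P \<and> ?Q"
    using r by (auto simp: regular_outcome_def)
next
  assume r: "?P \<and> ?Q"
  have "finite {a \<in> agents I. arrival \<omega> a \<le> t}" for t
  proof -
    obtain n :: nat where n: "t \<le> real n"
      using real_arch_simple by blast
    have "\<forall>i\<in>agent_types I. \<exists>k. real n < arrival \<omega> (i, k)"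
      using r by blast
    then obtain m where m: "\<And>i. i \<in> agent_types I \<Longrightarrow> real n < arrival \<omega> (i, m i)"
      by metis
    have "k \<le> m i" if "i \<in> agent_types I" "arrival \<omega> (i, k) \<le> t" for i k
    proof (rule ccontr)
      assume "\<not> k \<le> m i"
      then have "arrival \<omega> (i, m i) < arrival \<omega> (i, k)"
        using strict_mono_arrival[of \<omega> i, THEN strict_monoD, of "m i" k] r that by simp
      then show False using m[of i] that n by simp
    qed
    then have "{a \<in> agents I. arrival \<omega> a \<le> t} \<subseteq> (SIGMA i:agent_types I. {..m i})"
      by (auto simp: agents_iff)
    then show ?thesis
      by (rule finite_subset) (use finite_types in auto)
  qed
  then show "regular \<omega>" using r by (auto simp: regular_outcome_def)
qed

lemma pred_regular [measurable]: "Measurable.pred L regular"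
proof -
  have "Measurable.pred L (\<lambda>\<omega>. \<forall>a\<in>agents I. 0 < gap \<omega> a \<and> 0 < sojourn \<omega> a)"
    by (rule pred_intros_countable_bounded) measurable
  moreover have "Measurable.pred L (\<lambda>\<omega>. \<forall>i\<in>agent_types I. \<forall>n::nat. \<exists>k. real n < arrival \<omega> (i, k))"
  proof (rule pred_intros_countable_bounded)
    fix i assume "i \<in> agent_types I"
    then have [measurable]: "(\<lambda>\<omega>. arrival \<omega> (i, k)) \<in> borel_measurable L" for k
      by (simp add: agents_iff)
    show "Measurable.pred L (\<lambda>\<omega>. \<forall>n::nat. \<exists>k. real n < arrival \<omega> (i, k))"
      by measurable
  qed
  ultimately have "Measurable.pred L (\<lambda>\<omega>. (\<forall>a\<in>agents I. 0 < gap \<omega> a \<and> 0 < sojourn \<omega> a) \<and>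
     (\<forall>i\<in>agent_types I. \<forall>n::nat. \<exists>k. real n < arrival \<omega> (i, k)))"
    by (rule pred_intros_logic)
  then show ?thesis unfolding regular_iff by simp
qed

lemma regular_ex_arrival_gt:
  assumes "regular \<omega>" "i \<in> agent_types I"
  shows "\<exists>k. t < arrival \<omega> (i, k)"
proof -
  obtain n :: nat where "t \<le> real n" using real_arch_simple by blast
  moreover obtain k where "real n < arrival \<omega> (i, k)"
    using assms unfolding regular_iff by blast
  ultimately show ?thesis by (intro exI[of _ k]) simp
qed

lemma gap_upd_gap [simp]: "gap (upd_gap a \<omega> x) b = (if b = a then x else gap \<omega> b)"
  by (simp add: gap_def upd_gap_def)

lemma sojourn_upd_gap [simp]: "sojourn (upd_gap a \<omega> x) = sojourn \<omega>"
  by (simp add: sojourn_def upd_gap_def)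

lemma seed_upd_gap [simp]: "seed (upd_gap a \<omega> x) = seed \<omega>"
  by (simp add: seed_def upd_gap_def)

lemma gap_upd_sojourn [simp]: "gap (upd_sojourn a \<omega> x) = gap \<omega>"
  by (simp add: gap_def upd_sojourn_def)

lemma sojourn_upd_sojourn [simp]: "sojourn (upd_sojourn a \<omega> x) b = (if b = a then x else sojourn \<omega> b)"
  by (simp add: sojourn_def upd_sojourn_def)

lemma seed_upd_sojourn [simp]: "seed (upd_sojourn a \<omega> x) = seed \<omega>"
  by (simp add: seed_def upd_sojourn_def)

lemma arrival_upd_sojourn [simp]: "arrival (upd_sojourn a \<omega> x) = arrival \<omega>"
  by (simp add: arrival_def fun_eq_iff)

lemma prev_arrival_upd_gap [simp]: "prev_arrival (upd_gap a \<omega> x) a = prev_arrival \<omega> a"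
  unfolding prev_arrival_def by (intro sum.cong) (auto simp: prod_eq_iff)

lemma arrival_upd_gap_same: "arrival (upd_gap a \<omega> x) a = prev_arrival \<omega> a + x"
  by (simp add: arrival_eq)

lemma arrival_upd_gap:
  "arrival (upd_gap a \<omega> x) b =
    arrival \<omega> b + (if fst b = fst a \<and> snd a \<le> snd b then x - gap \<omega> a else 0)"
proof (cases "fst b = fst a \<and> snd a \<le> snd b")
  case True
  have "arrival (upd_gap a \<omega> x) b = (\<Sum>l\<le>snd b. gap \<omega> (fst b, l) + (if l = snd a then x - gap \<omega> a else 0))"
    unfolding arrival_def by (intro sum.cong) (use True in \<open>auto simp: prod_eq_iff\<close>)
  also have "\<dots> = arrival \<omega> b + (x - gap \<omega> a)"
    using True by (simp add: sum.distrib arrival_def)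
  finally show ?thesis using True by simp
next
  case False
  then have "arrival (upd_gap a \<omega> x) b = arrival \<omega> b"
    unfolding arrival_def by (intro sum.cong) (auto simp: prod_eq_iff)
  then show ?thesis unfolding if_not_P[OF False] by simp
qed

text \<open>Two values of the gap give arrivals that differ by at most
  \<open>\<bar>x - y\<bar>\<close>, so unboundedness passes from one to the other. Regularity
  therefore reveals nothing about a redrawn gap except that it is positive.\<close>

lemma regular_upd_gap:
  assumes r: "regular (upd_gap a \<omega> x)" and y: "0 < y"
  shows "regular (upd_gap a \<omega> y)"
proof -
  have "\<exists>k. real n < arrival (upd_gap a \<omega> y) (i, k)" if i: "i \<in> agent_types I" for i n
  proof -
    obtain k where "real n + \<bar>x - y\<bar> < arrival (upd_gap a \<omega> x) (i, k)"
      using regular_ex_arrival_gt[OF r i] by blast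
    then show ?thesis
      by (intro exI[of _ k]) (auto simp: arrival_upd_gap split: if_splits)
  qed
  then show ?thesis
    using r y unfolding regular_iff[of "upd_gap a \<omega> y"] by (auto simp: regular_iff)
qed

lemma regular_upd_sojourn:
  assumes r: "regular (upd_sojourn a \<omega> x)" and y: "0 < y"
  shows "regular (upd_sojourn a \<omega> y)"
  using r y by (auto simp: regular_iff)

lemma AE_gap:
  assumes "a \<in> agents I" "AE x in exponential_measure (arr_rate I (fst a)). P x"
    and [measurable]: "Measurable.pred borel P"
  shows "AE \<omega> in L. P (gap \<omega> a)"
proof -
  have "(\<integral>\<^sup>+\<omega>. indicator {\<omega>. \<not> P (gap \<omega> a)} \<omega> \<partial>L) =
    (\<integral>\<^sup>+\<omega>. (\<integral>\<^sup>+x. indicator {x. \<not> P x} x \<partial>exponential_measure (arr_rate I (fst a))) \<partial>L)"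
    using assms(1)
    by (subst nn_integral_resample_gap[OF assms(1)], measurable) (intro nn_integral_cong, simp add: indicator_def)
  also have "(\<integral>\<^sup>+x. indicator {x. \<not> P x} x \<partial>exponential_measure (arr_rate I (fst a))) = 0"
    using assms(2) by (subst nn_integral_0_iff_AE) (auto simp: indicator_def)
  finally have "(\<integral>\<^sup>+\<omega>. indicator {\<omega>. \<not> P (gap \<omega> a)} \<omega> \<partial>L) = 0"
    by simp
  then show ?thesis
    using assms(1) by (subst (asm) nn_integral_0_iff_AE) (auto simp: indicator_def)
qed

lemma AE_sojourn:
  assumes "a \<in> agents I" "AE x in exponential_measure (ab_rate I (fst a)). P x"
    and [measurable]: "Measurable.pred borel P"
  shows "AE \<omega> in L. P (sojourn \<omega> a)"
proof -
  have "(\<integral>\<^sup>+\<omega>. indicator {\<omega>. \<not> P (sojourn \<omega> a)} \<omega> \<partial>L) =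
    (\<integral>\<^sup>+\<omega>. (\<integral>\<^sup>+x. indicator {x. \<not> P x} x \<partial>exponential_measure (ab_rate I (fst a))) \<partial>L)"
    using assms(1)
    by (subst nn_integral_resample_sojourn[OF assms(1)], measurable) (intro nn_integral_cong, simp add: indicator_def)
  also have "(\<integral>\<^sup>+x. indicator {x. \<not> P x} x \<partial>exponential_measure (ab_rate I (fst a))) = 0"
    using assms(2) by (subst nn_integral_0_iff_AE) (auto simp: indicator_def)
  finally have "(\<integral>\<^sup>+\<omega>. indicator {\<omega>. \<not> P (sojourn \<omega> a)} \<omega> \<partial>L) = 0"
    by simp
  then show ?thesis
    using assms(1) by (subst (asm) nn_integral_0_iff_AE) (auto simp: indicator_def)
qed

lemma AE_exponential_pos:
  assumes "0 < l"
  shows "AE x in exponential_measure l. 0 < x"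
proof -
  interpret prob_space "exponential_measure l" by (rule prob_space_exponential_measure[OF assms])
  have "emeasure (exponential_measure l) {0<..} = 1"
    using emeasure_exponential_Ioi[OF assms, of 0] by simp
  then have "prob {0<..} = 1" by (simp add: measure_def)
  then show ?thesis by (subst (asm) prob_eq_1) auto
qed

text \<open>The \<open>k\<close>-th arrival is a sum of \<open>Suc k\<close> independent gaps;
  redrawing the last one splits off its Laplace factor.\<close>

lemma nn_integral_exp_arrival:
  assumes i: "i \<in> agent_types I"
  shows "(\<integral>\<^sup>+\<omega>. ennreal (exp (- arrival \<omega> (i, k))) \<partial>L) =
    ennreal ((arr_rate I i / (1 + arr_rate I i)) ^ Suc k)"
proof (induction k)
  case 0
  have "(\<integral>\<^sup>+\<omega>. ennreal (exp (- arrival \<omega> (i, 0))) \<partial>L) =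
    (\<integral>\<^sup>+\<omega>. (\<integral>\<^sup>+x. ennreal (exp (- x)) \<partial>exponential_measure (arr_rate I i)) \<partial>L)"
    using i by (subst nn_integral_resample_gap[of "(i, 0)"]) (auto simp: arrival_upd_gap_same prev_arrival_0 agents_iff)
  then show ?case
    by (simp add: nn_integral_exponential_laplace rates_pos[OF i] L.emeasure_space_1)
next
  case (Suc k)
  let ?E = "exponential_measure (arr_rate I i)"
  have "(\<integral>\<^sup>+\<omega>. ennreal (exp (- arrival \<omega> (i, Suc k))) \<partial>L) =
    (\<integral>\<^sup>+\<omega>. (\<integral>\<^sup>+x. ennreal (exp (- arrival \<omega> (i, k))) * ennreal (exp (- x)) \<partial>?E) \<partial>L)"
    using i
    by (subst nn_integral_resample_gap[of "(i, Suc k)"])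
      (auto simp: arrival_upd_gap_same prev_arrival_Suc agents_iff ennreal_mult[symmetric] exp_add[symmetric]
        intro!: nn_integral_cong)
  also have "\<dots> = (\<integral>\<^sup>+\<omega>. ennreal (exp (- arrival \<omega> (i, k))) * ennreal (arr_rate I i / (1 + arr_rate I i)) \<partial>L)"
    by (subst nn_integral_cmult) (auto simp: nn_integral_exponential_laplace rates_pos[OF i] cong: measurable_cong_sets)
  also have "\<dots> = ennreal ((arr_rate I i / (1 + arr_rate I i)) ^ Suc k) * ennreal (arr_rate I i / (1 + arr_rate I i))"
    using i by (subst nn_integral_multc) (auto simp: Suc.IH agents_iff)
  also have "\<dots> = ennreal ((arr_rate I i / (1 + arr_rate I i)) ^ Suc (Suc k))"
    using rates_pos[OF i] by (subst ennreal_mult[symmetric]) (auto simp: mult_ac)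
  finally show ?case .
qed

text \<open>A Chernoff bound: if all arrivals stay below \<open>n\<close>, each
  \<open>exp (- arrival \<omega> (i, k))\<close> is at least \<open>exp (- real n)\<close>, while
  its expectation decays geometrically in \<open>k\<close>.\<close>

lemma AE_arrivals_unbounded:
  assumes i: "i \<in> agent_types I"
  shows "AE \<omega> in L. \<exists>k. real n < arrival \<omega> (i, k)"
proof -
  let ?c = "arr_rate I i / (1 + arr_rate I i)"
  let ?B = "{\<omega> \<in> space L. \<forall>k. arrival \<omega> (i, k) \<le> real n}"
  have [measurable]: "(\<lambda>\<omega>. arrival \<omega> (i, k)) \<in> borel_measurable L" for k
    using i by (simp add: agents_iff)
  have B: "?B \<in> sets L" by measurable
  have "ennreal (exp (- real n)) * emeasure L ?B \<le> ennreal (?c ^ Suc k)" for k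
  proof -
    have "ennreal (exp (- real n)) * emeasure L ?B =
        (\<integral>\<^sup>+\<omega>. ennreal (exp (- real n)) * indicator ?B \<omega> \<partial>L)"
      using B by (subst nn_integral_cmult) auto
    also have "\<dots> \<le> (\<integral>\<^sup>+\<omega>. ennreal (exp (- arrival \<omega> (i, k))) \<partial>L)"
      by (intro nn_integral_mono) (auto simp: indicator_def intro!: ennreal_leI)
    finally show ?thesis by (simp only: nn_integral_exp_arrival[OF i])
  qed
  moreover have "(\<lambda>k. ennreal (?c ^ Suc k)) \<longlonglongrightarrow> ennreal 0"
    using rates_pos[OF i] by (intro tendsto_ennrealI LIMSEQ_Suc LIMSEQ_power_zero) auto
  ultimately have "ennreal (exp (- real n)) * emeasure L ?B \<le> 0"
    by (intro LIMSEQ_le_const[of "\<lambda>k. ennreal (?c ^ Suc k)"]) auto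
  then have "emeasure L ?B = 0" by auto
  then show ?thesis
    using B by (intro AE_I[of _ _ ?B]) (auto simp: not_less)
qed

lemma AE_regular: "AE \<omega> in L. regular \<omega>"
proof -
  have "AE \<omega> in L. \<forall>a\<in>agents I. 0 < gap \<omega> a"
    by (subst AE_ball_countable[OF countable_agents])
      (auto intro!: AE_gap AE_exponential_pos rates_pos simp: agents_iff)
  moreover have "AE \<omega> in L. \<forall>a\<in>agents I. 0 < sojourn \<omega> a"
    by (subst AE_ball_countable[OF countable_agents])
      (auto intro!: AE_sojourn AE_exponential_pos rates_pos simp: agents_iff)
  moreover have "AE \<omega> in L. \<forall>i\<in>agent_types I. \<forall>n::nat. \<exists>k. real n < arrival \<omega> (i, k)"
    by (subst AE_ball_countable[OF countable_finite[OF finite_types]])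
      (auto intro!: AE_arrivals_unbounded simp: AE_all_countable)
  ultimately show ?thesis
    unfolding regular_iff by eventually_elim auto
qed

section \<open>Compensators of the arrival and departure clocks\<close>

lemma nn_integral_interval_shift:
  fixes R :: "real \<Rightarrow> bool" and p g :: real
  assumes [measurable]: "Measurable.pred borel R"
  shows "(\<integral>\<^sup>+v. indicator {v. 0 < v \<and> v \<le> g \<and> R (p + v)} v \<partial>lborel) =
    (\<integral>\<^sup>+u. indicator {u. p < u \<and> u \<le> p + g \<and> R u} u \<partial>lborel)"
  by (subst (2) nn_integral_real_affine[where c = 1 and t = p], measurable)
    (simp only: abs_one ennreal_1 mult_1, intro nn_integral_cong, simp add: indicator_def)

text \<open>If whether \<open>Q\<close> holds up to the time \<open>e\<close> does not depend on the exponential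
  variable \<open>e - p\<close>, then \<open>Q\<close> holds at time \<open>e\<close> with hazard rate \<open>l\<close>.\<close>

lemma resampled_compensator:
  fixes p e :: "'a outcome \<Rightarrow> real"
  assumes l: "0 < l"
    and upd: "(\<lambda>(\<omega>, x). upd \<omega> x) \<in> measurable (L \<Otimes>\<^sub>M borel) L"
    and resample: "\<And>F :: 'a outcome \<Rightarrow> ennreal. F \<in> borel_measurable L \<Longrightarrow>
      (\<integral>\<^sup>+\<omega>. F \<omega> \<partial>L) = (\<integral>\<^sup>+\<omega>. (\<integral>\<^sup>+x. F (upd \<omega> x) \<partial>exponential_measure l) \<partial>L)"
    and p [measurable]: "p \<in> borel_measurable L" and e [measurable]: "e \<in> borel_measurable L"
    and p_upd: "\<And>\<omega> x. p (upd \<omega> x) = p \<omega>" and e_upd: "\<And>\<omega> x. e (upd \<omega> x) = p \<omega> + x"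
    and Q [measurable]: "Measurable.pred (L \<Otimes>\<^sub>M borel) (\<lambda>z. Q (fst z) (snd z))"
    and pred: "\<And>\<omega> v x. \<omega> \<in> space L \<Longrightarrow> 0 < v \<Longrightarrow> v \<le> x \<Longrightarrow> Q (upd \<omega> x) (p \<omega> + v) = Q (upd \<omega> v) (p \<omega> + v)"
  shows "emeasure L {\<omega> \<in> space L. p \<omega> < e \<omega> \<and> Q \<omega> (e \<omega>)} =
    ennreal l * (\<integral>\<^sup>+\<omega>. (\<integral>\<^sup>+u. indicator {u. p \<omega> < u \<and> u \<le> e \<omega> \<and> Q \<omega> u} u \<partial>lborel) \<partial>L)"
proof -
  let ?E = "exponential_measure l"
  interpret E: prob_space ?E by (rule prob_space_exponential_measure[OF l])
  \<comment> \<open>\<open>J\<close> is the time for which \<open>Q\<close> holds while the clock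
    runs, in absolute time \<open>u\<close>; the one-variable identity below measures it by the age
    \<open>u - p \<omega>\<close> of the clock.\<close>
  define J where "J \<omega> = (\<integral>\<^sup>+u. indicator {u. p \<omega> < u \<and> u \<le> e \<omega> \<and> Q \<omega> u} u \<partial>lborel)" for \<omega>
  have [measurable]: "Measurable.pred L (\<lambda>\<omega>. Q \<omega> (e \<omega>))"
    using measurable_compose[OF _ Q, of "\<lambda>\<omega>. (\<omega>, e \<omega>)" L] by simp
  have up: "upd \<omega> \<in> measurable borel L" if "\<omega> \<in> space L" for \<omega>
    using measurable_compose[OF measurable_Pair1'[OF that] upd] by simp
  have J: "J \<in> borel_measurable L"
    unfolding J_def
  proof (rule lborel.borel_measurable_nn_integral)
    show "(\<lambda>(\<omega>, u). indicator {u. p \<omega> < u \<and> u \<le> e \<omega> \<and> Q \<omega> u} u) \<in> borel_measurable (L \<Otimes>\<^sub>M lborel)"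
      unfolding indicator_def split_beta' by simp measurable
  qed
  have "emeasure L {\<omega> \<in> space L. p \<omega> < e \<omega> \<and> Q \<omega> (e \<omega>)} =
      (\<integral>\<^sup>+\<omega>. indicator {\<omega> \<in> space L. p \<omega> < e \<omega> \<and> Q \<omega> (e \<omega>)} \<omega> \<partial>L)"
    by (subst nn_integral_indicator) auto
  also have "\<dots> = (\<integral>\<^sup>+\<omega>. (\<integral>\<^sup>+x. indicator {\<omega> \<in> space L. p \<omega> < e \<omega> \<and> Q \<omega> (e \<omega>)} (upd \<omega> x) \<partial>?E) \<partial>L)"
    by (rule resample) auto
  also have "\<dots> = (\<integral>\<^sup>+\<omega>. (\<integral>\<^sup>+x. indicator {x. 0 < x \<and> Q (upd \<omega> x) (p \<omega> + x)} x \<partial>?E) \<partial>L)"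
    using measurable_space[OF up]
    by (intro nn_integral_cong) (auto simp: indicator_def p_upd e_upd)
  also have "\<dots> = (\<integral>\<^sup>+\<omega>. ennreal l * (\<integral>\<^sup>+x. J (upd \<omega> x) \<partial>?E) \<partial>L)"
  proof (rule nn_integral_cong)
    fix \<omega> assume w: "\<omega> \<in> space L"
    have m: "Measurable.pred borel (\<lambda>x. Q (upd \<omega> x) (p \<omega> + x))"
      using measurable_compose[OF _ Q, of "\<lambda>x. (upd \<omega> x, p \<omega> + x)" borel] up[OF w] by simp
    have "(\<integral>\<^sup>+x. indicator {x. 0 < x \<and> Q (upd \<omega> x) (p \<omega> + x)} x \<partial>?E) =
        ennreal l * (\<integral>\<^sup>+x. (\<integral>\<^sup>+v. indicator {v. 0 < v \<and> v \<le> x \<and> Q (upd \<omega> x) (p \<omega> + v)} v \<partial>lborel) \<partial>?E)"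
      by (rule exponential_compensator[where Z = "\<lambda>x v. Q (upd \<omega> x) (p \<omega> + v)", OF l m pred[OF w]])
    also have "(\<integral>\<^sup>+x. (\<integral>\<^sup>+v. indicator {v. 0 < v \<and> v \<le> x \<and> Q (upd \<omega> x) (p \<omega> + v)} v \<partial>lborel) \<partial>?E) =
        (\<integral>\<^sup>+x. J (upd \<omega> x) \<partial>?E)"
    proof (rule nn_integral_cong)
      fix x
      have "Measurable.pred borel (Q (upd \<omega> x))"
        using measurable_compose[OF measurable_Pair1' Q, of "upd \<omega> x"] measurable_space[OF up[OF w]] by simp
      from nn_integral_interval_shift[OF this, of x "p \<omega>"]
      show "(\<integral>\<^sup>+v. indicator {v. 0 < v \<and> v \<le> x \<and> Q (upd \<omega> x) (p \<omega> + v)} v \<partial>lborel) = J (upd \<omega> x)"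
        by (simp add: J_def p_upd e_upd)
    qed
    finally show "(\<integral>\<^sup>+x. indicator {x. 0 < x \<and> Q (upd \<omega> x) (p \<omega> + x)} x \<partial>?E) =
        ennreal l * (\<integral>\<^sup>+x. J (upd \<omega> x) \<partial>?E)" .
  qed
  also have "\<dots> = ennreal l * (\<integral>\<^sup>+\<omega>. (\<integral>\<^sup>+x. J (upd \<omega> x) \<partial>?E) \<partial>L)"
  proof (rule nn_integral_cmult, rule E.borel_measurable_nn_integral)
    show "(\<lambda>(\<omega>, x). J (upd \<omega> x)) \<in> borel_measurable (L \<Otimes>\<^sub>M ?E)"
      using measurable_compose[OF upd J] by (simp add: split_beta' cong: measurable_cong_sets)
  qed
  also have "\<dots> = ennreal l * (\<integral>\<^sup>+\<omega>. J \<omega> \<partial>L)"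
    by (simp add: resample[OF J])
  finally show ?thesis by (simp add: J_def)
qed

lemma gap_compensator:
  assumes a: "a \<in> agents I"
    and Q: "Measurable.pred (L \<Otimes>\<^sub>M borel) (\<lambda>z. Q (fst z) (snd z))"
    and pred: "\<And>\<omega> v x. \<omega> \<in> space L \<Longrightarrow> 0 < v \<Longrightarrow> v \<le> x \<Longrightarrow>
      Q (upd_gap a \<omega> x) (prev_arrival \<omega> a + v) = Q (upd_gap a \<omega> v) (prev_arrival \<omega> a + v)"
  shows "emeasure L {\<omega> \<in> space L. prev_arrival \<omega> a < arrival \<omega> a \<and> Q \<omega> (arrival \<omega> a)} =
    ennreal (arr_rate I (fst a)) *
    (\<integral>\<^sup>+\<omega>. (\<integral>\<^sup>+u. indicator {u. prev_arrival \<omega> a < u \<and> u \<le> arrival \<omega> a \<and> Q \<omega> u} u \<partial>lborel) \<partial>L)"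
  by (rule resampled_compensator[OF _ measurable_upd_gap[OF a] nn_integral_resample_gap[OF a] _ _ _ _ Q pred])
    (use a in \<open>auto simp: agents_iff arrival_upd_gap_same
      intro!: rates_pos measurable_prev_arrival measurable_arrival\<close>)

lemma sojourn_compensator:
  assumes a: "a \<in> agents I"
    and Q: "Measurable.pred (L \<Otimes>\<^sub>M borel) (\<lambda>z. Q (fst z) (snd z))"
    and pred: "\<And>\<omega> v x. \<omega> \<in> space L \<Longrightarrow> 0 < v \<Longrightarrow> v \<le> x \<Longrightarrow>
      Q (upd_sojourn a \<omega> x) (arrival \<omega> a + v) = Q (upd_sojourn a \<omega> v) (arrival \<omega> a + v)"
  shows "emeasure L {\<omega> \<in> space L. arrival \<omega> a < departure \<omega> a \<and> Q \<omega> (departure \<omega> a)} =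
    ennreal (ab_rate I (fst a)) *
    (\<integral>\<^sup>+\<omega>. (\<integral>\<^sup>+u. indicator {u. arrival \<omega> a < u \<and> u \<le> departure \<omega> a \<and> Q \<omega> u} u \<partial>lborel) \<partial>L)"
  by (rule resampled_compensator[OF _ measurable_upd_sojourn[OF a] nn_integral_resample_sojourn[OF a] _ _ _ _ Q pred])
    (use a in \<open>auto simp: agents_iff departure_def[of "upd_sojourn a _ _"]
      intro!: rates_pos measurable_arrival measurable_departure\<close>)

lemma prev_arrival_intervals_disjoint:
  assumes r: "regular \<omega>" and i: "i \<in> agent_types I"
  shows "disjoint_family (\<lambda>k. {prev_arrival \<omega> (i, k)<..arrival \<omega> (i, k)})"
proof -
  have "{prev_arrival \<omega> (i, k)<..arrival \<omega> (i, k)} \<inter> {prev_arrival \<omega> (i, l)<..arrival \<omega> (i, l)} = {}"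
    if kl: "k < l" for k l
  proof -
    obtain m where m: "l = Suc m" "k \<le> m" using less_imp_Suc_add[OF kl] by auto
    have "arrival \<omega> (i, k) \<le> arrival \<omega> (i, m)"
      using strict_mono_arrival[of \<omega> i, THEN strict_mono_less_eq, of k m] r i m
      by (simp add: regular_outcome_def)
    then show ?thesis using m by (auto simp: prev_arrival_Suc)
  qed
  then show ?thesis
    unfolding disjoint_family_on_def by (metis Int_commute linorder_neqE_nat)
qed

text \<open>The intervals between successive arrivals of a type are disjoint, so the times for which
  \<open>Q\<close> holds during the single gaps add up to at most the total time. In effect, the
  arrivals of type \<open>i\<close> find \<open>Q\<close> true at rate at most
  \<open>arr_rate I i\<close>, whatever else \<open>Q\<close> depends on.\<close>

lemma suminf_gap_compensator_le:
  assumes i: "i \<in> agent_types I"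
    and Q [measurable]: "Measurable.pred (L \<Otimes>\<^sub>M borel) (\<lambda>z. Q (fst z) (snd z))"
    and pred: "\<And>k \<omega> v x. \<omega> \<in> space L \<Longrightarrow> 0 < v \<Longrightarrow> v \<le> x \<Longrightarrow>
      Q (upd_gap (i, k) \<omega> x) (prev_arrival \<omega> (i, k) + v) = Q (upd_gap (i, k) \<omega> v) (prev_arrival \<omega> (i, k) + v)"
    and reg: "\<And>\<omega> u. Q \<omega> u \<Longrightarrow> regular \<omega>"
  shows "(\<Sum>k. emeasure L {\<omega> \<in> space L. Q \<omega> (arrival \<omega> (i, k))}) \<le>
    ennreal (arr_rate I i) * (\<integral>\<^sup>+\<omega>. (\<integral>\<^sup>+u. indicator {u. 0 < u \<and> Q \<omega> u} u \<partial>lborel) \<partial>L)"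
proof -
  have a: "(i, k) \<in> agents I" for k using i by (simp add: agents_iff)
  note [measurable] = measurable_arrival[OF a] measurable_prev_arrival[OF a]
  let ?f = "\<lambda>k \<omega> u. indicator {u. prev_arrival \<omega> (i, k) < u \<and> u \<le> arrival \<omega> (i, k) \<and> Q \<omega> u} u :: ennreal"
  have f: "(\<lambda>(\<omega>, u). ?f k \<omega> u) \<in> borel_measurable (L \<Otimes>\<^sub>M lborel)" for k
    unfolding indicator_def split_beta' by simp measurable
  have f': "?f k \<omega> \<in> borel_measurable lborel" if "\<omega> \<in> space L" for k \<omega>
    using measurable_compose[OF measurable_Pair1'[OF that] f] by simp
  have pos: "prev_arrival \<omega> (i, k) < arrival \<omega> (i, k)" if "Q \<omega> u" for \<omega> k u
    using regular_gap_pos[OF reg[OF that] a] by (simp add: arrival_eq)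
  have "(\<Sum>k. emeasure L {\<omega> \<in> space L. Q \<omega> (arrival \<omega> (i, k))}) =
      (\<Sum>k. emeasure L {\<omega> \<in> space L. prev_arrival \<omega> (i, k) < arrival \<omega> (i, k) \<and> Q \<omega> (arrival \<omega> (i, k))})"
    using pos by (intro suminf_cong arg_cong[where f = "emeasure L"]) auto
  also have "\<dots> = (\<Sum>k. ennreal (arr_rate I i) * (\<integral>\<^sup>+\<omega>. (\<integral>\<^sup>+u. ?f k \<omega> u \<partial>lborel) \<partial>L))"
    by (intro suminf_cong, subst gap_compensator[OF a Q pred]) simp_all
  also have "\<dots> = ennreal (arr_rate I i) * (\<Sum>k. \<integral>\<^sup>+\<omega>. (\<integral>\<^sup>+u. ?f k \<omega> u \<partial>lborel) \<partial>L)"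
    by simp
  also have "(\<Sum>k. \<integral>\<^sup>+\<omega>. (\<integral>\<^sup>+u. ?f k \<omega> u \<partial>lborel) \<partial>L) = (\<integral>\<^sup>+\<omega>. (\<Sum>k. \<integral>\<^sup>+u. ?f k \<omega> u \<partial>lborel) \<partial>L)"
    by (rule nn_integral_suminf[symmetric]) (rule lborel.borel_measurable_nn_integral[OF f])
  also have "\<dots> = (\<integral>\<^sup>+\<omega>. (\<integral>\<^sup>+u. (\<Sum>k. ?f k \<omega> u) \<partial>lborel) \<partial>L)"
    by (intro nn_integral_cong nn_integral_suminf[symmetric] f')
  also have "\<dots> \<le> (\<integral>\<^sup>+\<omega>. (\<integral>\<^sup>+u. indicator {u. 0 < u \<and> Q \<omega> u} u \<partial>lborel) \<partial>L)"
  proof (intro nn_integral_mono)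
    fix \<omega> u
    show "(\<Sum>k. ?f k \<omega> u) \<le> indicator {u. 0 < u \<and> Q \<omega> u} u"
    proof (cases "Q \<omega> u")
      case True
      have "(\<Sum>k. ?f k \<omega> u) = (\<Sum>k. indicator {prev_arrival \<omega> (i, k)<..arrival \<omega> (i, k)} u)"
        using True by (intro suminf_cong) (auto simp: indicator_def)
      also have "\<dots> = indicator (\<Union>k. {prev_arrival \<omega> (i, k)<..arrival \<omega> (i, k)}) u"
        by (rule suminf_indicator[OF prev_arrival_intervals_disjoint[OF reg[OF True] i]])
      also have "\<dots> \<le> indicator {u. 0 < u \<and> Q \<omega> u} u"
        using True prev_arrival_nonneg[OF reg[OF True] a]
        by (auto simp: indicator_def intro: le_less_trans)
      finally show ?thesis .
    qed simp
  qed
  finally show ?thesis by (simp add: mult_left_mono)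
qed

text \<open>The expected number of arrivals in a horizon, written as a sum of probabilities over the
  agents; \<open>Q\<close> is the mere statement that the time is at most \<open>t\<close>.\<close>

lemma suminf_arrived_le:
  assumes i: "i \<in> agent_types I" and t: "0 \<le> t"
  shows "(\<Sum>k. emeasure L {\<omega> \<in> space L. regular \<omega> \<and> arrival \<omega> (i, k) \<le> t}) \<le> ennreal (arr_rate I i * t)"
proof -
  have "(\<Sum>k. emeasure L {\<omega> \<in> space L. regular \<omega> \<and> arrival \<omega> (i, k) \<le> t}) \<le>
    ennreal (arr_rate I i) * (\<integral>\<^sup>+\<omega>. (\<integral>\<^sup>+u. indicator {u. 0 < u \<and> regular \<omega> \<and> u \<le> t} u \<partial>lborel) \<partial>L)"
    by (rule suminf_gap_compensator_le[OF i]) (auto intro: regular_upd_gap)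
  also have "\<dots> \<le> ennreal (arr_rate I i) * (\<integral>\<^sup>+\<omega>. (\<integral>\<^sup>+u. indicator {0..t} u \<partial>lborel) \<partial>L)"
    by (intro mult_left_mono nn_integral_mono) (auto simp: indicator_def)
  also have "\<dots> = ennreal (arr_rate I i * t)"
    using t rates_pos[OF i] by (simp add: L.emeasure_space_1 ennreal_mult)
  finally show ?thesis .
qed

end

text \<open>Matches and arrivals are counted by \<open>card\<close>, but their expectations are sums
  of probabilities over agent indices; this is the passage between the two. For infinite
  \<open>A\<close> the left side is 0 by the convention of \<open>card\<close>.\<close>

lemma of_nat_card_le_suminf_indicator:
  fixes f :: "'b \<Rightarrow> nat"
  assumes "inj_on f A"
  shows "ennreal (real (card A)) \<le> (\<Sum>k. indicator (f ` A) k)"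
proof (cases "finite A")
  case True
  have "ennreal (real (card A)) = (\<Sum>k\<in>f ` A. indicator (f ` A) k)"
    using True assms by (simp add: card_image ennreal_of_nat_eq_real_of_nat)
  also have "\<dots> \<le> (\<Sum>k. indicator (f ` A) k)"
    using True by (intro sum_le_suminf) auto
  finally show ?thesis .
qed simp

context matching_model begin

section \<open>Transfer between the product space and the outcome space\<close>

abbreviation "\<Omega> \<equiv> outcome_space I"

lemma space_Omega: "space \<Omega> = {\<omega> \<in> space L. regular \<omega>}"
  by (auto simp: outcome_space_def space_restrict_space)

lemma regular_sets: "{\<omega>. regular \<omega>} \<inter> space L \<in> sets L"
  using pred_regular by (simp add: pred_def Int_def conj_commute)

lemma sets_Omega_iff: "A \<in> sets \<Omega> \<longleftrightarrow> A \<subseteq> {\<omega>. regular \<omega>} \<and> A \<in> sets L"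
  unfolding outcome_space_def by (rule sets_restrict_space_iff[OF regular_sets])

lemma emeasure_Omega: "A \<in> sets \<Omega> \<Longrightarrow> emeasure \<Omega> A = emeasure L A"
  unfolding outcome_space_def
  by (rule emeasure_restrict_space[OF regular_sets]) (simp add: sets_Omega_iff outcome_space_def[symmetric])

text \<open>The integral of nonnegative functions is monotone without measurability of
  \<open>f\<close>, so the number of matches can be bounded although only the single match events
  are known to be measurable.\<close>

lemma nn_integral_Omega_suminf_indicator_le:
  assumes m: "\<And>k. Measurable.pred L (\<lambda>\<omega>. regular \<omega> \<and> P k \<omega>)"
    and le: "\<And>\<omega>. \<omega> \<in> space \<Omega> \<Longrightarrow> f \<omega> \<le> (\<Sum>k::nat. indicator {k. P k \<omega>} k)"
  shows "(\<integral>\<^sup>+\<omega>. f \<omega> \<partial>\<Omega>) \<le> (\<Sum>k. emeasure L {\<omega> \<in> space L. regular \<omega> \<and> P k \<omega>})"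
proof -
  have s: "{\<omega> \<in> space L. regular \<omega> \<and> P k \<omega>} \<in> sets \<Omega>" for k
    using m[of k] by (auto simp: sets_Omega_iff)
  have "(\<integral>\<^sup>+\<omega>. f \<omega> \<partial>\<Omega>) \<le> (\<integral>\<^sup>+\<omega>. (\<Sum>k. indicator {\<omega> \<in> space L. regular \<omega> \<and> P k \<omega>} \<omega>) \<partial>\<Omega>)"
  proof (rule nn_integral_mono)
    fix \<omega> assume w: "\<omega> \<in> space \<Omega>"
    have "f \<omega> \<le> (\<Sum>k::nat. indicator {k. P k \<omega>} k)" by (rule le[OF w])
    also have "\<dots> = (\<Sum>k. indicator {\<omega> \<in> space L. regular \<omega> \<and> P k \<omega>} \<omega>)"
      using w by (intro suminf_cong) (auto simp: indicator_def space_Omega)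
    finally show "f \<omega> \<le> (\<Sum>k. indicator {\<omega> \<in> space L. regular \<omega> \<and> P k \<omega>} \<omega>)" .
  qed
  also have "\<dots> = (\<Sum>k. emeasure L {\<omega> \<in> space L. regular \<omega> \<and> P k \<omega>})"
    using s by (subst nn_integral_suminf) (auto simp: emeasure_Omega)
  finally show ?thesis .
qed

end

section \<open>Online policies\<close>

locale online_model = matching_model +
  fixes \<pi> :: "'a policy"
  assumes online: "online_policy I \<pi>"
begin

lemma policy_edge:
  assumes "\<omega> \<in> space \<Omega>" "(a, b) \<in> \<pi> \<omega> s"
  shows "a \<in> agents I" "b \<in> agents I" "arrival \<omega> a < arrival \<omega> b" "arrival \<omega> b \<le> s"
    "s < departure \<omega> a" "s < departure \<omega> b"
    "s' < s \<Longrightarrow> \<not> matched_at \<pi> \<omega> a s'" "s' < s \<Longrightarrow> \<not> matched_at \<pi> \<omega> b s'"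
  using online assms unfolding online_policy_def feasible_policy_def by blast+

lemma policy_is_matching: "\<omega> \<in> space \<Omega> \<Longrightarrow> is_matching (\<pi> \<omega> s)"
  using online unfolding online_policy_def feasible_policy_def by blast

lemma matched_at_agent:
  assumes "\<omega> \<in> space \<Omega>" "matched_at \<pi> \<omega> a s"
  shows "a \<in> agents I" "arrival \<omega> a \<le> s" "s < departure \<omega> a" "s' < s \<Longrightarrow> \<not> matched_at \<pi> \<omega> a s'"
proof -
  obtain b c where bc: "(b, c) \<in> \<pi> \<omega> s" "a = b \<or> a = c"
    using assms(2) by (auto simp: matched_at_def)
  note e = policy_edge[OF assms(1) bc(1)]
  from e bc(2) show "a \<in> agents I" "arrival \<omega> a \<le> s" "s < departure \<omega> a" "s' < s \<Longrightarrow> \<not> matched_at \<pi> \<omega> a s'"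
    by auto
qed

lemma matched_at_unique:
  assumes "\<omega> \<in> space \<Omega>" "matched_at \<pi> \<omega> a s" "matched_at \<pi> \<omega> a s'"
  shows "s = s'"
  using matched_at_agent(4)[OF assms(1,2), of s'] matched_at_agent(4)[OF assms(1,3), of s] assms(2,3)
  by (metis linorder_neqE)

lemma matched_atI:
  assumes "(a, b) \<in> \<pi> \<omega> s"
  shows "matched_at \<pi> \<omega> a s" "matched_at \<pi> \<omega> b s"
  using assms by (auto simp: matched_at_def)

text \<open>Each match time is charged to an agent matched then. No agent is matched at two times,
  and only finitely many agents have arrived by \<open>u\<close>.\<close>

lemma finite_match_times:
  assumes w: "\<omega> \<in> space \<Omega>"
  shows "finite {s. s < u \<and> \<pi> \<omega> s \<noteq> {}}"
proof -
  define f where "f s = fst (SOME e. e \<in> \<pi> \<omega> s)" for s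
  have f: "matched_at \<pi> \<omega> (f s) s" if "\<pi> \<omega> s \<noteq> {}" for s
  proof -
    have "(SOME e. e \<in> \<pi> \<omega> s) \<in> \<pi> \<omega> s" using that by (auto intro: someI)
    then show ?thesis unfolding f_def by (metis matched_atI(1) prod.collapse)
  qed
  show ?thesis
  proof (rule inj_on_finite)
    show "inj_on f {s. s < u \<and> \<pi> \<omega> s \<noteq> {}}"
      using f matched_at_unique[OF w] by (metis (mono_tags, lifting) inj_onI mem_Collect_eq)
    show "f ` {s. s < u \<and> \<pi> \<omega> s \<noteq> {}} \<subseteq> {a \<in> agents I. arrival \<omega> a \<le> u}"
    proof (rule image_subsetI)
      fix s assume "s \<in> {s. s < u \<and> \<pi> \<omega> s \<noteq> {}}"
      then show "f s \<in> {a \<in> agents I. arrival \<omega> a \<le> u}"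
        using matched_at_agent(1,2)[OF w f[of s]] by simp
    qed
    show "finite {a \<in> agents I. arrival \<omega> a \<le> u}"
      using w by (intro regular_finite) (simp add: space_Omega)
  qed
qed

text \<open>Histories contain past matches, so non-anticipation is applied at the first time at which
  the two runs differ; it exists because match times are locally finite.\<close>

lemma policy_agree_before:
  assumes w: "\<omega> \<in> space \<Omega>" "\<omega>' \<in> space \<Omega>" and seed: "seed \<omega> = seed \<omega>'"
    and arr: "\<And>a. a \<in> agents I \<Longrightarrow> arrival \<omega> a < u \<or> arrival \<omega>' a < u \<Longrightarrow> arrival \<omega> a = arrival \<omega>' a"
    and dep: "\<And>a. a \<in> agents I \<Longrightarrow> departure \<omega> a < u \<or> departure \<omega>' a < u \<Longrightarrow> departure \<omega> a = departure \<omega>' a"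
    and s: "s < u"
  shows "\<pi> \<omega> s = \<pi> \<omega>' s"
proof (rule ccontr)
  assume neq: "\<pi> \<omega> s \<noteq> \<pi> \<omega>' s"
  let ?D = "{s. s < u \<and> \<pi> \<omega> s \<noteq> \<pi> \<omega>' s}"
  have fin: "finite ?D"
    by (rule finite_subset[OF _ finite_UnI[OF finite_match_times[OF w(1), of u] finite_match_times[OF w(2), of u]]])
      auto
  define m where "m = Min ?D"
  have "m \<in> ?D" unfolding m_def using fin s neq by (intro Min_in) auto
  then have m: "m < u" "\<pi> \<omega> m \<noteq> \<pi> \<omega>' m" by auto
  have before: "\<pi> \<omega> s = \<pi> \<omega>' s" if "s < m" for s
  proof (rule ccontr)
    assume "\<pi> \<omega> s \<noteq> \<pi> \<omega>' s"
    then have "m \<le> s" unfolding m_def using fin that m by (intro Min_le) auto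
    then show False using that by simp
  qed
  then have mat: "matched_at \<pi> \<omega> a s = matched_at \<pi> \<omega>' a s" if "s < m" for a s
    using that by (simp add: matched_at_def)
  \<comment> \<open>Non-anticipation is assumed at nonnegative times; before time 0 no match is
    possible because all arrivals are positive.\<close>
  have "\<pi> \<omega>' m = {}" if "m < 0" "\<omega>' \<in> space \<Omega>" for \<omega>'
    using policy_edge[OF that(2), of _ _ m] arrival_pos[of \<omega>'] that by (fastforce simp: space_Omega)
  then have "0 \<le> m" using m w by (metis not_le)
  have "history I \<pi> \<omega> m = history I \<pi> \<omega>' m"
    unfolding history_def prod.inject
  proof (intro conjI)
    show "{(a, s). a \<in> agents I \<and> s = arrival \<omega> a \<and> s \<le> m} = {(a, s). a \<in> agents I \<and> s = arrival \<omega>' a \<and> s \<le> m}"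
      using arr m by (auto; metis le_less_trans)
    \<comment> \<open>An abandonment is visible only if the agent has not been matched before, so
      this component of the history also needs the agreement of all matches before
      \<open>m\<close>.\<close>
    show "{(a, s). a \<in> agents I \<and> s = departure \<omega> a \<and> s \<le> m \<and> (\<forall>s'<s. \<not> matched_at \<pi> \<omega> a s')} =
        {(a, s). a \<in> agents I \<and> s = departure \<omega>' a \<and> s \<le> m \<and> (\<forall>s'<s. \<not> matched_at \<pi> \<omega>' a s')}"
    proof (intro set_eqI, clarsimp)
      fix a k s
      have "departure \<omega> (a, k) = departure \<omega>' (a, k)"
        if "(a, k) \<in> agents I" "departure \<omega> (a, k) \<le> m \<or> departure \<omega>' (a, k) \<le> m"
        using dep[of "(a, k)"] that m by (meson le_less_trans)
      then show "((a, k) \<in> agents I \<and> s = departure \<omega> (a, k) \<and> s \<le> m \<and> (\<forall>s'<s. \<not> matched_at \<pi> \<omega> (a, k) s')) =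
        ((a, k) \<in> agents I \<and> s = departure \<omega>' (a, k) \<and> s \<le> m \<and> (\<forall>s'<s. \<not> matched_at \<pi> \<omega>' (a, k) s'))"
        using mat by (metis less_le_trans)
    qed
  qed (use seed before in auto)
  then have "\<pi> \<omega> m = \<pi> \<omega>' m"
    using online w \<open>0 \<le> m\<close> unfolding online_policy_def nonanticipating_policy_def by blast
  then show False using m by simp
qed

text \<open>Policies are constrained on regular outcomes only. The conjunct
  \<open>regular \<omega>\<close> transports their measurability to the product space
  \<open>L\<close>, where coordinates can be redrawn.\<close>

lemma pred_edge:
  assumes "a \<in> agents I" "b \<in> agents I"
  shows "Measurable.pred L (\<lambda>\<omega>. regular \<omega> \<and> (\<exists>s\<le>t. (a, b) \<in> \<pi> \<omega> s))"
proof -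
  have "{\<omega> \<in> space \<Omega>. \<exists>s\<le>t. (a, b) \<in> \<pi> \<omega> s} \<in> sets \<Omega>"
    using online assms unfolding online_policy_def measurable_policy_def by blast
  then show ?thesis
    by (simp add: sets_Omega_iff space_Omega pred_def conj_assoc)
qed

text \<open>The partner may be any agent, so the event is a union over the countable type of agents;
  the guards \<open>b \<in> agents I\<close> are there because measurability is assumed for agents
  of the instance.\<close>

lemma pred_matched:
  assumes a: "a \<in> agents I"
  shows "Measurable.pred L (\<lambda>\<omega>. regular \<omega> \<and> (\<exists>s\<le>t. matched_at \<pi> \<omega> a s))"
proof -
  have [measurable]: "Measurable.pred L (\<lambda>\<omega>. b \<in> agents I \<and> regular \<omega> \<and> (\<exists>s\<le>t. (a, b) \<in> \<pi> \<omega> s))"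
    "Measurable.pred L (\<lambda>\<omega>. b \<in> agents I \<and> regular \<omega> \<and> (\<exists>s\<le>t. (b, a) \<in> \<pi> \<omega> s))" for b
    using pred_edge[OF a, of b t] pred_edge[OF _ a, of b t] by (cases "b \<in> agents I"; simp)+
  have "Measurable.pred L (\<lambda>\<omega>. \<exists>b. b \<in> agents I \<and> regular \<omega> \<and> (\<exists>s\<le>t. (a, b) \<in> \<pi> \<omega> s) \<or>
      b \<in> agents I \<and> regular \<omega> \<and> (\<exists>s\<le>t. (b, a) \<in> \<pi> \<omega> s))"
    by measurable
  also have "?this \<longleftrightarrow> ?thesis"
  proof (rule measurable_cong)
    fix \<omega> assume "\<omega> \<in> space L"
    then have "b \<in> agents I \<and> c \<in> agents I" if "regular \<omega>" "(b, c) \<in> \<pi> \<omega> s" for b c s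
      using policy_edge(1,2)[of \<omega> b c s] that by (auto simp: space_Omega)
    then show "(\<exists>b. b \<in> agents I \<and> regular \<omega> \<and> (\<exists>s\<le>t. (a, b) \<in> \<pi> \<omega> s) \<or>
        b \<in> agents I \<and> regular \<omega> \<and> (\<exists>s\<le>t. (b, a) \<in> \<pi> \<omega> s)) \<longleftrightarrow>
      regular \<omega> \<and> (\<exists>s\<le>t. matched_at \<pi> \<omega> a s)"
      unfolding matched_at_def by blast
  qed
  finally show ?thesis .
qed

text \<open>The state of \<open>a\<close> just before \<open>u\<close>, hence the open left and
  closed right end and the matches strictly before \<open>u\<close>; this makes it predictable. At
  \<open>u = departure \<omega> a\<close> it says that \<open>a\<close> abandons by time
  \<open>t\<close>, at the arrival of another agent that \<open>a\<close> is available to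
  it.\<close>

definition waiting :: "'a agent \<Rightarrow> real \<Rightarrow> 'a outcome \<Rightarrow> real \<Rightarrow> bool" where
  "waiting a t \<omega> u \<longleftrightarrow> \<omega> \<in> space \<Omega> \<and> arrival \<omega> a < u \<and> u \<le> departure \<omega> a \<and> u \<le> t \<and>
     (\<forall>s<u. \<not> matched_at \<pi> \<omega> a s)"

text \<open>For a policy only the events of being matched by a fixed time are known to be
  measurable. Between a match time and \<open>u\<close> there is a rational, so countably many of
  these events describe the strict past of the varying time \<open>u\<close>.\<close>

lemma pred_waiting:
  assumes a: "a \<in> agents I"
  shows "Measurable.pred (L \<Otimes>\<^sub>M borel) (\<lambda>z. waiting a t (fst z) (snd z))"
proof -
  note [measurable] = measurable_arrival[OF a] measurable_departure[OF a]
    measurable_compose[OF measurable_fst pred_matched[OF a]]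
  have "Measurable.pred (L \<Otimes>\<^sub>M borel) (\<lambda>z. regular (fst z) \<and> arrival (fst z) a < snd z \<and>
      snd z \<le> departure (fst z) a \<and> snd z \<le> t \<and>
      (\<forall>q::rat. of_rat q < snd z \<longrightarrow> \<not> (regular (fst z) \<and> (\<exists>s\<le>of_rat q. matched_at \<pi> (fst z) a s))))"
    by measurable
  also have "?this \<longleftrightarrow> ?thesis"
  proof (rule measurable_cong)
    fix z :: "'a outcome \<times> real"
    assume "z \<in> space (L \<Otimes>\<^sub>M borel)"
    then have z: "fst z \<in> space L" by (auto simp: space_pair_measure)
    have "(\<forall>q::rat. of_rat q < snd z \<longrightarrow> \<not> (\<exists>s\<le>of_rat q. matched_at \<pi> (fst z) a s)) \<longleftrightarrow>
        (\<forall>s<snd z. \<not> matched_at \<pi> (fst z) a s)" (is "?l \<longleftrightarrow> ?r")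
    proof
      assume l: ?l
      show ?r
      proof (intro allI impI)
        fix s assume "s < snd z"
        then obtain q where "s < of_rat q" "of_rat q < snd z" using of_rat_dense by blast
        then show "\<not> matched_at \<pi> (fst z) a s" using l less_imp_le by blast
      qed
    qed (auto dest: le_less_trans)
    then show "(regular (fst z) \<and> arrival (fst z) a < snd z \<and> snd z \<le> departure (fst z) a \<and> snd z \<le> t \<and>
      (\<forall>q::rat. of_rat q < snd z \<longrightarrow> \<not> (regular (fst z) \<and> (\<exists>s\<le>of_rat q. matched_at \<pi> (fst z) a s)))) \<longleftrightarrow>
      waiting a t (fst z) (snd z)"
      using z by (auto simp: waiting_def space_Omega)
  qed
  finally show ?thesis .
qed

text \<open>\<open>waiting\<close> asks whether the arrival and the departure of \<open>a\<close>
  fall strictly before \<open>u\<close>, and for matches strictly before \<open>u\<close>; agreement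
  of the strict past decides all three.\<close>

lemma waiting_cong:
  assumes w: "\<omega> \<in> space \<Omega> \<longleftrightarrow> \<omega>' \<in> space \<Omega>" and "seed \<omega> = seed \<omega>'"
    and "\<And>a. a \<in> agents I \<Longrightarrow> arrival \<omega> a < u \<or> arrival \<omega>' a < u \<Longrightarrow> arrival \<omega> a = arrival \<omega>' a"
    and "\<And>a. a \<in> agents I \<Longrightarrow> departure \<omega> a < u \<or> departure \<omega>' a < u \<Longrightarrow> departure \<omega> a = departure \<omega>' a"
    and a: "a \<in> agents I"
  shows "waiting a t \<omega> u = waiting a t \<omega>' u"
proof (cases "\<omega> \<in> space \<Omega>")
  case True
  then have "\<pi> \<omega> s = \<pi> \<omega>' s" if "s < u" for s
    using w by (intro policy_agree_before[OF _ _ assms(2-4) that]) auto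
  then have "(\<forall>s<u. \<not> matched_at \<pi> \<omega> a s) = (\<forall>s<u. \<not> matched_at \<pi> \<omega>' a s)"
    by (auto simp: matched_at_def)
  moreover have "arrival \<omega> a < u \<longleftrightarrow> arrival \<omega>' a < u"
    using assms(3)[OF a] by auto
  moreover have "u \<le> departure \<omega> a \<longleftrightarrow> u \<le> departure \<omega>' a"
    using assms(4)[OF a] by force
  ultimately show ?thesis using True w by (simp add: waiting_def)
qed (use w in \<open>simp add: waiting_def\<close>)

lemma upd_gap_space: "\<omega> \<in> space L \<Longrightarrow> a \<in> agents I \<Longrightarrow> upd_gap a \<omega> x \<in> space L"
  using measurable_space[OF measurable_upd_gap, of a "(\<omega>, x)"] by (simp add: space_pair_measure)

lemma upd_sojourn_space: "\<omega> \<in> space L \<Longrightarrow> a \<in> agents I \<Longrightarrow> upd_sojourn a \<omega> x \<in> space L"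
  using measurable_space[OF measurable_upd_sojourn, of a "(\<omega>, x)"] by (simp add: space_pair_measure)

text \<open>Under either value of the gap, \<open>b\<close> and all later agents of its type arrive
  no earlier than \<open>prev_arrival \<omega> b + v\<close>, and agents depart after they arrive.
  The two outcomes thus have the same strict past at that time, and so the same matches.\<close>

lemma waiting_upd_gap:
  assumes "\<omega> \<in> space L" "a \<in> agents I" "b \<in> agents I" "0 < v" "v \<le> x"
  shows "waiting a t (upd_gap b \<omega> x) (prev_arrival \<omega> b + v) =
    waiting a t (upd_gap b \<omega> v) (prev_arrival \<omega> b + v)"
proof -
  have reg: "regular (upd_gap b \<omega> x) \<longleftrightarrow> regular (upd_gap b \<omega> v)"
    using assms by (auto intro: regular_upd_gap)
  show ?thesis
  proof (cases "regular (upd_gap b \<omega> x)")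
    case True
    have late: "prev_arrival \<omega> b + v \<le> arrival (upd_gap b \<omega> y) c"
      if c: "c \<in> agents I" "fst c = fst b" "snd b \<le> snd c" and y: "y = v \<or> y = x" for c y
    proof -
      have "regular (upd_gap b \<omega> y)" using True reg y by auto
      then have "arrival (upd_gap b \<omega> y) b \<le> arrival (upd_gap b \<omega> y) c"
        using strict_mono_arrival[of "upd_gap b \<omega> y" "fst b", THEN strict_mono_less_eq, of "snd b" "snd c"] c assms(3)
        by (cases b, cases c) (auto simp: regular_outcome_def agents_iff)
      then show ?thesis using y assms by (auto simp: arrival_upd_gap_same)
    qed
    have arr: "arrival (upd_gap b \<omega> x) c = arrival (upd_gap b \<omega> v) c"
      if "c \<in> agents I" "arrival (upd_gap b \<omega> x) c < prev_arrival \<omega> b + v \<or>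
        arrival (upd_gap b \<omega> v) c < prev_arrival \<omega> b + v" for c
      using that late[of c x] late[of c v] by (auto simp: arrival_upd_gap)
    have "departure (upd_gap b \<omega> x) c = departure (upd_gap b \<omega> v) c"
      if c: "c \<in> agents I" and "departure (upd_gap b \<omega> x) c < prev_arrival \<omega> b + v \<or>
        departure (upd_gap b \<omega> v) c < prev_arrival \<omega> b + v" for c
      using that arr[OF c] regular_sojourn_pos[OF True c] by (auto simp: departure_def)
    then show ?thesis
      using assms reg True by (intro waiting_cong arr) (auto simp: space_Omega upd_gap_space)
  qed (use reg in \<open>simp add: waiting_def space_Omega\<close>)
qed

text \<open>Only the departure of \<open>a\<close> changes, and under either value it is not before
  \<open>arrival \<omega> a + v\<close>, so nothing strictly earlier differs.\<close>

lemma waiting_upd_sojourn: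
  assumes "\<omega> \<in> space L" "a \<in> agents I" "0 < v" "v \<le> x"
  shows "waiting a t (upd_sojourn a \<omega> x) (arrival \<omega> a + v) =
    waiting a t (upd_sojourn a \<omega> v) (arrival \<omega> a + v)"
proof -
  have reg: "regular (upd_sojourn a \<omega> x) \<longleftrightarrow> regular (upd_sojourn a \<omega> v)"
    using assms by (auto intro: regular_upd_sojourn)
  show ?thesis
    by (rule waiting_cong) (use assms reg in \<open>auto simp: space_Omega upd_sojourn_space departure_def split: if_splits\<close>)
qed

text \<open>The common yardstick: the probabilities of abandoning and of obtaining a later partner
  are both compared with this expectation, which is then eliminated.\<close>

definition wait_time :: "'a agent \<Rightarrow> real \<Rightarrow> ennreal" where
  "wait_time a t = (\<integral>\<^sup>+\<omega>. (\<integral>\<^sup>+u. indicator {u. waiting a t \<omega> u} u \<partial>lborel) \<partial>L)"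

text \<open>The clock is the agent's own sojourn time, and ringing while the agent is still
  \<open>waiting\<close> means abandoning by \<open>t\<close>. There is only one such clock, so the
  compensator gives an equality, which is needed as a lower bound on abandonment.\<close>

lemma abandonment_prob:
  assumes a: "a \<in> agents I"
  shows "emeasure L {\<omega> \<in> space L. waiting a t \<omega> (departure \<omega> a)} = ennreal (ab_rate I (fst a)) * wait_time a t"
proof -
  have "emeasure L {\<omega> \<in> space L. arrival \<omega> a < departure \<omega> a \<and> waiting a t \<omega> (departure \<omega> a)} =
    ennreal (ab_rate I (fst a)) *
    (\<integral>\<^sup>+\<omega>. (\<integral>\<^sup>+u. indicator {u. arrival \<omega> a < u \<and> u \<le> departure \<omega> a \<and> waiting a t \<omega> u} u \<partial>lborel) \<partial>L)"
    by (rule sojourn_compensator[OF a pred_waiting[OF a]]) (rule waiting_upd_sojourn[OF _ a])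
  moreover have "arrival \<omega> a < departure \<omega> a \<and> waiting a t \<omega> (departure \<omega> a) \<longleftrightarrow> waiting a t \<omega> (departure \<omega> a)" for \<omega>
    by (auto simp: waiting_def)
  moreover have "arrival \<omega> a < u \<and> u \<le> departure \<omega> a \<and> waiting a t \<omega> u \<longleftrightarrow> waiting a t \<omega> u" for \<omega> u
    by (auto simp: waiting_def)
  ultimately show ?thesis by (simp add: wait_time_def)
qed

text \<open>A match may be made long after the partner arrived, but \<open>a\<close> must then have
  been unmatched and present all along. So \<open>a\<close> was \<open>waiting\<close> at the
  arrival of the partner, and the arrivals of type \<open>j\<close> see this state at rate at most
  \<open>arr_rate I j\<close>.\<close>

lemma suminf_edge_prob_le:
  assumes a: "a \<in> agents I" and j: "j \<in> agent_types I"
  shows "(\<Sum>l. emeasure L {\<omega> \<in> space L. regular \<omega> \<and> (\<exists>s\<le>t. (a, (j, l)) \<in> \<pi> \<omega> s)}) \<le>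
    ennreal (arr_rate I j) * wait_time a t"
proof -
  have b: "(j, l) \<in> agents I" for l using j by (simp add: agents_iff)
  note [measurable] = measurable_arrival[OF b]
  have "waiting a t \<omega> (arrival \<omega> (j, l))"
    if w: "\<omega> \<in> space L" "regular \<omega>" and st: "s \<le> t" "(a, (j, l)) \<in> \<pi> \<omega> s" for \<omega> s l
  proof -
    have w': "\<omega> \<in> space \<Omega>" using w by (simp add: space_Omega)
    note e = policy_edge[OF w' st(2)]
    show ?thesis
      using e st w' by (fastforce simp: waiting_def)
  qed
  then have "(\<Sum>l. emeasure L {\<omega> \<in> space L. regular \<omega> \<and> (\<exists>s\<le>t. (a, (j, l)) \<in> \<pi> \<omega> s)}) \<le>
      (\<Sum>l. emeasure L {\<omega> \<in> space L. waiting a t \<omega> (arrival \<omega> (j, l))})"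
  proof (intro suminf_le emeasure_mono allI)
    fix l
    have "(\<lambda>\<omega>. (\<omega>, arrival \<omega> (j, l))) \<in> measurable L (L \<Otimes>\<^sub>M borel)" by measurable
    from measurable_compose[OF this pred_waiting[OF a]]
    show "{\<omega> \<in> space L. waiting a t \<omega> (arrival \<omega> (j, l))} \<in> sets L" by simp
  qed auto
  also have "\<dots> \<le> ennreal (arr_rate I j) * (\<integral>\<^sup>+\<omega>. (\<integral>\<^sup>+u. indicator {u. 0 < u \<and> waiting a t \<omega> u} u \<partial>lborel) \<partial>L)"
  proof (rule suminf_gap_compensator_le[OF j pred_waiting[OF a]])
    show "waiting a t (upd_gap (j, k) \<omega> x) (prev_arrival \<omega> (j, k) + v) =
        waiting a t (upd_gap (j, k) \<omega> v) (prev_arrival \<omega> (j, k) + v)"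
      if "\<omega> \<in> space L" "0 < v" "v \<le> x" for k \<omega> v x
      using that by (intro waiting_upd_gap a b)
  qed (simp add: waiting_def space_Omega)
  also have "\<dots> \<le> ennreal (arr_rate I j) * wait_time a t"
    unfolding wait_time_def by (intro mult_left_mono nn_integral_mono) (auto simp: indicator_def)
  finally show ?thesis .
qed

text \<open>An agent is either matched or abandons, and it abandons at rate \<open>ab_rate\<close> while waiting,
  whereas it meets newly arriving agents of type \<open>j\<close> only at rate \<open>arr_rate I j\<close>.\<close>

lemma match_prob_le:
  assumes a: "a \<in> agents I" and j: "j \<in> agent_types I"
    and c: "c * arr_rate I j \<le> ab_rate I (fst a)" "0 \<le> c"
  shows "emeasure L {\<omega> \<in> space L. regular \<omega> \<and> (\<exists>s\<le>t. matched_at \<pi> \<omega> a s)} +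
    ennreal c * (\<Sum>l. emeasure L {\<omega> \<in> space L. regular \<omega> \<and> (\<exists>s\<le>t. (a, (j, l)) \<in> \<pi> \<omega> s)}) \<le>
    emeasure L {\<omega> \<in> space L. regular \<omega> \<and> arrival \<omega> a \<le> t}" (is "emeasure L ?M + _ \<le> emeasure L ?A")
proof -
  note [measurable] = measurable_arrival[OF a] measurable_departure[OF a]
  let ?W = "{\<omega> \<in> space L. waiting a t \<omega> (departure \<omega> a)}"
  have M: "?M \<in> sets L" using pred_matched[OF a] by simp
  have "(\<lambda>\<omega>. (\<omega>, departure \<omega> a)) \<in> measurable L (L \<Otimes>\<^sub>M borel)" by measurable
  from measurable_compose[OF this pred_waiting[OF a]]
  have W: "?W \<in> sets L" by simp
  have "ennreal c * (\<Sum>l. emeasure L {\<omega> \<in> space L. regular \<omega> \<and> (\<exists>s\<le>t. (a, (j, l)) \<in> \<pi> \<omega> s)}) \<le>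
      ennreal c * (ennreal (arr_rate I j) * wait_time a t)"
    by (intro mult_left_mono suminf_edge_prob_le a j) simp
  also have "\<dots> = ennreal (c * arr_rate I j) * wait_time a t"
    using c rates_pos[OF j] by (simp add: ennreal_mult mult.assoc)
  also have "\<dots> \<le> ennreal (ab_rate I (fst a)) * wait_time a t"
    using c by (intro mult_right_mono ennreal_leI) auto
  also have "\<dots> = emeasure L ?W" by (simp add: abandonment_prob[OF a])
  finally have "emeasure L ?M + ennreal c * (\<Sum>l. emeasure L {\<omega> \<in> space L. regular \<omega> \<and> (\<exists>s\<le>t. (a, (j, l)) \<in> \<pi> \<omega> s)}) \<le>
      emeasure L ?M + emeasure L ?W"
    by (rule add_left_mono)
  \<comment> \<open>A feasible match happens strictly before the departure, and
    \<open>waiting\<close> at the departure excludes any such match.\<close>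
  also have "?M \<inter> ?W = {}"
    using matched_at_agent(3) by (fastforce simp: waiting_def)
  then have "emeasure L ?M + emeasure L ?W = emeasure L (?M \<union> ?W)"
    by (rule plus_emeasure[OF M W])
  also have "\<dots> \<le> emeasure L ?A"
  proof (rule emeasure_mono)
    have "arrival \<omega> a \<le> t" if "\<omega> \<in> space \<Omega>" "s \<le> t" "matched_at \<pi> \<omega> a s" for \<omega> s
      using matched_at_agent(2)[OF that(1,3)] that(2) by simp
    then show "?M \<union> ?W \<subseteq> ?A"
      by (auto simp: waiting_def space_Omega)
  qed measurable
  finally show ?thesis .
qed

lemma suminf_match_prob_le:
  assumes i: "i \<in> agent_types I" and j: "j \<in> agent_types I" and t: "0 \<le> t"
    and c: "c * arr_rate I j \<le> ab_rate I i" "0 \<le> c"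
  shows "(\<Sum>k. emeasure L {\<omega> \<in> space L. regular \<omega> \<and> (\<exists>s\<le>t. matched_at \<pi> \<omega> (i, k) s)}) +
    ennreal c * (\<Sum>k. \<Sum>l. emeasure L {\<omega> \<in> space L. regular \<omega> \<and> (\<exists>s\<le>t. ((i, k), (j, l)) \<in> \<pi> \<omega> s)}) \<le>
    ennreal (arr_rate I i * t)" (is "?l \<le> _")
proof -
  have "?l = (\<Sum>k. emeasure L {\<omega> \<in> space L. regular \<omega> \<and> (\<exists>s\<le>t. matched_at \<pi> \<omega> (i, k) s)} +
    ennreal c * (\<Sum>l. emeasure L {\<omega> \<in> space L. regular \<omega> \<and> (\<exists>s\<le>t. ((i, k), (j, l)) \<in> \<pi> \<omega> s)}))"
    by (subst suminf_add[symmetric]) auto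
  also have "\<dots> \<le> (\<Sum>k. emeasure L {\<omega> \<in> space L. regular \<omega> \<and> arrival \<omega> (i, k) \<le> t})"
    using c i by (intro suminf_le match_prob_le j) (auto simp: agents_iff)
  also have "\<dots> \<le> ennreal (arr_rate I i * t)"
    by (rule suminf_arrived_le[OF i t])
  finally show ?thesis .
qed

lemma edges_share_agent:
  assumes w: "\<omega> \<in> space \<Omega>" and e: "(a, b) \<in> \<pi> \<omega> s" "(c, d) \<in> \<pi> \<omega> s'" and "{a, b} \<inter> {c, d} \<noteq> {}"
  shows "a = c \<and> b = d"
proof -
  obtain x where x: "x \<in> {a, b}" "x \<in> {c, d}" using assms(4) by blast
  then have "matched_at \<pi> \<omega> x s" "matched_at \<pi> \<omega> x s'"
    using e by (auto intro: matched_atI)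
  then have "s = s'" by (rule matched_at_unique[OF w])
  then have "(a, b) \<noteq> (c, d) \<Longrightarrow> {a, b} \<inter> {c, d} = {}"
    using policy_is_matching[OF w, of s] e unfolding is_matching_def by (metis fst_conv snd_conv)
  then show ?thesis using assms(4) by blast
qed

text \<open>Both kinds of matches are counted by their type-\<open>i\<close> agent, the later one in
  an \<open>(h, i)\<close> match and the earlier one in an \<open>(i, j)\<close> match. An
  \<open>(i, j)\<close> match also makes its type-\<open>i\<close> agent matched; this contribution
  to the first sum is given away, which is negligible when \<open>c\<close> is large.\<close>

lemma expected_matches_le:
  assumes i: "i \<in> agent_types I" and j: "j \<in> agent_types I" and h: "h \<in> agent_types I" and t: "0 \<le> t"
    and c: "c * arr_rate I j \<le> ab_rate I i" "0 < c"
  shows "(\<integral>\<omega>. real (num_matches \<pi> h i t \<omega>) \<partial>\<Omega>) + c * (\<integral>\<omega>. real (num_matches \<pi> i j t \<omega>) \<partial>\<Omega>) \<le> arr_rate I i * t"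
proof -
  have ag: "(i, k) \<in> agents I" "(j, k) \<in> agents I" for k
    using i j by (auto simp: agents_iff)
  let ?X = "\<Sum>k. emeasure L {\<omega> \<in> space L. regular \<omega> \<and> (\<exists>s\<le>t. matched_at \<pi> \<omega> (i, k) s)}"
  let ?Y = "\<Sum>k. \<Sum>l. emeasure L {\<omega> \<in> space L. regular \<omega> \<and> (\<exists>s\<le>t. ((i, k), (j, l)) \<in> \<pi> \<omega> s)}"
  have le: "?X + ennreal c * ?Y \<le> ennreal (arr_rate I i * t)"
    using c by (intro suminf_match_prob_le i j t) auto
  have X: "(\<integral>\<^sup>+\<omega>. ennreal (real (num_matches \<pi> h i t \<omega>)) \<partial>\<Omega>) \<le> ?X"
  proof (rule nn_integral_Omega_suminf_indicator_le[OF pred_matched[OF ag(1)]])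
    fix \<omega> assume w: "\<omega> \<in> space \<Omega>"
    let ?A = "{(a, b). fst a = h \<and> fst b = i \<and> (\<exists>s\<le>t. (a, b) \<in> \<pi> \<omega> s)}"
    let ?f = "\<lambda>e::'a agent \<times> 'a agent. snd (snd e)"
    have "inj_on ?f ?A"
    proof (rule inj_onI, clarsimp)
      fix k k' l s s'
      assume "((h, k), (i, l)) \<in> \<pi> \<omega> s" "((h, k'), (i, l)) \<in> \<pi> \<omega> s'"
      then show "k = k'"
        using edges_share_agent[OF w, of "(h, k)" "(i, l)" s "(h, k')" "(i, l)" s'] by auto
    qed
    then have "ennreal (real (num_matches \<pi> h i t \<omega>)) \<le> (\<Sum>k. indicator (?f ` ?A) k)"
      unfolding num_matches_def by (rule of_nat_card_le_suminf_indicator)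
    also have "\<dots> \<le> (\<Sum>k. indicator {k. \<exists>s\<le>t. matched_at \<pi> \<omega> (i, k) s} k)"
    proof (intro suminf_le)
      have "?f ` ?A \<subseteq> {k. \<exists>s\<le>t. matched_at \<pi> \<omega> (i, k) s}"
        using matched_atI(2) by fastforce
      then show "indicator (?f ` ?A) k \<le> (indicator {k. \<exists>s\<le>t. matched_at \<pi> \<omega> (i, k) s} k :: ennreal)" for k
        unfolding indicator_def by (metis (no_types, lifting) of_bool_less_eq_iff subset_eq)
    qed auto
    finally show "ennreal (real (num_matches \<pi> h i t \<omega>)) \<le> (\<Sum>k. indicator {k. \<exists>s\<le>t. matched_at \<pi> \<omega> (i, k) s} k)" .
  qed
  have Y: "(\<integral>\<^sup>+\<omega>. ennreal (real (num_matches \<pi> i j t \<omega>)) \<partial>\<Omega>) \<le> ?Y"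
  proof -
    have p: "Measurable.pred L (\<lambda>\<omega>. regular \<omega> \<and> (\<exists>s\<le>t. ((i, k), (j, l)) \<in> \<pi> \<omega> s))" for k l
      by (rule pred_edge[OF ag])
    have un: "{\<omega> \<in> space L. regular \<omega> \<and> (\<exists>l. \<exists>s\<le>t. ((i, k), (j, l)) \<in> \<pi> \<omega> s)} =
       (\<Union>l. {\<omega> \<in> space L. regular \<omega> \<and> (\<exists>s\<le>t. ((i, k), (j, l)) \<in> \<pi> \<omega> s)})" for k
      by auto
    have "(\<integral>\<^sup>+\<omega>. ennreal (real (num_matches \<pi> i j t \<omega>)) \<partial>\<Omega>) \<le>
      (\<Sum>k. emeasure L {\<omega> \<in> space L. regular \<omega> \<and> (\<exists>l. \<exists>s\<le>t. ((i, k), (j, l)) \<in> \<pi> \<omega> s)})"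
    proof (rule nn_integral_Omega_suminf_indicator_le)
      show "Measurable.pred L (\<lambda>\<omega>. regular \<omega> \<and> (\<exists>l. \<exists>s\<le>t. ((i, k), (j, l)) \<in> \<pi> \<omega> s))" for k
        unfolding pred_def un using p[of k] by (intro sets.countable_UN) auto
    next
      fix \<omega> assume w: "\<omega> \<in> space \<Omega>"
      let ?A = "{(a, b). fst a = i \<and> fst b = j \<and> (\<exists>s\<le>t. (a, b) \<in> \<pi> \<omega> s)}"
      let ?f = "\<lambda>e::'a agent \<times> 'a agent. snd (fst e)"
      have "inj_on ?f ?A"
      proof (rule inj_onI, clarsimp)
        fix k l l' s s'
        assume "((i, k), (j, l)) \<in> \<pi> \<omega> s" "((i, k), (j, l')) \<in> \<pi> \<omega> s'"
        then show "l = l'"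
          using edges_share_agent[OF w, of "(i, k)" "(j, l)" s "(i, k)" "(j, l')" s'] by auto
      qed
      then have "ennreal (real (num_matches \<pi> i j t \<omega>)) \<le> (\<Sum>k. indicator (?f ` ?A) k)"
        unfolding num_matches_def by (rule of_nat_card_le_suminf_indicator)
      also have "\<dots> \<le> (\<Sum>k. indicator {k. \<exists>l. \<exists>s\<le>t. ((i, k), (j, l)) \<in> \<pi> \<omega> s} k)"
      proof (intro suminf_le)
        have "?f ` ?A \<subseteq> {k. \<exists>l. \<exists>s\<le>t. ((i, k), (j, l)) \<in> \<pi> \<omega> s}"
          by fastforce
        then show "indicator (?f ` ?A) k \<le> (indicator {k. \<exists>l. \<exists>s\<le>t. ((i, k), (j, l)) \<in> \<pi> \<omega> s} k :: ennreal)" for k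
          unfolding indicator_def by (metis (no_types, lifting) of_bool_less_eq_iff subset_eq)
      qed auto
      finally show "ennreal (real (num_matches \<pi> i j t \<omega>)) \<le>
        (\<Sum>k. indicator {k. \<exists>l. \<exists>s\<le>t. ((i, k), (j, l)) \<in> \<pi> \<omega> s} k)" .
    qed
    also have "\<dots> \<le> ?Y"
      unfolding un using p by (intro suminf_le emeasure_subadditive_countably) auto
    finally show ?thesis .
  qed
  \<comment> \<open>Strict positivity of \<open>c\<close> matters: it lets finiteness of the product
    imply finiteness of \<open>?Y\<close>.\<close>
  have "?X \<noteq> \<infinity>" "ennreal c * ?Y \<noteq> \<infinity>"
    using le by (auto simp: top_unique)
  then obtain x y where xy: "?X = ennreal x" "0 \<le> x" "?Y = ennreal y" "0 \<le> y"
    using c by (cases ?X; cases ?Y) (auto simp: ennreal_mult_top)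
  \<comment> \<open>\<open>integral_real_bounded\<close> covers functions that are not integrable as
    well, since their integral is 0 by convention.\<close>
  have "(\<integral>\<omega>. real (num_matches \<pi> h i t \<omega>) \<partial>\<Omega>) \<le> x" "(\<integral>\<omega>. real (num_matches \<pi> i j t \<omega>) \<partial>\<Omega>) \<le> y"
    using X Y xy by (auto intro!: integral_real_bounded)
  moreover have "x + c * y \<le> arr_rate I i * t"
    using le xy c rates_pos[OF i] t by (simp add: ennreal_mult[symmetric] ennreal_plus[symmetric] del: ennreal_plus)
  ultimately show ?thesis
    using c by (smt (verit) mult_left_mono)
qed

end

context matching_model begin

section \<open>Restarting the arrival processes\<close>

definition gap_arrival :: "('a agent \<Rightarrow> real) \<Rightarrow> 'a agent \<Rightarrow> real" where
  "gap_arrival g a = (\<Sum>l\<le>snd a. g (fst a, l))"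

lemma arrival_Pair: "arrival (g, q) = gap_arrival g"
  by (simp add: arrival_def gap_arrival_def gap_def fun_eq_iff)

definition first_after :: "'a \<Rightarrow> real \<Rightarrow> nat \<Rightarrow> 'a outcome \<Rightarrow> bool" where
  "first_after i s k \<omega> \<longleftrightarrow> (\<forall>j<k. arrival \<omega> (i, j) \<le> s) \<and> s < arrival \<omega> (i, k)"

text \<open>The new gap at index 0 is the residual time from \<open>s\<close> to the next arrival;
  it is independent of the past and again exponential, although it is only a piece of the old gap
  \<open>k\<close>.\<close>

definition shift_gap :: "'a \<Rightarrow> real \<Rightarrow> nat \<Rightarrow> ('a agent \<Rightarrow> real) \<Rightarrow> 'a agent \<Rightarrow> real" where
  "shift_gap i s k g = (\<lambda>a\<in>agents I. if fst a = i then
     (if snd a = 0 then gap_arrival g (i, k) - s else g (i, k + snd a)) else g a)"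

definition shift_sojourn :: "'a \<Rightarrow> nat \<Rightarrow> ('a agent \<Rightarrow> real) \<Rightarrow> 'a agent \<Rightarrow> real" where
  "shift_sojourn i k \<sigma> = (\<lambda>a\<in>agents I. \<sigma> (if fst a = i then (i, k + snd a) else a))"

definition shift :: "'a \<Rightarrow> real \<Rightarrow> nat \<Rightarrow> 'a outcome \<Rightarrow> 'a outcome" where
  "shift i s k \<omega> = (shift_gap i s k (fst \<omega>), shift_sojourn i k (fst (snd \<omega>)), snd (snd \<omega>))"

text \<open>\<open>restart i s\<close> re-labels the agents of type \<open>i\<close> so that the process of this type starts
  anew at time \<open>s\<close>, forgetting the earlier arrivals. The \<open>LEAST\<close> is junk on the null set
  of outcomes with finitely many arrivals.\<close>

definition restart :: "'a \<Rightarrow> real \<Rightarrow> 'a outcome \<Rightarrow> 'a outcome" where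
  "restart i s \<omega> = shift i s (LEAST k. s < arrival \<omega> (i, k)) \<omega>"

lemma first_after_unique:
  assumes "first_after i s k \<omega>"
  shows "(LEAST k. s < arrival \<omega> (i, k)) = k"
  using assms unfolding first_after_def by (intro Least_equality) (auto simp: not_less[symmetric] intro: leI)

lemma measurable_gap_component:
  "a \<in> agents I \<Longrightarrow> (\<lambda>g. g a) \<in> borel_measurable G"
  using measurable_component_singleton[of a "agents I" "\<lambda>a. exponential_measure (arr_rate I (fst a))"]
  by (simp cong: measurable_cong_sets)

lemma measurable_gap_arrival [measurable]:
  "a \<in> agents I \<Longrightarrow> (\<lambda>g. gap_arrival g a) \<in> borel_measurable G"
  unfolding gap_arrival_def by (intro borel_measurable_sum measurable_gap_component) (simp add: agents_iff)

lemma measurable_shift_gap: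
  assumes i: "i \<in> agent_types I"
  shows "shift_gap i s k \<in> measurable G G"
  unfolding shift_gap_def
proof (rule measurable_restrict)
  fix a assume a: "a \<in> agents I"
  have [measurable]: "(\<lambda>g. gap_arrival g (i, l)) \<in> borel_measurable G" "(\<lambda>g. g (i, l)) \<in> borel_measurable G" for l
    using i by (auto intro!: measurable_gap_arrival measurable_gap_component simp: agents_iff)
  have "(\<lambda>g. if fst a = i then if snd a = 0 then gap_arrival g (i, k) - s else g (i, k + snd a) else g a) \<in>
      borel_measurable G"
    using measurable_gap_component[OF a] by measurable
  then show "(\<lambda>g. if fst a = i then if snd a = 0 then gap_arrival g (i, k) - s else g (i, k + snd a) else g a) \<in>
      measurable G (exponential_measure (arr_rate I (fst a)))"
    unfolding measurable_cong_sets[OF refl sets_exponential_measure] .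
qed

lemma distr_shift_sojourn:
  assumes i: "i \<in> agent_types I"
  shows "distr S S (shift_sojourn i k) = S" "shift_sojourn i k \<in> measurable S S"
proof -
  let ?f = "\<lambda>a. if fst a = i then (i, k + snd a) else a"
  have f: "?f \<in> agents I \<rightarrow> agents I" using i by (auto simp: agents_iff)
  have inj: "inj_on ?f (agents I)" by (auto simp: inj_on_def prod_eq_iff split: if_splits)
  have fst: "fst (?f a) = fst a" for a by auto
  have "distr S (PiM (agents I) (\<lambda>a. exponential_measure (ab_rate I (fst (?f a))))) (\<lambda>\<omega>. \<lambda>n\<in>agents I. \<omega> (?f n)) =
      PiM (agents I) (\<lambda>a. exponential_measure (ab_rate I (fst (?f a))))"
    by (rule distr_PiM_reindex[OF prob_space_sojourn inj f])
  then show "distr S S (shift_sojourn i k) = S"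
    unfolding fst shift_sojourn_def .
  show "shift_sojourn i k \<in> measurable S S"
    unfolding shift_sojourn_def
  proof (rule measurable_restrict)
    fix a assume a: "a \<in> agents I"
    have "(\<lambda>\<sigma>. \<sigma> (?f a)) \<in> measurable S (exponential_measure (ab_rate I (fst (?f a))))"
      using a f by (intro measurable_component_singleton) blast
    then show "(\<lambda>\<sigma>. \<sigma> (?f a)) \<in> measurable S (exponential_measure (ab_rate I (fst a)))"
      unfolding fst .
  qed
qed

text \<open>\<open>X\<close> supplies the past of type \<open>i\<close> up to the gap that will
  straddle \<open>s\<close>, and \<open>Y\<close> supplies the future. The gap
  \<open>(i, k + m)\<close> is \<open>Y (i, m)\<close> for positive \<open>m\<close>, so the slot
  \<open>Y (i, 0)\<close> stays vacant and can later hold the residual time.\<close>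

lemma nn_integral_splice_gap:
  assumes i: "i \<in> agent_types I" and F: "F \<in> borel_measurable G"
  shows "(\<integral>\<^sup>+g. F g \<partial>G) = (\<integral>\<^sup>+Y. (\<integral>\<^sup>+X. F (\<lambda>a\<in>agents I. if fst a = i \<and> snd a \<le> k then X a
    else Y (if fst a = i then (i, snd a - k) else a)) \<partial>G) \<partial>G)"
proof -
  interpret GG: pair_prob_space G G ..
  let ?D = "{a. fst a = i \<and> snd a \<le> k}" and ?f = "\<lambda>a::'a agent. if fst a = i then (i, snd a - k) else a"
  have f: "?f a \<in> agents I \<and> exponential_measure (arr_rate I (fst (?f a))) = exponential_measure (arr_rate I (fst a))"
    if "a \<in> agents I" for a
    using that by (auto simp: agents_iff)
  have inj: "inj_on ?f (agents I - ?D)"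
    by (auto simp: inj_on_def prod_eq_iff split: if_splits)
  let ?\<theta> = "\<lambda>X Y. \<lambda>a\<in>agents I. if a \<in> ?D then X a else Y (?f a)"
  have m: "(\<lambda>(X, Y). ?\<theta> X Y) \<in> measurable (G \<Otimes>\<^sub>M G) G"
    by (rule measurable_PiM_splice[OF f])
  have "(\<integral>\<^sup>+g. F g \<partial>G) = (\<integral>\<^sup>+g. F g \<partial>distr (G \<Otimes>\<^sub>M G) G (\<lambda>(X, Y). ?\<theta> X Y))"
    by (subst distr_PiM_splice[OF prob_space_gap f inj]) auto
  also have "\<dots> = (\<integral>\<^sup>+z. F (?\<theta> (fst z) (snd z)) \<partial>(G \<Otimes>\<^sub>M G))"
    using F by (subst nn_integral_distr[OF m]) (auto simp: split_beta')
  also have "\<dots> = (\<integral>\<^sup>+Y. (\<integral>\<^sup>+X. F (?\<theta> X Y) \<partial>G) \<partial>G)"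
    using measurable_compose[OF m F]
    by (subst GG.nn_integral_snd[symmetric]) (auto simp: split_beta' cong: if_cong)
  finally show ?thesis by simp
qed

text \<open>The shifted gaps are the independent family \<open>Y\<close> with the residual time in
  the vacant slot. Given that the gap \<open>k\<close> straddles \<open>s\<close>, its excess over
  \<open>s - prev\<close> is a fresh exponential, whence the product form.\<close>

lemma nn_integral_first_after_gap:
  assumes i: "i \<in> agent_types I" and s: "0 \<le> s" and H [measurable]: "H \<in> borel_measurable G"
  shows "(\<integral>\<^sup>+g. indicator {g. first_after i s k (g, q)} g * H (shift_gap i s k g) \<partial>G) =
    emeasure G {g \<in> space G. first_after i s k (g, q)} * (\<integral>\<^sup>+g. H g \<partial>G)"
proof -
  have a: "(i, l) \<in> agents I" for l using i by (simp add: agents_iff)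
  let ?E = "exponential_measure (arr_rate I i)"
  interpret E: prob_space ?E by (rule prob_space_exponential_measure) (rule rates_pos[OF i])
  note [measurable] = measurable_gap_arrival[OF a] measurable_shift_gap[OF i]
  have P [measurable]: "Measurable.pred G (\<lambda>g. first_after i s k (g, q))"
    unfolding first_after_def arrival_Pair by measurable
  define prev where "prev g = (\<Sum>l<k. g (i, l))" for g :: "'a agent \<Rightarrow> real"
  have [measurable]: "prev \<in> borel_measurable G"
    unfolding prev_def by (intro borel_measurable_sum measurable_gap_component a)
  define B where "B g \<longleftrightarrow> (\<forall>j<k. gap_arrival g (i, j) \<le> s)" for g
  have [measurable]: "Measurable.pred G B" unfolding B_def by measurable
  \<comment> \<open>As a condition on the straddling gap \<open>x\<close> alone, the event is that
    \<open>x\<close> exceeds the level \<open>s - prev g\<close>; all the rest of it lies in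
    \<open>B\<close>.\<close>
  have fa: "first_after i s k (g((i, k) := x), q) \<longleftrightarrow> B g \<and> s - prev g < x" for g x
  proof -
    have "gap_arrival (g((i, k) := x)) (i, j) = gap_arrival g (i, j)" if "j < k" for j
      unfolding gap_arrival_def using that by (intro sum.cong) auto
    moreover have "gap_arrival (g((i, k) := x)) (i, k) = prev g + x"
      unfolding gap_arrival_def prev_def by (simp add: lessThan_Suc_atMost[symmetric])
    ultimately show ?thesis by (auto simp: first_after_def arrival_Pair B_def)
  qed
  have arr_upd: "gap_arrival (g((i, k) := x)) (i, k) = prev g + x" for g x
    unfolding gap_arrival_def prev_def by (simp add: lessThan_Suc_atMost[symmetric])
  \<comment> \<open>Memorylessness needs a nonnegative level. For \<open>k = 0\<close> this is
    \<open>0 \<le> s\<close>, otherwise it is the last condition in \<open>B\<close>.\<close>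
  have prev_le: "0 \<le> s - prev g" if "B g" for g
  proof (cases k)
    case 0
    then show ?thesis using s by (simp add: prev_def)
  next
    case (Suc j)
    then show ?thesis using that by (auto simp: B_def prev_def gap_arrival_def lessThan_Suc_atMost)
  qed
  \<comment> \<open>With the future \<open>Y\<close> frozen, redraw the straddling gap of
    \<open>X\<close>; memorylessness separates the event from the residual time.\<close>
  have fresh: "(\<integral>\<^sup>+X. indicator {g. first_after i s k (g, q)} X * H (Y((i, 0) := gap_arrival X (i, k) - s)) \<partial>G) =
      emeasure G {g \<in> space G. first_after i s k (g, q)} * (\<integral>\<^sup>+x. H (Y((i, 0) := x)) \<partial>?E)"
    if Y: "Y \<in> space G" for Y
  proof -
    have "(\<lambda>x. (x, Y)) \<in> measurable ?E (?E \<Otimes>\<^sub>M G)" using Y by simp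
    from measurable_compose[OF this measurable_PiM_upd[OF a[of 0], where M = "\<lambda>a. exponential_measure (arr_rate I (fst a))", simplified]]
    have "(\<lambda>x. Y((i, 0) := x)) \<in> measurable ?E G" by simp
    then have HY [measurable]: "(\<lambda>x. H (Y((i, 0) := x))) \<in> borel_measurable borel"
      using measurable_compose[OF _ H] by (simp cong: measurable_cong_sets)
    have "(\<integral>\<^sup>+X. indicator {g. first_after i s k (g, q)} X * H (Y((i, 0) := gap_arrival X (i, k) - s)) \<partial>G) =
        (\<integral>\<^sup>+X. (\<integral>\<^sup>+x. indicator {g. first_after i s k (g, q)} (X((i, k) := x)) *
          H (Y((i, 0) := gap_arrival (X((i, k) := x)) (i, k) - s)) \<partial>?E) \<partial>G)"
    proof (subst nn_integral_PiM_resample[OF prob_space_gap a[of k]])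
      have "(\<lambda>X. H (Y((i, 0) := gap_arrival X (i, k) - s))) \<in> borel_measurable G"
        using measurable_compose[OF _ HY, of "\<lambda>X. gap_arrival X (i, k) - s" G] by simp
      then show "(\<lambda>X. indicator {g. first_after i s k (g, q)} X * H (Y((i, 0) := gap_arrival X (i, k) - s))) \<in> borel_measurable G"
        by measurable
    qed auto
    also have "\<dots> = (\<integral>\<^sup>+X. (\<integral>\<^sup>+x. indicator {X. B X} X * (indicator {s - prev X<..} x *
        H (Y((i, 0) := x - (s - prev X)))) \<partial>?E) \<partial>G)"
      by (intro nn_integral_cong) (auto simp: fa arr_upd indicator_def algebra_simps)
    also have "\<dots> = (\<integral>\<^sup>+X. indicator {X. B X} X * (\<integral>\<^sup>+x. indicator {s - prev X<..} x *
        H (Y((i, 0) := x - (s - prev X))) \<partial>?E) \<partial>G)"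
    proof (intro nn_integral_cong nn_integral_cmult)
      fix X
      define f where "f x = H (Y((i, 0) := x))" for x
      have f: "f \<in> borel_measurable borel"
        unfolding f_def by (rule HY)
      have "(\<lambda>x. f (x - (s - prev X))) \<in> borel_measurable borel"
        by (rule measurable_compose[OF _ f]) simp
      then have "(\<lambda>x. indicator {s - prev X<..} x * f (x - (s - prev X))) \<in> borel_measurable borel"
        by (intro borel_measurable_times_ennreal) auto
      then show "(\<lambda>x. indicator {s - prev X<..} x * H (Y((i, 0) := x - (s - prev X)))) \<in> borel_measurable ?E"
        by (simp add: f_def cong: measurable_cong_sets)
    qed
    also have "\<dots> = (\<integral>\<^sup>+X. indicator {X. B X} X * (emeasure ?E {s - prev X<..} * (\<integral>\<^sup>+x. H (Y((i, 0) := x)) \<partial>?E)) \<partial>G)"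
    proof (rule nn_integral_cong)
      fix X
      show "indicator {X. B X} X * (\<integral>\<^sup>+x. indicator {s - prev X<..} x * H (Y((i, 0) := x - (s - prev X))) \<partial>?E) =
          indicator {X. B X} X * (emeasure ?E {s - prev X<..} * (\<integral>\<^sup>+x. H (Y((i, 0) := x)) \<partial>?E))"
      proof (cases "B X")
        case True
        then show ?thesis
          using nn_integral_exponential_indicator_Ioi[OF rates_pos(1)[OF i] prev_le[OF True] HY]
            emeasure_exponential_Ioi[OF rates_pos(1)[OF i] prev_le[OF True]] by simp
      qed simp
    qed
    also have "\<dots> = (\<integral>\<^sup>+X. (\<integral>\<^sup>+x. indicator {g. first_after i s k (g, q)} (X((i, k) := x)) \<partial>?E) * (\<integral>\<^sup>+x. H (Y((i, 0) := x)) \<partial>?E) \<partial>G)"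
    proof (intro nn_integral_cong)
      fix X
      have "(\<integral>\<^sup>+x. indicator {g. first_after i s k (g, q)} (X((i, k) := x)) \<partial>?E) =
          (\<integral>\<^sup>+x. indicator {X. B X} X * indicator {s - prev X<..} x \<partial>?E)"
        by (intro nn_integral_cong) (auto simp: fa indicator_def)
      also have "\<dots> = indicator {X. B X} X * emeasure ?E {s - prev X<..}"
        by (subst nn_integral_cmult) auto
      finally show "indicator {X. B X} X * (emeasure ?E {s - prev X<..} * (\<integral>\<^sup>+x. H (Y((i, 0) := x)) \<partial>?E)) =
          (\<integral>\<^sup>+x. indicator {g. first_after i s k (g, q)} (X((i, k) := x)) \<partial>?E) * (\<integral>\<^sup>+x. H (Y((i, 0) := x)) \<partial>?E)"
        by (simp add: mult.assoc)
    qed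
    also have "\<dots> = (\<integral>\<^sup>+X. (\<integral>\<^sup>+x. indicator {g. first_after i s k (g, q)} (X((i, k) := x)) \<partial>?E) \<partial>G) * (\<integral>\<^sup>+x. H (Y((i, 0) := x)) \<partial>?E)"
    proof (rule nn_integral_multc, rule E.borel_measurable_nn_integral)
      have "(\<lambda>(X, x). (x, X)) \<in> measurable (G \<Otimes>\<^sub>M ?E) (?E \<Otimes>\<^sub>M G)" by measurable
      from measurable_compose[OF measurable_compose[OF this
          measurable_PiM_upd[OF a[of k], where M = "\<lambda>a. exponential_measure (arr_rate I (fst a))", simplified]],
          of "indicator {g. first_after i s k (g, q)} :: _ \<Rightarrow> ennreal" borel]
      show "(\<lambda>(X, x). indicator {g. first_after i s k (g, q)} (X((i, k) := x)) :: ennreal) \<in> borel_measurable (G \<Otimes>\<^sub>M ?E)"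
        by (simp add: split_beta')
    qed
    also have "(\<integral>\<^sup>+X. (\<integral>\<^sup>+x. indicator {g. first_after i s k (g, q)} (X((i, k) := x)) \<partial>?E) \<partial>G) =
        (\<integral>\<^sup>+X. indicator {g. first_after i s k (g, q)} X \<partial>G)"
      by (subst (2) nn_integral_PiM_resample[OF prob_space_gap a[of k]]) auto
    also have "\<dots> = (\<integral>\<^sup>+X. indicator {g \<in> space G. first_after i s k (g, q)} X \<partial>G)"
      by (intro nn_integral_cong) (auto simp: indicator_def)
    also have "\<dots> = emeasure G {g \<in> space G. first_after i s k (g, q)}"
      by (subst nn_integral_indicator) auto
    finally show ?thesis .
  qed
  let ?\<theta> = "\<lambda>X Y. \<lambda>a\<in>agents I. if fst a = i \<and> snd a \<le> k then X a else Y (if fst a = i then (i, snd a - k) else a)"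
  have "(\<integral>\<^sup>+g. indicator {g. first_after i s k (g, q)} g * H (shift_gap i s k g) \<partial>G) =
    (\<integral>\<^sup>+Y. (\<integral>\<^sup>+X. indicator {g. first_after i s k (g, q)} (?\<theta> X Y) * H (shift_gap i s k (?\<theta> X Y)) \<partial>G) \<partial>G)"
    by (rule nn_integral_splice_gap[OF i]) measurable
  also have "\<dots> = (\<integral>\<^sup>+Y. (\<integral>\<^sup>+X. indicator {g. first_after i s k (g, q)} X * H (Y((i, 0) := gap_arrival X (i, k) - s)) \<partial>G) \<partial>G)"
  proof (intro nn_integral_cong)
    fix X Y assume Y: "Y \<in> space G"
    have arr: "gap_arrival (?\<theta> X Y) (i, j) = gap_arrival X (i, j)" if "j \<le> k" for j
      unfolding gap_arrival_def using that a by (intro sum.cong) simp_all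
    have "shift_gap i s k (?\<theta> X Y) = Y((i, 0) := gap_arrival X (i, k) - s)"
    proof
      fix b
      consider "b \<notin> agents I" | "b = (i, 0)" | l where "b = (i, Suc l)" | "b \<in> agents I" "fst b \<noteq> i"
        by (cases b, cases "snd b", auto)
      then show "shift_gap i s k (?\<theta> X Y) b = (Y((i, 0) := gap_arrival X (i, k) - s)) b"
      proof cases
        case 1
        then have "b \<noteq> (i, 0)" using a by auto
        moreover have "Y b = undefined"
          using Y 1 unfolding space_PiM by (rule PiE_arb)
        ultimately show ?thesis using 1 by (simp add: shift_gap_def)
      next
        case 2
        then show ?thesis using a arr[of k] by (simp add: shift_gap_def)
      next
        case 3
        then show ?thesis using a by (simp add: shift_gap_def)
      next
        case 4
        then have "b \<noteq> (i, 0)" by auto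
        then show ?thesis using 4 by (simp add: shift_gap_def)
      qed
    qed
    then show "indicator {g. first_after i s k (g, q)} (?\<theta> X Y) * H (shift_gap i s k (?\<theta> X Y)) =
      indicator {g. first_after i s k (g, q)} X * H (Y((i, 0) := gap_arrival X (i, k) - s))"
      using arr by (simp add: indicator_def first_after_def arrival_Pair)
  qed
  also have "\<dots> = (\<integral>\<^sup>+Y. emeasure G {g \<in> space G. first_after i s k (g, q)} * (\<integral>\<^sup>+x. H (Y((i, 0) := x)) \<partial>?E) \<partial>G)"
    by (intro nn_integral_cong fresh)
  also have "\<dots> = emeasure G {g \<in> space G. first_after i s k (g, q)} * (\<integral>\<^sup>+Y. (\<integral>\<^sup>+x. H (Y((i, 0) := x)) \<partial>?E) \<partial>G)"
  proof (rule nn_integral_cmult, rule E.borel_measurable_nn_integral)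
    have "(\<lambda>(X, x). (x, X)) \<in> measurable (G \<Otimes>\<^sub>M ?E) (?E \<Otimes>\<^sub>M G)" by measurable
    from measurable_compose[OF measurable_compose[OF this
        measurable_PiM_upd[OF a[of 0], where M = "\<lambda>a. exponential_measure (arr_rate I (fst a))", simplified]] H]
    show "(\<lambda>(X, x). H (X((i, 0) := x))) \<in> borel_measurable (G \<Otimes>\<^sub>M ?E)"
      by (simp add: split_beta')
  qed
  \<comment> \<open>A fresh exponential in the vacant slot is just a redrawn coordinate of
    \<open>Y\<close>, so the law \<open>G\<close> comes back.\<close>
  also have "(\<integral>\<^sup>+Y. (\<integral>\<^sup>+x. H (Y((i, 0) := x)) \<partial>?E) \<partial>G) = (\<integral>\<^sup>+Y. H Y \<partial>G)"
    by (subst (2) nn_integral_PiM_resample[OF prob_space_gap a[of 0]]) auto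
  finally show ?thesis .
qed

lemma pred_first_after:
  assumes i: "i \<in> agent_types I"
  shows "Measurable.pred L (first_after i s k)"
proof -
  have [measurable]: "(\<lambda>\<omega>. arrival \<omega> (i, l)) \<in> borel_measurable L" for l
    using i by (intro measurable_arrival) (simp add: agents_iff)
  show ?thesis unfolding first_after_def by measurable
qed

lemma measurable_shift:
  assumes i: "i \<in> agent_types I"
  shows "shift i s k \<in> measurable L L"
proof -
  have [measurable]: "(\<lambda>\<omega>. shift_gap i s k (fst \<omega>)) \<in> measurable (G \<Otimes>\<^sub>M (S \<Otimes>\<^sub>M U)) G"
    by (rule measurable_compose[OF measurable_fst measurable_shift_gap[OF i]])
  have [measurable]: "(\<lambda>\<omega>. shift_sojourn i k (fst (snd \<omega>))) \<in> measurable (G \<Otimes>\<^sub>M (S \<Otimes>\<^sub>M U)) S"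
    by (rule measurable_compose[OF measurable_compose[OF measurable_snd measurable_fst] distr_shift_sojourn(2)[OF i]])
  show ?thesis
    unfolding shift_def full_outcome_measure_def by measurable
qed

text \<open>For fixed \<open>k\<close> the sojourn times are merely re-indexed injectively within
  one type, which keeps their law, and \<open>first_after\<close> does not look at them.\<close>

lemma nn_integral_first_after:
  assumes i: "i \<in> agent_types I" and s: "0 \<le> s" and F: "F \<in> borel_measurable L"
  shows "(\<integral>\<^sup>+\<omega>. indicator {\<omega>. first_after i s k \<omega>} \<omega> * F (shift i s k \<omega>) \<partial>L) =
    emeasure L {\<omega> \<in> space L. first_after i s k \<omega>} * (\<integral>\<^sup>+\<omega>. F \<omega> \<partial>L)"
proof -
  note [measurable] = pred_first_after[OF i] distr_shift_sojourn(2)[OF i] measurable_shift_gap[OF i]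
  \<comment> \<open>\<open>undefined\<close> is a dummy for sojourn times and seed:
    \<open>first_after\<close> reads only the gaps. The constant is identified at the end by taking
    \<open>F\<close> to be 1.\<close>
  let ?c = "emeasure G {g \<in> space G. first_after i s k (g, undefined)}"
  have ind: "first_after i s k (g, q) \<longleftrightarrow> first_after i s k (g, q')" for g q q'
    by (simp add: first_after_def arrival_Pair)
  have main: "(\<integral>\<^sup>+\<omega>. indicator {\<omega>. first_after i s k \<omega>} \<omega> * F (shift i s k \<omega>) \<partial>L) = ?c * (\<integral>\<^sup>+\<omega>. F \<omega> \<partial>L)"
    if F: "F \<in> borel_measurable L" for F
  proof -
    have [measurable]: "F \<in> borel_measurable (G \<Otimes>\<^sub>M (S \<Otimes>\<^sub>M U))"
      using F by (simp add: full_outcome_measure_def)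
    define H where "H g = (\<integral>\<^sup>+q. F (g, q) \<partial>(S \<Otimes>\<^sub>M U))" for g
    have H: "H \<in> borel_measurable G"
      unfolding H_def by measurable
    have m: "(\<lambda>\<omega>. indicator {\<omega>. first_after i s k \<omega>} \<omega> * F (shift i s k \<omega>)) \<in> borel_measurable (G \<Otimes>\<^sub>M (S \<Otimes>\<^sub>M U))"
      using measurable_compose[OF measurable_shift[OF i] F] pred_first_after[OF i, of s k]
      unfolding full_outcome_measure_def[symmetric] by measurable
    have sq: "(\<integral>\<^sup>+q. F (g, shift_sojourn i k (fst q), snd q) \<partial>(S \<Otimes>\<^sub>M U)) = H g" if g: "g \<in> space G" for g
    proof -
      have Fg [measurable]: "(\<lambda>q. F (g, q)) \<in> borel_measurable (S \<Otimes>\<^sub>M U)"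
        using g by measurable
      have "(\<integral>\<^sup>+q. F (g, shift_sojourn i k (fst q), snd q) \<partial>(S \<Otimes>\<^sub>M U)) =
        (\<integral>\<^sup>+\<sigma>. (\<integral>\<^sup>+u. F (g, shift_sojourn i k \<sigma>, u) \<partial>U) \<partial>S)"
        using g by (subst U.nn_integral_fst[symmetric]) auto
      also have "\<dots> = (\<integral>\<^sup>+\<sigma>. (\<integral>\<^sup>+u. F (g, \<sigma>, u) \<partial>U) \<partial>distr S S (shift_sojourn i k))"
        using g by (subst nn_integral_distr[OF distr_shift_sojourn(2)[OF i]]) auto
      also have "\<dots> = H g"
        unfolding distr_shift_sojourn(1)[OF i] H_def by (subst U.nn_integral_fst[symmetric]) auto
      finally show ?thesis .
    qed
    have "(\<integral>\<^sup>+\<omega>. indicator {\<omega>. first_after i s k \<omega>} \<omega> * F (shift i s k \<omega>) \<partial>L) =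
        (\<integral>\<^sup>+g. (\<integral>\<^sup>+q. indicator {\<omega>. first_after i s k \<omega>} (g, q) * F (shift i s k (g, q)) \<partial>(S \<Otimes>\<^sub>M U)) \<partial>G)"
      unfolding full_outcome_measure_def by (subst SU.nn_integral_fst[symmetric, OF m]) simp
    also have "\<dots> = (\<integral>\<^sup>+g. indicator {g. first_after i s k (g, undefined)} g * H (shift_gap i s k g) \<partial>G)"
    proof (intro nn_integral_cong)
      fix g assume g: "g \<in> space G"
      then have sg: "shift_gap i s k g \<in> space G" using measurable_space[OF measurable_shift_gap[OF i]] by blast
      have [measurable]: "(\<lambda>q. F (shift_gap i s k g, shift_sojourn i k (fst q), snd q)) \<in> borel_measurable (S \<Otimes>\<^sub>M U)"
        using sg by measurable
      have "(\<integral>\<^sup>+q. indicator {\<omega>. first_after i s k \<omega>} (g, q) * F (shift i s k (g, q)) \<partial>(S \<Otimes>\<^sub>M U)) =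
          (\<integral>\<^sup>+q. indicator {g. first_after i s k (g, undefined)} g *
            F (shift_gap i s k g, shift_sojourn i k (fst q), snd q) \<partial>(S \<Otimes>\<^sub>M U))"
        using ind by (intro nn_integral_cong) (simp add: indicator_def shift_def, metis)
      also have "\<dots> = indicator {g. first_after i s k (g, undefined)} g * H (shift_gap i s k g)"
        by (subst nn_integral_cmult) (auto simp: sq[OF sg])
      finally show "(\<integral>\<^sup>+q. indicator {\<omega>. first_after i s k \<omega>} (g, q) * F (shift i s k (g, q)) \<partial>(S \<Otimes>\<^sub>M U)) =
        indicator {g. first_after i s k (g, undefined)} g * H (shift_gap i s k g)" .
    qed
    also have "\<dots> = ?c * (\<integral>\<^sup>+g. H g \<partial>G)"
      by (rule nn_integral_first_after_gap[OF i s H])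
    also have "(\<integral>\<^sup>+g. H g \<partial>G) = (\<integral>\<^sup>+\<omega>. F \<omega> \<partial>L)"
      unfolding H_def full_outcome_measure_def by (subst SU.nn_integral_fst) auto
    finally show ?thesis .
  qed
  have "emeasure L {\<omega> \<in> space L. first_after i s k \<omega>} = (\<integral>\<^sup>+\<omega>. indicator {\<omega> \<in> space L. first_after i s k \<omega>} \<omega> \<partial>L)"
    by (subst nn_integral_indicator) auto
  also have "\<dots> = (\<integral>\<^sup>+\<omega>. indicator {\<omega>. first_after i s k \<omega>} \<omega> * 1 \<partial>L)"
    by (intro nn_integral_cong) (auto simp: indicator_def)
  also have "\<dots> = ?c"
    using main[of "\<lambda>_. 1"] by (simp add: L.emeasure_space_1)
  finally show ?thesis using main[OF F] by simp
qed

text \<open>Split according to the index of the first arrival after \<open>s\<close>. On regular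
  outcomes exactly one index applies, so the weights of the pieces sum to 1.\<close>

lemma nn_integral_restart:
  assumes i: "i \<in> agent_types I" and s: "0 \<le> s" and F: "F \<in> borel_measurable L"
  shows "(\<integral>\<^sup>+\<omega>. F (restart i s \<omega>) \<partial>L) = (\<integral>\<^sup>+\<omega>. F \<omega> \<partial>L)"
proof -
  note [measurable] = pred_first_after[OF i]
  have ex: "\<exists>k. first_after i s k \<omega>" if r: "regular \<omega>" for \<omega>
  proof -
    have "s < arrival \<omega> (i, LEAST k. s < arrival \<omega> (i, k))"
      using regular_ex_arrival_gt[OF r i, of s] by (rule LeastI_ex)
    then have "first_after i s (LEAST k. s < arrival \<omega> (i, k)) \<omega>"
      by (auto simp: first_after_def dest: not_less_Least)
    then show ?thesis by blast
  qed
  have split: "(\<Sum>k. indicator {\<omega>. first_after i s k \<omega>} \<omega> * f k) = f (LEAST k. s < arrival \<omega> (i, k))"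
    if r: "regular \<omega>" for \<omega> and f :: "nat \<Rightarrow> ennreal"
  proof -
    obtain k where k: "first_after i s k \<omega>" using ex[OF r] by blast
    have "(\<Sum>k. indicator {\<omega>. first_after i s k \<omega>} \<omega> * f k) = (\<Sum>l\<in>{k}. indicator {\<omega>. first_after i s l \<omega>} \<omega> * f l)"
      using first_after_unique[OF k] first_after_unique[of i s _ \<omega>]
      by (intro suminf_finite) (auto simp: indicator_def)
    then show ?thesis using k first_after_unique[OF k] by simp
  qed
  have m: "(\<lambda>\<omega>. indicator {\<omega>. first_after i s k \<omega>} \<omega> * F (shift i s k \<omega>)) \<in> borel_measurable L" for k
    using measurable_compose[OF measurable_shift[OF i] F] by measurable
  have "(\<integral>\<^sup>+\<omega>. F (restart i s \<omega>) \<partial>L) = (\<integral>\<^sup>+\<omega>. (\<Sum>k. indicator {\<omega>. first_after i s k \<omega>} \<omega> * F (shift i s k \<omega>)) \<partial>L)"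
    unfolding restart_def
  proof (rule nn_integral_cong_AE)
    show "AE \<omega> in L. F (shift i s (LEAST k. s < arrival \<omega> (i, k)) \<omega>) =
        (\<Sum>k. indicator {\<omega>. first_after i s k \<omega>} \<omega> * F (shift i s k \<omega>))"
      using AE_regular by eventually_elim (rule split[symmetric])
  qed
  also have "\<dots> = (\<Sum>k. emeasure L {\<omega> \<in> space L. first_after i s k \<omega>} * (\<integral>\<^sup>+\<omega>. F \<omega> \<partial>L))"
    using m by (subst nn_integral_suminf) (auto simp: nn_integral_first_after[OF i s F])
  also have "\<dots> = (\<Sum>k. emeasure L {\<omega> \<in> space L. first_after i s k \<omega>}) * (\<integral>\<^sup>+\<omega>. F \<omega> \<partial>L)"
    by simp
  also have "(\<Sum>k. emeasure L {\<omega> \<in> space L. first_after i s k \<omega>}) =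
      (\<Sum>k. \<integral>\<^sup>+\<omega>. indicator {\<omega>. first_after i s k \<omega>} \<omega> * 1 \<partial>L)"
    by (intro suminf_cong, subst nn_integral_indicator[symmetric], simp)
      (intro nn_integral_cong, simp add: indicator_def)
  also have "\<dots> = (\<integral>\<^sup>+\<omega>. (\<Sum>k. indicator {\<omega>. first_after i s k \<omega>} \<omega> * 1) \<partial>L)"
    by (rule nn_integral_suminf[symmetric]) measurable
  also have "\<dots> = (\<integral>\<^sup>+\<omega>. 1 \<partial>L)"
  proof (rule nn_integral_cong_AE)
    show "AE \<omega> in L. (\<Sum>k. indicator {\<omega>. first_after i s k \<omega>} \<omega> * 1) = (1 :: ennreal)"
      using AE_regular by eventually_elim (rule split)
  qed
  finally show ?thesis by (simp add: L.emeasure_space_1)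
qed

text \<open>The iterated \<open>restart\<close> in closed form. All indices are read off the
  original outcome, so no order of the types has to be chosen and arrivals and departures can be
  computed directly.\<close>

definition restart_types :: "'a set \<Rightarrow> real \<Rightarrow> 'a outcome \<Rightarrow> 'a outcome" where
  "restart_types J s \<omega> =
     (\<lambda>a\<in>agents I. if fst a \<in> J then
        (if snd a = 0 then arrival \<omega> (fst a, LEAST k. s < arrival \<omega> (fst a, k)) - s
         else gap \<omega> (fst a, (LEAST k. s < arrival \<omega> (fst a, k)) + snd a)) else gap \<omega> a,
      \<lambda>a\<in>agents I. sojourn \<omega>
        (if fst a \<in> J then (fst a, (LEAST k. s < arrival \<omega> (fst a, k)) + snd a) else a),
      seed \<omega>)"

lemma gap_restart_types:
  assumes "a \<in> agents I"
  shows "gap (restart_types J s \<omega>) a = (if fst a \<in> J then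
        (if snd a = 0 then arrival \<omega> (fst a, LEAST k. s < arrival \<omega> (fst a, k)) - s
         else gap \<omega> (fst a, (LEAST k. s < arrival \<omega> (fst a, k)) + snd a)) else gap \<omega> a)"
  using assms by (subst gap_def) (simp add: restart_types_def)

lemma sojourn_restart_types:
  assumes "a \<in> agents I"
  shows "sojourn (restart_types J s \<omega>) a = sojourn \<omega>
        (if fst a \<in> J then (fst a, (LEAST k. s < arrival \<omega> (fst a, k)) + snd a) else a)"
  using assms by (subst sojourn_def) (simp add: restart_types_def)

lemma restart_types_empty: "\<omega> \<in> space L \<Longrightarrow> restart_types {} s \<omega> = \<omega>"
  by (cases \<omega>) (auto simp: restart_types_def gap_def sojourn_def seed_def full_outcome_measure_def
    space_pair_measure space_PiM intro!: PiE_restrict)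

lemma arrival_restart_types_other:
  assumes "i \<in> agent_types I" "i \<notin> J"
  shows "arrival (restart_types J s \<omega>) (i, k) = arrival \<omega> (i, k)"
  using assms by (simp add: arrival_def gap_def restart_types_def agents_iff)

text \<open>Restarting other types leaves the arrivals of type \<open>i\<close> alone, so the index
  found afterwards is the one in the original outcome.\<close>

lemma restart_types_insert:
  assumes "i \<in> agent_types I" "i \<notin> J"
  shows "restart_types (insert i J) s \<omega> = restart i s (restart_types J s \<omega>)"
proof -
  have arr: "gap_arrival (fst (restart_types J s \<omega>)) (i, k) = arrival \<omega> (i, k)" for k
    using arrival_restart_types_other[OF assms, of s \<omega> k] by (simp add: arrival_def gap_arrival_def gap_def)
  have 1: "fst (restart_types (insert i J) s \<omega>) = fst (restart i s (restart_types J s \<omega>))"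
    unfolding restart_def shift_def shift_gap_def arrival_restart_types_other[OF assms] fst_conv arr
    using assms by (auto simp: restart_types_def agents_iff intro!: restrict_ext)
  have 2: "fst (snd (restart_types (insert i J) s \<omega>)) = fst (snd (restart i s (restart_types J s \<omega>)))"
    unfolding restart_def shift_def shift_sojourn_def arrival_restart_types_other[OF assms] fst_conv snd_conv
    using assms by (auto simp: restart_types_def agents_iff intro!: restrict_ext)
  have 3: "snd (snd (restart_types (insert i J) s \<omega>)) = snd (snd (restart i s (restart_types J s \<omega>)))"
    by (simp add: restart_def shift_def restart_types_def)
  show ?thesis using 1 2 3 by (simp add: prod_eq_iff)
qed

lemma measurable_restart:
  assumes i: "i \<in> agent_types I"
  shows "restart i s \<in> measurable L L"
proof -
  have [measurable]: "(\<lambda>\<omega>. arrival \<omega> (i, l)) \<in> borel_measurable L" for l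
    using i by (intro measurable_arrival) (simp add: agents_iff)
  have "(\<lambda>\<omega>. LEAST k. s < arrival \<omega> (i, k)) \<in> measurable L (count_space UNIV)"
    by measurable
  then show ?thesis
    unfolding restart_def using measurable_shift[OF i]
    by (rule measurable_compose_countable[rotated])
qed

lemma restart_types_preserves:
  assumes J: "J \<subseteq> agent_types I" and s: "0 \<le> s"
  shows "restart_types J s \<in> measurable L L \<and>
    (\<forall>F\<in>borel_measurable L. (\<integral>\<^sup>+\<omega>. F (restart_types J s \<omega>) \<partial>L) = (\<integral>\<^sup>+\<omega>. F \<omega> \<partial>L))"
  using finite_subset[OF J finite_types] J
proof (induction J rule: finite_induct)
  case empty
  have "restart_types {} s \<in> measurable L L"
    by (subst measurable_cong[where g = "\<lambda>\<omega>. \<omega>"]) (auto simp: restart_types_empty)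
  then show ?case
    by (auto intro!: nn_integral_cong simp: restart_types_empty)
next
  case (insert i J)
  then have i: "i \<in> agent_types I" "i \<notin> J" by auto
  have eq: "restart_types (insert i J) s = (\<lambda>\<omega>. restart i s (restart_types J s \<omega>))"
    using restart_types_insert[OF i] by auto
  have IH: "restart_types J s \<in> measurable L L"
    "F \<in> borel_measurable L \<Longrightarrow> (\<integral>\<^sup>+\<omega>. F (restart_types J s \<omega>) \<partial>L) = (\<integral>\<^sup>+\<omega>. F \<omega> \<partial>L)" for F :: "_ \<Rightarrow> ennreal"
    using insert by auto
  have "(\<integral>\<^sup>+\<omega>. F (restart i s (restart_types J s \<omega>)) \<partial>L) = (\<integral>\<^sup>+\<omega>. F \<omega> \<partial>L)"
    if F: "F \<in> borel_measurable L" for F :: "_ \<Rightarrow> ennreal"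
    using IH(2)[OF measurable_compose[OF measurable_restart[OF i(1)] F]] nn_integral_restart[OF i(1) s F] by simp
  then show ?case
    unfolding eq using measurable_compose[OF IH(1) measurable_restart[OF i(1)]] by auto
qed

section \<open>The outcome seen from time \<open>s\<close>\<close>

lemma LEAST_arrival_gt:
  assumes r: "regular \<omega>" and i: "i \<in> agent_types I"
  shows "s < arrival \<omega> (i, LEAST k. s < arrival \<omega> (i, k))"
  using regular_ex_arrival_gt[OF r i, of s] by (rule LeastI_ex)

text \<open>The original agent that carries the label \<open>a\<close> after the restart. Under this
  map the restarted outcome is the original one with the clock set back by \<open>s\<close>.\<close>

definition relabel :: "real \<Rightarrow> 'a outcome \<Rightarrow> 'a agent \<Rightarrow> 'a agent" where
  "relabel s \<omega> a = (fst a, (LEAST k. s < arrival \<omega> (fst a, k)) + snd a)"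

abbreviation "restart_all \<equiv> restart_types (agent_types I)"

lemma arrival_relabel_gt:
  assumes r: "regular \<omega>" and a: "a \<in> agents I"
  shows "s < arrival \<omega> (relabel s \<omega> a)"
proof -
  have "arrival \<omega> (fst a, LEAST k. s < arrival \<omega> (fst a, k)) \<le> arrival \<omega> (relabel s \<omega> a)"
    unfolding relabel_def
    using strict_mono_arrival[of \<omega> "fst a", THEN strict_mono_less_eq] r a
    by (simp add: regular_outcome_def agents_iff)
  then show ?thesis
    using LEAST_arrival_gt[OF r, of "fst a" s] a by (simp add: agents_iff)
qed

lemma arrival_restart_all:
  assumes a: "a \<in> agents I"
  shows "arrival (restart_all s \<omega>) a = arrival \<omega> (relabel s \<omega> a) - s"
proof -
  obtain i m where am: "a = (i, m)" by (cases a)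
  have i: "i \<in> agent_types I" using a am by (simp add: agents_iff)
  show ?thesis
    unfolding am
  proof (induction m)
    case 0
    have "arrival (restart_all s \<omega>) (i, 0) = gap (restart_all s \<omega>) (i, 0)"
      by (simp add: arrival_def)
    then show ?case using i by (simp add: gap_restart_types relabel_def agents_iff)
  next
    case (Suc m)
    then show ?case using i
      by (simp add: arrival_Suc gap_restart_types relabel_def agents_iff)
  qed
qed

lemma sojourn_restart_all: "a \<in> agents I \<Longrightarrow> sojourn (restart_all s \<omega>) a = sojourn \<omega> (relabel s \<omega> a)"
  by (simp add: sojourn_restart_types relabel_def agents_iff)

lemma departure_restart_all:
  "a \<in> agents I \<Longrightarrow> departure (restart_all s \<omega>) a = departure \<omega> (relabel s \<omega> a) - s"
  by (simp add: departure_def arrival_restart_all sojourn_restart_all)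

lemma relabel_agents: "relabel s \<omega> a \<in> agents I \<longleftrightarrow> a \<in> agents I"
  by (simp add: relabel_def agents_iff)

lemma regular_restart_all:
  assumes r: "regular \<omega>"
  shows "regular (restart_all s \<omega>)"
  unfolding regular_iff
proof (intro conjI ballI allI)
  fix a assume a: "a \<in> agents I"
  show "0 < sojourn (restart_all s \<omega>) a"
    using a regular_sojourn_pos[OF r, of "relabel s \<omega> a"] by (simp add: sojourn_restart_all relabel_agents)
  show "0 < gap (restart_all s \<omega>) a"
  proof (cases "snd a")
    case 0
    then show ?thesis
      using arrival_relabel_gt[OF r a, of s] a by (simp add: gap_restart_types relabel_def agents_iff)
  next
    case (Suc m)
    then show ?thesis
      using regular_gap_pos[OF r, of "relabel s \<omega> a"] a
      by (simp add: gap_restart_types relabel_def agents_iff)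
  qed
next
  fix i n assume i: "i \<in> agent_types I"
  obtain k where k: "real n + s < arrival \<omega> (i, k)"
    using regular_ex_arrival_gt[OF r i] by blast
  have "arrival \<omega> (i, k) \<le> arrival \<omega> (relabel s \<omega> (i, k))"
    unfolding relabel_def
    using strict_mono_arrival[of \<omega> i, THEN strict_mono_less_eq] r i by (simp add: regular_outcome_def)
  then show "\<exists>k. real n < arrival (restart_all s \<omega>) (i, k)"
    using k i by (intro exI[of _ k]) (simp add: arrival_restart_all agents_iff)
qed

section \<open>The omniscient benchmark\<close>

lemma offline_edges_iff:
  assumes r: "regular \<omega>"
  shows "(a, b) \<in> offline_edges I \<omega> t \<longleftrightarrow> a \<in> agents I \<and> b \<in> agents I \<and>
    arrival \<omega> a < arrival \<omega> b \<and> arrival \<omega> b \<le> t \<and> arrival \<omega> b \<le> departure \<omega> a"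
proof -
  have "{arrival \<omega> a..departure \<omega> a} \<inter> {arrival \<omega> b..departure \<omega> b} \<noteq> {} \<longleftrightarrow> arrival \<omega> b \<le> departure \<omega> a"
    if "a \<in> agents I" "b \<in> agents I" "arrival \<omega> a < arrival \<omega> b"
  proof
    assume "arrival \<omega> b \<le> departure \<omega> a"
    then have "arrival \<omega> b \<in> {arrival \<omega> a..departure \<omega> a} \<inter> {arrival \<omega> b..departure \<omega> b}"
      using that regular_sojourn_pos[OF r that(2)] by (auto simp: departure_def)
    then show "{arrival \<omega> a..departure \<omega> a} \<inter> {arrival \<omega> b..departure \<omega> b} \<noteq> {}" by blast
  qed auto
  then show ?thesis by (auto simp: offline_edges_def)
qed

lemma finite_offline_edges:
  assumes r: "regular \<omega>"
  shows "finite (offline_edges I \<omega> t)"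
proof (rule finite_subset)
  show "offline_edges I \<omega> t \<subseteq> {a \<in> agents I. arrival \<omega> a \<le> t} \<times> {a \<in> agents I. arrival \<omega> a \<le> t}"
    by (auto simp: offline_edges_def)
qed (intro finite_cartesian_product regular_finite r)

abbreviation offline_matchings :: "'a outcome \<Rightarrow> real \<Rightarrow> ('a agent \<times> 'a agent) set set" where
  "offline_matchings \<omega> t \<equiv> {M. M \<subseteq> offline_edges I \<omega> t \<and> is_matching M}"

lemma finite_offline_matchings: "regular \<omega> \<Longrightarrow> finite (offline_matchings \<omega> t)"
  by (rule finite_subset[of _ "Pow (offline_edges I \<omega> t)"]) (auto simp: finite_offline_edges)

lemma matching_weight_le_max:
  assumes "regular \<omega>" "M \<subseteq> offline_edges I \<omega> t" "is_matching M"
  shows "matching_weight I M \<le> max_matching_weight I \<omega> t"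
  unfolding max_matching_weight_def
  by (intro Max_ge finite_imageI finite_offline_matchings imageI) (use assms in auto)

lemma max_matching_weight_attained:
  assumes "regular \<omega>"
  obtains M where "M \<subseteq> offline_edges I \<omega> t" "is_matching M" "max_matching_weight I \<omega> t = matching_weight I M"
proof -
  have "{} \<in> offline_matchings \<omega> t" by (simp add: is_matching_def)
  then have "max_matching_weight I \<omega> t \<in> matching_weight I ` offline_matchings \<omega> t"
    unfolding max_matching_weight_def
    by (intro Max_in finite_imageI finite_offline_matchings assms) blast
  then show ?thesis using that by auto
qed

lemma max_matching_weight_nonneg: "regular \<omega> \<Longrightarrow> 0 \<le> max_matching_weight I \<omega> t"
  using matching_weight_le_max[of \<omega> "{}" t] by (simp add: is_matching_def matching_weight_def)

definition total_reward :: real where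
  "total_reward = (\<Sum>i\<in>agent_types I. \<Sum>j\<in>agent_types I. \<bar>reward I i j\<bar>)"

lemma total_reward_nonneg: "0 \<le> total_reward"
  unfolding total_reward_def by (intro sum_nonneg) auto

lemma reward_le_total:
  assumes "i \<in> agent_types I" "j \<in> agent_types I"
  shows "reward I i j \<le> total_reward"
proof -
  have "\<bar>reward I i j\<bar> \<le> (\<Sum>j\<in>agent_types I. \<bar>reward I i j\<bar>)"
    using assms finite_types by (intro member_le_sum) auto
  also have "\<dots> \<le> total_reward"
    unfolding total_reward_def
    using assms finite_types by (intro member_le_sum[where f = "\<lambda>i. \<Sum>j\<in>agent_types I. \<bar>reward I i j\<bar>"] sum_nonneg) auto
  finally show ?thesis by simp
qed

text \<open>The earlier endpoints of the edges of a matching are distinct arrived agents, so the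
  number of agents bounds the number of edges. This makes the benchmark at most linear in the
  horizon.\<close>

lemma max_matching_weight_le:
  assumes r: "regular \<omega>"
  shows "max_matching_weight I \<omega> t \<le> total_reward * (\<Sum>i\<in>agent_types I. real (card {k. arrival \<omega> (i, k) \<le> t}))"
proof -
  obtain M where M: "M \<subseteq> offline_edges I \<omega> t" "is_matching M" "max_matching_weight I \<omega> t = matching_weight I M"
    by (rule max_matching_weight_attained[OF r])
  let ?A = "{a \<in> agents I. arrival \<omega> a \<le> t}"
  have inj: "inj_on fst M"
    using M(2) unfolding is_matching_def inj_on_def by (metis disjoint_insert(1) insertI1)
  have "matching_weight I M \<le> (\<Sum>e\<in>M. total_reward)"
    unfolding matching_weight_def
    using M(1) by (intro sum_mono) (auto simp: offline_edges_def agents_iff intro!: reward_le_total)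
  also have "\<dots> = total_reward * real (card M)" by simp
  also have "card M = card (fst ` M)" using inj by (simp add: card_image)
  also have "card (fst ` M) \<le> card ?A"
    using M(1) by (intro card_mono regular_finite r) (force simp: offline_edges_def)
  also have "?A = (SIGMA i:agent_types I. {k. arrival \<omega> (i, k) \<le> t})"
    by (auto simp: agents_iff)
  also have "card \<dots> = (\<Sum>i\<in>agent_types I. card {k. arrival \<omega> (i, k) \<le> t})"
  proof (rule card_SigmaI[OF finite_types], rule ballI)
    fix i assume "i \<in> agent_types I"
    then have "Pair i ` {k. arrival \<omega> (i, k) \<le> t} \<subseteq> ?A" by (auto simp: agents_iff)
    then have "finite (Pair i ` {k. arrival \<omega> (i, k) \<le> t})"
      using regular_finite[OF r] by (rule finite_subset)
    then show "finite {k. arrival \<omega> (i, k) \<le> t}"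
      by (rule finite_imageD) (simp add: inj_on_def)
  qed
  finally show ?thesis
    using M(3) total_reward_nonneg by (simp add: mult_left_mono)
qed

text \<open>Take an optimal matching among the arrivals up to \<open>s\<close> and one among the
  later arrivals. They share no agent, and translating time preserves edges and their order, so the
  union is a matching for the long horizon; edges across \<open>s\<close> are given up.\<close>

lemma max_matching_weight_superadd:
  assumes r: "regular \<omega>" and s: "0 \<le> s" "0 \<le> t"
  shows "max_matching_weight I \<omega> s + max_matching_weight I (restart_all s \<omega>) t \<le> max_matching_weight I \<omega> (s + t)"
proof -
  let ?\<omega>' = "restart_all s \<omega>" and ?\<phi> = "map_prod (relabel s \<omega>) (relabel s \<omega>)"
  have r': "regular ?\<omega>'" by (rule regular_restart_all[OF r])
  obtain M where M: "M \<subseteq> offline_edges I \<omega> s" "is_matching M" "max_matching_weight I \<omega> s = matching_weight I M"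
    by (rule max_matching_weight_attained[OF r])
  obtain N where N: "N \<subseteq> offline_edges I ?\<omega>' t" "is_matching N" "max_matching_weight I ?\<omega>' t = matching_weight I N"
    by (rule max_matching_weight_attained[OF r'])
  have inj: "relabel s \<omega> a = relabel s \<omega> b \<longleftrightarrow> a = b" for a b
    by (auto simp: relabel_def prod_eq_iff)
  have early: "arrival \<omega> a \<le> s \<and> arrival \<omega> b \<le> s" if "(a, b) \<in> M" for a b
    using that M(1) by (auto simp: offline_edges_def)
  have late: "s < arrival \<omega> a \<and> s < arrival \<omega> b" if "(a, b) \<in> ?\<phi> ` N" for a b
    using that N(1) arrival_relabel_gt[OF r] by (auto simp: offline_edges_def)
  have "?\<phi> ` N \<subseteq> offline_edges I \<omega> (s + t)"
  proof
    fix e assume "e \<in> ?\<phi> ` N"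
    then obtain a b where ab: "(a, b) \<in> N" "e = (relabel s \<omega> a, relabel s \<omega> b)" by auto
    then have "(a, b) \<in> offline_edges I ?\<omega>' t" using N(1) by auto
    then show "e \<in> offline_edges I \<omega> (s + t)"
      unfolding ab(2) offline_edges_iff[OF r] offline_edges_iff[OF r']
      by (auto simp: relabel_agents arrival_restart_all departure_restart_all)
  qed
  moreover have "M \<subseteq> offline_edges I \<omega> (s + t)"
    using M(1) s by (auto simp: offline_edges_def)
  moreover have "is_matching (M \<union> ?\<phi> ` N)"
    unfolding is_matching_def
  proof (intro ballI impI)
    fix e f assume ef: "e \<in> M \<union> ?\<phi> ` N" "f \<in> M \<union> ?\<phi> ` N" "e \<noteq> f"
    have mixed: "{fst e, snd e} \<inter> {fst f, snd f} = {}" if "e \<in> M" "f \<in> ?\<phi> ` N" for e f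
      using early[of "fst e" "snd e"] late[of "fst f" "snd f"] that by auto
    have NN: "{fst e, snd e} \<inter> {fst f, snd f} = {}" if h: "e \<in> ?\<phi> ` N" "f \<in> ?\<phi> ` N" "e \<noteq> f" for e f
    proof -
      obtain e' where e': "e = ?\<phi> e'" "e' \<in> N" using h(1) by (rule imageE)
      obtain f' where f': "f = ?\<phi> f'" "f' \<in> N" using h(2) by (rule imageE)
      have "e' \<noteq> f'" using h(3) e' f' by blast
      then have "{fst e', snd e'} \<inter> {fst f', snd f'} = {}"
        using N(2) e'(2) f'(2) unfolding is_matching_def by blast
      then show ?thesis unfolding e'(1) f'(1) by (simp add: inj)
    qed
    consider "e \<in> M" "f \<in> M" | "e \<in> M" "f \<in> ?\<phi> ` N" | "f \<in> M" "e \<in> ?\<phi> ` N" | "e \<in> ?\<phi> ` N" "f \<in> ?\<phi> ` N"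
      using ef by blast
    then show "{fst e, snd e} \<inter> {fst f, snd f} = {}"
    proof cases
      case 1
      then show ?thesis using M(2) ef(3) unfolding is_matching_def by blast
    next
      case 2
      then show ?thesis by (rule mixed)
    next
      case 3
      then show ?thesis using mixed[of f e] by (simp only: Int_commute)
    next
      case 4
      then show ?thesis using ef(3) by (rule NN)
    qed
  qed
  ultimately have "matching_weight I (M \<union> ?\<phi> ` N) \<le> max_matching_weight I \<omega> (s + t)"
    by (intro matching_weight_le_max r) auto
  also have "matching_weight I (M \<union> ?\<phi> ` N) = matching_weight I M + matching_weight I (?\<phi> ` N)"
    unfolding matching_weight_def
  proof (rule sum.union_disjoint)
    show "finite M" using M(1) finite_offline_edges[OF r] by (rule finite_subset)
    show "finite (?\<phi> ` N)" using finite_subset[OF N(1) finite_offline_edges[OF r']] by simp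
    show "M \<inter> ?\<phi> ` N = {}" using early late by fastforce
  qed
  also have "matching_weight I (?\<phi> ` N) = matching_weight I N"
    unfolding matching_weight_def
    by (subst sum.reindex) (auto simp: inj inj_on_def relabel_def intro!: sum.cong)
  finally show ?thesis using M(3) N(3) by simp
qed

text \<open>The set under the maximum varies with the outcome. But exceeding \<open>c\<close> means
  that some finite matching of weight above \<open>c\<close> is available, and there are only
  countably many finite sets of pairs of agents.\<close>

lemma pred_max_matching_weight_gt:
  "Measurable.pred L (\<lambda>\<omega>. regular \<omega> \<and> c < max_matching_weight I \<omega> t)"
proof -
  let ?MM = "{M. finite M \<and> M \<subseteq> agents I \<times> agents I \<and> is_matching M \<and> c < matching_weight I M}"
  have "countable ?MM"
    by (rule countable_subset[OF _ countable_Collect_finite]) auto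
  moreover have "{\<omega> \<in> space L. regular \<omega> \<and> M \<subseteq> offline_edges I \<omega> t} \<in> sets L" if "M \<in> ?MM" for M
  proof -
    have "Measurable.pred L (\<lambda>\<omega>. \<forall>e\<in>M. arrival \<omega> (fst e) < arrival \<omega> (snd e) \<and> arrival \<omega> (snd e) \<le> t \<and>
        arrival \<omega> (snd e) \<le> departure \<omega> (fst e))"
    proof (rule pred_intros_finite(3))
      fix e assume "e \<in> M"
      then have e: "fst e \<in> agents I" "snd e \<in> agents I" using that by auto
      note [measurable] = measurable_arrival[OF e(1)] measurable_arrival[OF e(2)] measurable_departure[OF e(1)]
      show "Measurable.pred L (\<lambda>\<omega>. arrival \<omega> (fst e) < arrival \<omega> (snd e) \<and> arrival \<omega> (snd e) \<le> t \<and>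
        arrival \<omega> (snd e) \<le> departure \<omega> (fst e))"
        by measurable
    qed (use that in auto)
    then have "Measurable.pred L (\<lambda>\<omega>. regular \<omega> \<and> (\<forall>e\<in>M. arrival \<omega> (fst e) < arrival \<omega> (snd e) \<and> arrival \<omega> (snd e) \<le> t \<and>
        arrival \<omega> (snd e) \<le> departure \<omega> (fst e)))"
      by measurable
    also have "(\<lambda>\<omega>. regular \<omega> \<and> (\<forall>e\<in>M. arrival \<omega> (fst e) < arrival \<omega> (snd e) \<and> arrival \<omega> (snd e) \<le> t \<and>
        arrival \<omega> (snd e) \<le> departure \<omega> (fst e))) = (\<lambda>\<omega>. regular \<omega> \<and> M \<subseteq> offline_edges I \<omega> t)"
      using that by (fastforce simp: fun_eq_iff offline_edges_iff)
    finally show ?thesis by (simp add: pred_def)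
  qed
  ultimately have "(\<Union>M\<in>?MM. {\<omega> \<in> space L. regular \<omega> \<and> M \<subseteq> offline_edges I \<omega> t}) \<in> sets L"
    by (intro sets.countable_UN') auto
  also have "(\<Union>M\<in>?MM. {\<omega> \<in> space L. regular \<omega> \<and> M \<subseteq> offline_edges I \<omega> t}) =
      {\<omega> \<in> space L. regular \<omega> \<and> c < max_matching_weight I \<omega> t}"
  proof (intro equalityI subsetI)
    fix \<omega> assume "\<omega> \<in> {\<omega> \<in> space L. regular \<omega> \<and> c < max_matching_weight I \<omega> t}"
    then have w: "\<omega> \<in> space L" "regular \<omega>" "c < max_matching_weight I \<omega> t" by auto
    obtain M where M: "M \<subseteq> offline_edges I \<omega> t" "is_matching M" "max_matching_weight I \<omega> t = matching_weight I M"
      by (rule max_matching_weight_attained[OF w(2)])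
    moreover have "finite M" using M(1) finite_offline_edges[OF w(2)] by (rule finite_subset)
    moreover have "M \<subseteq> agents I \<times> agents I" using M(1) by (auto simp: offline_edges_def)
    ultimately show "\<omega> \<in> (\<Union>M\<in>?MM. {\<omega> \<in> space L. regular \<omega> \<and> M \<subseteq> offline_edges I \<omega> t})"
      using w by auto
  next
    fix \<omega> assume "\<omega> \<in> (\<Union>M\<in>?MM. {\<omega> \<in> space L. regular \<omega> \<and> M \<subseteq> offline_edges I \<omega> t})"
    then obtain M where "\<omega> \<in> space L" "regular \<omega>" "M \<subseteq> offline_edges I \<omega> t" "is_matching M" "c < matching_weight I M"
      by auto
    then show "\<omega> \<in> {\<omega> \<in> space L. regular \<omega> \<and> c < max_matching_weight I \<omega> t}"
      using matching_weight_le_max[of \<omega> M t] by auto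
  qed
  finally show ?thesis by (simp add: pred_def)
qed

section \<open>Superadditivity and linear growth of the expected maximum weight\<close>

lemma measurable_max_matching_weight:
  "(\<lambda>\<omega>. max_matching_weight I \<omega> t) \<in> borel_measurable \<Omega>"
proof (subst borel_measurable_iff_greater, intro allI)
  fix c
  have "{\<omega> \<in> space \<Omega>. c < max_matching_weight I \<omega> t} = {\<omega> \<in> space L. regular \<omega> \<and> c < max_matching_weight I \<omega> t}"
    by (auto simp: space_Omega)
  then show "{\<omega> \<in> space \<Omega>. c < max_matching_weight I \<omega> t} \<in> sets \<Omega>"
    using pred_max_matching_weight_gt[of c t] by (auto simp: sets_Omega_iff pred_def)
qed

lemma nn_integral_Omega:
  "(\<integral>\<^sup>+\<omega>. f \<omega> \<partial>\<Omega>) = (\<integral>\<^sup>+\<omega>. f \<omega> * indicator {\<omega>. regular \<omega>} \<omega> \<partial>L)"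
  unfolding outcome_space_def by (rule nn_integral_restrict_space[OF regular_sets])

definition offline_value :: "real \<Rightarrow> ennreal" where
  "offline_value t = (\<integral>\<^sup>+\<omega>. ennreal (max_matching_weight I \<omega> t) \<partial>\<Omega>)"

lemma measurable_offline_integrand:
  "(\<lambda>\<omega>. ennreal (max_matching_weight I \<omega> t) * indicator {\<omega>. regular \<omega>} \<omega>) \<in> borel_measurable L"
  using measurable_max_matching_weight[of t] unfolding outcome_space_def
  by (subst borel_measurable_restrict_space_iff_ennreal[OF regular_sets, symmetric]) auto

text \<open>Invariance under the restart turns the second summand into an expectation over the same
  outcome, where the pointwise inequality applies.\<close>

lemma offline_value_superadd:
  assumes s: "0 \<le> s" "0 \<le> t"
  shows "offline_value s + offline_value t \<le> offline_value (s + t)"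
proof -
  let ?f = "\<lambda>t \<omega>. ennreal (max_matching_weight I \<omega> t) * indicator {\<omega>. regular \<omega>} \<omega>"
  note m = measurable_offline_integrand
  have T: "restart_all s \<in> measurable L L"
    "F \<in> borel_measurable L \<Longrightarrow> (\<integral>\<^sup>+\<omega>. F (restart_all s \<omega>) \<partial>L) = (\<integral>\<^sup>+\<omega>. F \<omega> \<partial>L)" for F :: "_ \<Rightarrow> ennreal"
    using restart_types_preserves[of "agent_types I" s] s by auto
  have "offline_value s + offline_value t = (\<integral>\<^sup>+\<omega>. ?f s \<omega> \<partial>L) + (\<integral>\<^sup>+\<omega>. ?f t (restart_all s \<omega>) \<partial>L)"
    by (simp add: offline_value_def nn_integral_Omega T(2)[OF m])
  also have "\<dots> = (\<integral>\<^sup>+\<omega>. ?f s \<omega> + ?f t (restart_all s \<omega>) \<partial>L)"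
    using measurable_compose[OF T(1) m] by (intro nn_integral_add[symmetric] m) auto
  also have "\<dots> \<le> (\<integral>\<^sup>+\<omega>. ?f (s + t) \<omega> \<partial>L)"
  proof (rule nn_integral_mono_AE)
    show "AE \<omega> in L. ?f s \<omega> + ?f t (restart_all s \<omega>) \<le> ?f (s + t) \<omega>"
      using AE_regular
    proof eventually_elim
      case (elim \<omega>)
      then have "0 \<le> max_matching_weight I (restart_all s \<omega>) t"
        by (intro max_matching_weight_nonneg regular_restart_all)
      then show ?case
        using elim max_matching_weight_superadd[OF elim s] max_matching_weight_nonneg[OF elim, of s]
        by (simp add: regular_restart_all ennreal_plus[symmetric] ennreal_leI del: ennreal_plus)
    qed
  qed
  finally show ?thesis by (simp add: offline_value_def nn_integral_Omega)
qed

lemma offline_value_le: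
  assumes t: "0 \<le> t"
  shows "offline_value t \<le> ennreal (total_reward * (\<Sum>i\<in>agent_types I. arr_rate I i) * t)"
proof -
  have card_le: "(\<integral>\<^sup>+\<omega>. (\<Sum>k. indicator {k. arrival \<omega> (i, k) \<le> t} k) \<partial>\<Omega>) \<le> ennreal (arr_rate I i * t)"
    if i: "i \<in> agent_types I" for i
  proof -
    have [measurable]: "(\<lambda>\<omega>. arrival \<omega> (i, l)) \<in> borel_measurable L" for l
      using i by (intro measurable_arrival) (simp add: agents_iff)
    have "(\<integral>\<^sup>+\<omega>. (\<Sum>k. indicator {k. arrival \<omega> (i, k) \<le> t} k) \<partial>\<Omega>) \<le>
        (\<Sum>k. emeasure L {\<omega> \<in> space L. regular \<omega> \<and> arrival \<omega> (i, k) \<le> t})"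
      by (rule nn_integral_Omega_suminf_indicator_le[where P = "\<lambda>k \<omega>. arrival \<omega> (i, k) \<le> t"]) auto
    also have "\<dots> \<le> ennreal (arr_rate I i * t)"
      by (rule suminf_arrived_le[OF i t])
    finally show ?thesis .
  qed
  have meas: "(\<lambda>\<omega>. \<Sum>k. indicator {k. arrival \<omega> (i, k) \<le> t} k :: ennreal) \<in> borel_measurable \<Omega>"
    if i: "i \<in> agent_types I" for i
  proof -
    have [measurable]: "(\<lambda>\<omega>. arrival \<omega> (i, l)) \<in> borel_measurable L" for l
      using i by (intro measurable_arrival) (simp add: agents_iff)
    have "(\<lambda>\<omega>. \<Sum>k. indicator {k. arrival \<omega> (i, k) \<le> t} k :: ennreal) \<in> borel_measurable L"
      unfolding indicator_def mem_Collect_eq by measurable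
    then show ?thesis unfolding outcome_space_def by (rule measurable_restrict_space1)
  qed
  have "offline_value t \<le> (\<integral>\<^sup>+\<omega>. ennreal total_reward *
      (\<Sum>i\<in>agent_types I. \<Sum>k. indicator {k. arrival \<omega> (i, k) \<le> t} k) \<partial>\<Omega>)"
    unfolding offline_value_def
  proof (rule nn_integral_mono)
    fix \<omega> assume "\<omega> \<in> space \<Omega>"
    then have r: "regular \<omega>" by (simp add: space_Omega)
    have "ennreal (max_matching_weight I \<omega> t) \<le>
        ennreal (total_reward * (\<Sum>i\<in>agent_types I. real (card {k. arrival \<omega> (i, k) \<le> t})))"
      by (intro ennreal_leI max_matching_weight_le r)
    also have "\<dots> = ennreal total_reward * (\<Sum>i\<in>agent_types I. ennreal (real (card {k. arrival \<omega> (i, k) \<le> t})))"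
      using total_reward_nonneg by (simp add: ennreal_mult sum_nonneg sum_ennreal)
    also have "\<dots> \<le> ennreal total_reward * (\<Sum>i\<in>agent_types I. \<Sum>k. indicator {k. arrival \<omega> (i, k) \<le> t} k)"
      using of_nat_card_le_suminf_indicator[of id] by (intro mult_left_mono sum_mono) auto
    finally show "ennreal (max_matching_weight I \<omega> t) \<le>
      ennreal total_reward * (\<Sum>i\<in>agent_types I. \<Sum>k. indicator {k. arrival \<omega> (i, k) \<le> t} k)" .
  qed
  also have "\<dots> = ennreal total_reward *
      (\<Sum>i\<in>agent_types I. \<integral>\<^sup>+\<omega>. (\<Sum>k. indicator {k. arrival \<omega> (i, k) \<le> t} k) \<partial>\<Omega>)"
    using meas by (subst nn_integral_cmult) (auto simp: nn_integral_sum)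
  also have "\<dots> \<le> ennreal total_reward * (\<Sum>i\<in>agent_types I. ennreal (arr_rate I i * t))"
    by (intro mult_left_mono sum_mono card_le) auto
  also have "\<dots> = ennreal (total_reward * (\<Sum>i\<in>agent_types I. arr_rate I i) * t)"
    using total_reward_nonneg rates_pos t
    by (simp add: sum_ennreal ennreal_mult[symmetric] sum_nonneg less_imp_le sum_distrib_right[symmetric] mult.assoc)
  finally show ?thesis .
qed

lemma OFF_upto_eq: "OFF_upto I t = 1 / t * enn2real (offline_value t)"
  unfolding OFF_upto_def offline_value_def
  by (subst integral_eq_nn_integral[OF measurable_max_matching_weight])
    (auto simp: space_Omega max_matching_weight_nonneg)

end

text \<open>Fekete's lemma in continuous time. The second conclusion, that the limit dominates every
  finite horizon, is what later allows a lower bound from one horizon only.\<close>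

lemma superadditive_limit:
  fixes f :: "real \<Rightarrow> real"
  assumes nonneg: "\<And>t. 0 \<le> t \<Longrightarrow> 0 \<le> f t"
    and super: "\<And>s t. 0 \<le> s \<Longrightarrow> 0 \<le> t \<Longrightarrow> f s + f t \<le> f (s + t)"
    and bound: "\<And>t. 0 \<le> t \<Longrightarrow> f t \<le> C * t"
  shows "\<exists>l. ((\<lambda>t. 1 / t * f t) \<longlongrightarrow> l) at_top \<and> (\<forall>t>0. f t / t \<le> l)"
proof -
  define l where "l = (SUP t\<in>{0<..}. f t / t)"
  have bdd: "bdd_above ((\<lambda>t. f t / t) ` {0<..})"
    using bound by (intro bdd_aboveI[of _ C]) (auto simp: field_simps)
  have le: "f t / t \<le> l" if "0 < t" for t
    unfolding l_def using that by (intro cSUP_upper bdd) auto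
  have iter: "real n * f t \<le> f (real n * t)" if "0 \<le> t" for n t
  proof (induction n)
    case (Suc n)
    then show ?case using super[of "real n * t" t] that by (simp add: algebra_simps)
  qed (use nonneg[of 0] in simp)
  have "((\<lambda>t. 1 / t * f t) \<longlongrightarrow> l) at_top"
  proof (rule order_tendstoI)
    fix a assume "a < l"
    then obtain u where u: "0 < u" "a < f u / u"
      unfolding l_def using less_cSUP_iff[OF _ bdd] by auto
    have "((\<lambda>t. f u / u - f u / t) \<longlongrightarrow> f u / u - 0) at_top"
      by (intro tendsto_intros tendsto_divide_0[OF tendsto_const] filterlim_at_top_imp_at_infinity filterlim_ident)
    then have "\<forall>\<^sub>F t in at_top. a < f u / u - f u / t"
      using u by (intro order_tendstoD(1)) auto
    moreover have "\<forall>\<^sub>F t in at_top. (0::real) < t" by (rule eventually_gt_at_top)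
    ultimately show "\<forall>\<^sub>F t in at_top. a < 1 / t * f t"
    proof eventually_elim
      case (elim t)
      \<comment> \<open>Fit \<open>n\<close> blocks of length \<open>u\<close> into
        \<open>t\<close>. The rest of length below \<open>u\<close> is discarded by nonnegativity
        and costs at most \<open>f u / t\<close>.\<close>
      define n where "n = nat \<lfloor>t / u\<rfloor>"
      have n: "real n * u \<le> t" "t / u - 1 \<le> real n"
      proof -
        have "real n = of_int \<lfloor>t / u\<rfloor>" using elim u by (simp add: n_def)
        then have "real n \<le> t / u" "t / u - 1 \<le> real n" by linarith+
        then show "real n * u \<le> t" "t / u - 1 \<le> real n" using u by (auto simp: le_divide_eq)
      qed
      have "(t / u - 1) * f u \<le> real n * f u"
        using n(2) nonneg[of u] u by (intro mult_right_mono) auto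
      also have "\<dots> \<le> f (real n * u)" using iter u by simp
      also have "\<dots> \<le> f (real n * u) + f (t - real n * u)"
        using nonneg[of "t - real n * u"] n(1) by simp
      also have "\<dots> \<le> f t"
        using super[of "real n * u" "t - real n * u"] n(1) u by simp
      finally have "(t / u - 1) * f u / t \<le> f t / t"
        using elim by (intro divide_right_mono) auto
      moreover have "(t / u - 1) * f u / t = f u / u - f u / t"
        using elim u by (simp add: field_simps)
      ultimately show ?case using elim by simp
    qed
  next
    fix a assume a: "l < a"
    show "\<forall>\<^sub>F t in at_top. 1 / t * f t < a"
      using eventually_gt_at_top[of 0]
    proof eventually_elim
      case (elim t)
      then show ?case using le[of t] a by simp
    qed
  qed
  then show ?thesis using le by blast
qed

context matching_model begin

text \<open>\<open>enn2real\<close> sends infinity to 0, so finiteness from the linear bound has to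
  come before superadditivity can be carried over to the reals.\<close>

lemma has_OFF_ex:
  "\<exists>off. has_OFF I off \<and> (\<forall>t>0. OFF_upto I t \<le> off)"
proof -
  let ?C = "total_reward * (\<Sum>i\<in>agent_types I. arr_rate I i)"
  have fin: "offline_value t < top" if "0 \<le> t" for t
    using offline_value_le[OF that] by (rule le_less_trans) simp
  have C: "0 \<le> ?C"
    using total_reward_nonneg rates_pos by (intro mult_nonneg_nonneg sum_nonneg) (auto intro: less_imp_le)
  have "\<exists>l. ((\<lambda>t. 1 / t * enn2real (offline_value t)) \<longlongrightarrow> l) at_top \<and> (\<forall>t>0. enn2real (offline_value t) / t \<le> l)"
  proof (rule superadditive_limit)
    show "enn2real (offline_value s) + enn2real (offline_value t) \<le> enn2real (offline_value (s + t))"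
      if "0 \<le> s" "0 \<le> t" for s t
      using offline_value_superadd[OF that] fin that by (simp add: enn2real_plus[symmetric] enn2real_mono)
    show "enn2real (offline_value t) \<le> ?C * t" if "0 \<le> t" for t
      using offline_value_le[OF that] C that by (intro enn2real_leI) auto
  qed simp
  then show ?thesis
    unfolding has_OFF_def OFF_upto_eq[abs_def] by simp
qed

text \<open>Redrawing the three coordinates one after another gives their product law. Gaps and
  sojourn times lie in different factors, so \<open>c\<close> may coincide with \<open>a\<close> or
  \<open>b\<close>.\<close>

lemma nn_integral_two_gaps_sojourn:
  assumes a: "a \<in> agents I" and b: "b \<in> agents I" and c: "c \<in> agents I" and "a \<noteq> b"
    and F [measurable]: "(\<lambda>(x, y, z). F x y z) \<in> borel_measurable (borel \<Otimes>\<^sub>M borel \<Otimes>\<^sub>M borel)"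
  shows "(\<integral>\<^sup>+\<omega>. F (gap \<omega> a) (gap \<omega> b) (sojourn \<omega> c) \<partial>L) =
    (\<integral>\<^sup>+x. (\<integral>\<^sup>+y. (\<integral>\<^sup>+z. F x y z \<partial>exponential_measure (ab_rate I (fst c)))
      \<partial>exponential_measure (arr_rate I (fst b))) \<partial>exponential_measure (arr_rate I (fst a)))"
proof -
  let ?A = "exponential_measure (arr_rate I (fst a))" and ?B = "exponential_measure (arr_rate I (fst b))"
    and ?C = "exponential_measure (ab_rate I (fst c))"
  interpret A: prob_space ?A by (rule prob_space_gap[OF a])
  interpret B: prob_space ?B by (rule prob_space_gap[OF b])
  interpret C: prob_space ?C by (rule prob_space_sojourn[OF c])
  note ms = measurable_gap[OF a] measurable_gap[OF b] measurable_sojourn[OF c]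
  define H where "H x y = (\<integral>\<^sup>+z. F x y z \<partial>?C)" for x y
  have "(\<lambda>p. (fst (fst p), snd (fst p), snd p)) \<in> measurable ((borel \<Otimes>\<^sub>M borel) \<Otimes>\<^sub>M ?C) (borel \<Otimes>\<^sub>M borel \<Otimes>\<^sub>M borel)"
    by measurable
  from measurable_compose[OF this F]
  have H: "(\<lambda>(x, y). H x y) \<in> borel_measurable (borel \<Otimes>\<^sub>M borel)"
    unfolding H_def split_beta' by (intro C.borel_measurable_nn_integral) (simp add: split_beta')
  have HB: "(\<lambda>x. \<integral>\<^sup>+y. H x y \<partial>?B) \<in> borel_measurable borel"
    using H by (intro B.borel_measurable_nn_integral) (simp add: measurable_cong_sets[OF sets_pair_measure_cong[OF refl sets_exponential_measure] refl])
  have "(\<lambda>\<omega>. (gap \<omega> a, gap \<omega> b, sojourn \<omega> c)) \<in> measurable L (borel \<Otimes>\<^sub>M borel \<Otimes>\<^sub>M borel)"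
    using ms by measurable
  from measurable_compose[OF this F]
  have 1: "(\<lambda>\<omega>. F (gap \<omega> a) (gap \<omega> b) (sojourn \<omega> c)) \<in> borel_measurable L" by simp
  have "(\<lambda>\<omega>. (gap \<omega> a, gap \<omega> b)) \<in> measurable L (borel \<Otimes>\<^sub>M borel)"
    using ms by measurable
  from measurable_compose[OF this H]
  have 2: "(\<lambda>\<omega>. H (gap \<omega> a) (gap \<omega> b)) \<in> borel_measurable L" by simp
  have 3: "(\<lambda>\<omega>. \<integral>\<^sup>+y. H (gap \<omega> a) y \<partial>?B) \<in> borel_measurable L"
    using measurable_compose[OF measurable_gap[OF a] HB] by simp
  have "(\<integral>\<^sup>+\<omega>. F (gap \<omega> a) (gap \<omega> b) (sojourn \<omega> c) \<partial>L) = (\<integral>\<^sup>+\<omega>. H (gap \<omega> a) (gap \<omega> b) \<partial>L)"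
    unfolding H_def by (subst nn_integral_resample_sojourn[OF c 1]) simp
  also have "\<dots> = (\<integral>\<^sup>+\<omega>. (\<integral>\<^sup>+y. H (gap \<omega> a) y \<partial>?B) \<partial>L)"
    using \<open>a \<noteq> b\<close> by (subst nn_integral_resample_gap[OF b 2]) simp
  also have "\<dots> = (\<integral>\<^sup>+\<omega>. (\<integral>\<^sup>+x. (\<integral>\<^sup>+y. H x y \<partial>?B) \<partial>?A) \<partial>L)"
    by (subst nn_integral_resample_gap[OF a 3]) simp
  finally show ?thesis by (simp add: H_def L.emeasure_space_1)
qed

end

section \<open>The hard instance\<close>

text \<open>For rate \<open>1 / n\<^sup>2\<close> the density on a window of length \<open>n\<close>
  is constant up to a factor \<open>exp (- (1 / n))\<close>, which tends to 1. Rare arrivals may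
  thus be integrated against Lebesgue measure.\<close>

lemma nn_integral_exponential_ge:
  assumes l: "0 < l" and f [measurable]: "f \<in> borel_measurable borel"
  shows "ennreal (l * exp (- l * n)) * (\<integral>\<^sup>+x. f x * indicator {0<..<n} x \<partial>lborel) \<le> (\<integral>\<^sup>+x. f x \<partial>exponential_measure l)"
proof -
  have "ennreal (l * exp (- l * n)) * (\<integral>\<^sup>+x. f x * indicator {0<..<n} x \<partial>lborel) =
      (\<integral>\<^sup>+x. ennreal (l * exp (- l * n)) * (f x * indicator {0<..<n} x) \<partial>lborel)"
    by (rule nn_integral_cmult[symmetric]) measurable
  also have "\<dots> \<le> (\<integral>\<^sup>+x. ennreal (exponential_density l x) * f x \<partial>lborel)"
  proof (intro nn_integral_mono)
    fix x
    show "ennreal (l * exp (- l * n)) * (f x * indicator {0<..<n} x) \<le> ennreal (exponential_density l x) * f x"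
    proof (cases "x \<in> {0<..<n}")
      case True
      then have "l * exp (- l * n) \<le> exponential_density l x"
        using l by (simp add: exponential_density_def)
      then show ?thesis using True by (simp add: mult_right_mono ennreal_leI)
    qed simp
  qed
  also have "\<dots> = (\<integral>\<^sup>+x. f x \<partial>exponential_measure l)"
    by (rule nn_integral_exponential_measure[symmetric, OF f])
  finally show ?thesis .
qed

lemma nn_integral_FTC_Ioo:
  fixes f F :: "real \<Rightarrow> real"
  assumes f: "f \<in> borel_measurable borel" and ab: "a \<le> b"
    and D: "\<And>x. a \<le> x \<Longrightarrow> x \<le> b \<Longrightarrow> DERIV F x :> f x" and nonneg: "\<And>x. a \<le> x \<Longrightarrow> x \<le> b \<Longrightarrow> 0 \<le> f x"
  shows "(\<integral>\<^sup>+x. ennreal (f x) * indicator {a<..<b} x \<partial>lborel) = ennreal (F b - F a)"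
proof -
  have "(\<integral>\<^sup>+x. ennreal (f x) * indicator {a<..<b} x \<partial>lborel) = (\<integral>\<^sup>+x. ennreal (f x) * indicator {a..b} x \<partial>lborel)"
  proof (rule nn_integral_cong_AE)
    show "AE x in lborel. ennreal (f x) * indicator {a<..<b} x = ennreal (f x) * indicator {a..b} x"
      using AE_lborel_singleton[of a] AE_lborel_singleton[of b]
      by eventually_elim (auto simp: indicator_def)
  qed
  also have "\<dots> = ennreal (F b - F a)"
    using f ab D nonneg by (intro nn_integral_FTC_Icc) (auto intro: has_field_derivative_at_within)
  finally show ?thesis .
qed

text \<open>For large \<open>n\<close>, agents of type 0 are scarce and live for a time of mean 1. Such an agent earns 1
  with a type-1 agent, one of which is almost always already present, or \<open>n\<^sup>2\<close> with a type-2 agent,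
  one of which arrives during its life with probability about \<open>1 / n\<^sup>2\<close>.\<close>

definition hard_instance :: "real \<Rightarrow> nat matching_instance" where
  "hard_instance n = \<lparr>agent_types = {0, 1, 2}, arr_rate = (\<lambda>i. if i = 1 then 1 else 1 / n\<^sup>2),
     ab_rate = (\<lambda>i. if i = 0 then 1 else 1 / n\<^sup>2),
     reward = (\<lambda>i j. if i = 1 \<and> j = 0 then 1 else if i = 0 \<and> j = 2 then n\<^sup>2 else 0)\<rparr>"

lemma hard_instance_simps [simp]:
  "agent_types (hard_instance n) = {0, 1, 2}"
  "arr_rate (hard_instance n) i = (if i = 1 then 1 else 1 / n\<^sup>2)"
  "ab_rate (hard_instance n) i = (if i = 0 then 1 else 1 / n\<^sup>2)"
  "reward (hard_instance n) i j = (if i = 1 \<and> j = 0 then 1 else if i = 0 \<and> j = 2 then n\<^sup>2 else 0)"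
  by (simp_all add: hard_instance_def)

lemma homogeneous_hard_instance: "homogeneous_departures (hard_instance n)"
  unfolding homogeneous_departures_def bipartition_def
  by (intro disjI2 exI[of _ "{0}"] exI[of _ "{1, 2}"]) auto

section \<open>The online and the offline bound for the hard instance\<close>

locale hard_model =
  fixes n :: real
  assumes n: "1 \<le> n"
begin

sublocale matching_model "hard_instance n"
  using n by unfold_locales (auto simp: valid_instance_def)

lemma agents: "(0, k) \<in> agents (hard_instance n)" "(1, k) \<in> agents (hard_instance n)" "(2, k) \<in> agents (hard_instance n)"
  by (auto simp: agents_iff)

lemma reward_rate_le:
  assumes \<pi>: "markovian_policy (hard_instance n) \<pi>" and V: "has_reward_rate (hard_instance n) \<pi> V"
  shows "V \<le> 1 / n\<^sup>2"
proof -
  interpret online_model "hard_instance n" \<pi>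
    using \<pi> by unfold_locales (simp add: markovian_policy_def)
  let ?E = "\<lambda>i j t. (\<integral>\<omega>. real (num_matches \<pi> i j t \<omega>) \<partial>\<Omega>)"
  obtain x where x: "\<And>i j. i \<in> {0, 1, 2} \<Longrightarrow> j \<in> {0, 1, 2} \<Longrightarrow> ((\<lambda>t. 1 / t * ?E i j t) \<longlongrightarrow> x i j) at_top"
    and V': "V = (\<Sum>i\<in>{0, 1, 2}. \<Sum>j\<in>{0, 1, 2}. reward (hard_instance n) i j * x i j)"
    using V unfolding has_reward_rate_def hard_instance_simps(1) by blast
  have "((\<lambda>t. 1 / t * ?E 1 0 t + n\<^sup>2 * (1 / t * ?E 0 2 t)) \<longlongrightarrow> x 1 0 + n\<^sup>2 * x 0 2) at_top"
    using x[of 1 0] x[of 0 2] by (intro tendsto_intros) auto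
  moreover have "\<forall>\<^sub>F t in at_top. 1 / t * ?E 1 0 t + n\<^sup>2 * (1 / t * ?E 0 2 t) \<le> 1 / n\<^sup>2"
    using eventually_gt_at_top[of 0]
  proof eventually_elim
    case (elim t)
    have "?E 1 0 t + n\<^sup>2 * ?E 0 2 t \<le> 1 / n\<^sup>2 * t"
      \<comment> \<open>\<open>n\<^sup>2\<close> is at once the jackpot reward and the largest
        \<open>c\<close> with \<open>c * arr_rate\<close> of type 2 at most the abandonment rate 1
        of type 0. The right side is the arrival rate of scarce agents times
        \<open>t\<close>.\<close>
      using expected_matches_le[of 0 2 1 t "n\<^sup>2"] elim n by simp
    then have "(?E 1 0 t + n\<^sup>2 * ?E 0 2 t) / t \<le> 1 / n\<^sup>2"
      using elim by (simp add: pos_divide_le_eq)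
    then show ?case by (simp add: add_divide_distrib)
  qed
  ultimately have "x 1 0 + n\<^sup>2 * x 0 2 \<le> 1 / n\<^sup>2"
    by (rule tendsto_upperbound) simp
  then show ?thesis by (simp add: V')
qed

lemma max_matching_weight_ge:
  assumes r: "regular \<omega>" and e: "(a, b) \<in> offline_edges (hard_instance n) \<omega> t"
  shows "reward (hard_instance n) (fst a) (fst b) \<le> max_matching_weight (hard_instance n) \<omega> t"
  using matching_weight_le_max[OF r, of "{(a, b)}" t] e by (simp add: is_matching_def matching_weight_def)

text \<open>Within the horizon \<open>n\<close> a scarce agent shows up with probability about
  \<open>1 / n\<close>. It then has a companion almost surely, and meets a jackpot with probability
  about \<open>1 / n\<^sup>2\<close>. Each of the two contributes about \<open>1 / n\<close>, so per
  unit of time the value is about \<open>2 / n\<^sup>2\<close>.\<close>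

lemma offline_value_ge:
  "ennreal ((n - 1) * exp (- 2 / n) * (2 - 1 / n\<^sup>2) / n\<^sup>2) \<le> offline_value n"
proof -
  \<comment> \<open>\<open>A\<close>: a scarce agent arrives at \<open>x\<close> and lives for
    \<open>z\<close>, and a jackpot arrives at \<open>y\<close> during its life. In
    \<open>B\<close>, the companion arrives at \<open>y\<close> before \<open>x\<close>, and a
    sojourn \<open>z\<close> of at least \<open>n\<close> keeps it present until the end of the
    horizon.\<close>
  define A where "A x y z \<longleftrightarrow> 0 < x \<and> x < n \<and> x < y \<and> y < n \<and> y - x \<le> z" for x y z :: real
  define B where "B x y z \<longleftrightarrow> 0 < x \<and> x < n \<and> 0 < y \<and> y < x \<and> n \<le> z" for x y z :: real
  let ?A = "\<lambda>\<omega>. A (gap \<omega> (0, 0)) (gap \<omega> (2, 0)) (sojourn \<omega> (0, 0))"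
  let ?B = "\<lambda>\<omega>. B (gap \<omega> (0, 0)) (gap \<omega> (1, 0)) (sojourn \<omega> (1, 0))"
  let ?q = "exp (- (1 / n))"
  have [measurable]: "(\<lambda>\<omega>. gap \<omega> (i, 0)) \<in> borel_measurable L" "(\<lambda>\<omega>. sojourn \<omega> (i, 0)) \<in> borel_measurable L"
    if "i \<in> {0, 1, 2}" for i
    using that by (auto intro!: measurable_gap measurable_sojourn simp: agents_iff)
  have arr: "arrival \<omega> (i, 0) = gap \<omega> (i, 0)" for \<omega> and i :: nat
    by (simp add: arrival_def)
  have pos: "0 < n" using n by simp
  have q: "exp (- (1 / n\<^sup>2) * n) = ?q" using pos by (simp add: power2_eq_square)
  have qq: "?q * ?q = exp (- 2 / n)" by (simp add: exp_add[symmetric])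
  \<comment> \<open>If both events occur, the two edges share the scarce agent and only the jackpot
    counts. Weighting \<open>A\<close> by \<open>n\<^sup>2 - 1\<close> makes the two weights add up
    to exactly \<open>n\<^sup>2\<close> in this case.\<close>
  have pointwise: "ennreal (n\<^sup>2 - 1) * indicator {\<omega>. ?A \<omega>} \<omega> + indicator {\<omega>. ?B \<omega>} \<omega> \<le>
      ennreal (max_matching_weight (hard_instance n) \<omega> n) * indicator {\<omega>. regular \<omega>} \<omega>"
    if r: "regular \<omega>" for \<omega>
  proof -
    let ?w = "max_matching_weight (hard_instance n) \<omega> n"
    have "n\<^sup>2 \<le> ?w" if "?A \<omega>"
      using max_matching_weight_ge[OF r, of "(0, 0)" "(2, 0)" n] that agents
      by (simp add: offline_edges_iff[OF r] arr departure_def A_def)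
    moreover have "1 \<le> ?w" if "?B \<omega>"
      using max_matching_weight_ge[OF r, of "(1, 0)" "(0, 0)" n] that agents
      by (simp add: offline_edges_iff[OF r] arr departure_def B_def)
    moreover have "0 \<le> ?w" by (rule max_matching_weight_nonneg[OF r])
    moreover have "1 \<le> n\<^sup>2" using n by simp
    ultimately have le: "(n\<^sup>2 - 1) * indicator {\<omega>. ?A \<omega>} \<omega> + indicator {\<omega>. ?B \<omega>} \<omega> \<le> ?w"
      by (auto simp: indicator_def)
    have eq: "ennreal ((n\<^sup>2 - 1) * indicator {\<omega>. ?A \<omega>} \<omega> + indicator {\<omega>. ?B \<omega>} \<omega>) =
        ennreal (n\<^sup>2 - 1) * indicator {\<omega>. ?A \<omega>} \<omega> + indicator {\<omega>. ?B \<omega>} \<omega>"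
      using n ennreal_plus[of "n\<^sup>2 - 1" 1] by (auto simp: indicator_def simp del: ennreal_plus)
    show ?thesis
      using ennreal_leI[OF le] r unfolding eq by simp
  qed
  \<comment> \<open>Two rare arrivals contribute \<open>1 / n\<^sup>2\<close> and a factor
    \<open>exp (- (1 / n))\<close> each. The remaining integral of
    \<open>1 - exp (- (n - x))\<close> over the window is \<open>n - 1 + exp (- n)\<close>.\<close>
  have PA: "ennreal ((n - 1) / n ^ 4 * exp (- 2 / n)) \<le> (\<integral>\<^sup>+\<omega>. indicator {\<omega>. ?A \<omega>} \<omega> \<partial>L)"
  proof -
    have "(\<integral>\<^sup>+\<omega>. indicator {\<omega>. ?A \<omega>} \<omega> \<partial>L) = (\<integral>\<^sup>+\<omega>. of_bool (?A \<omega>) \<partial>L)"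
      by (simp add: indicator_def)
    also have "\<dots> = (\<integral>\<^sup>+x. (\<integral>\<^sup>+y. (\<integral>\<^sup>+z. of_bool (A x y z) \<partial>exponential_measure 1)
        \<partial>exponential_measure (1 / n\<^sup>2)) \<partial>exponential_measure (1 / n\<^sup>2))"
    proof -
      have "(\<lambda>(x, y, z). of_bool (A x y z) :: ennreal) \<in> borel_measurable (borel \<Otimes>\<^sub>M borel \<Otimes>\<^sub>M borel)"
        unfolding A_def split_beta' by measurable
      from nn_integral_two_gaps_sojourn[OF agents(1) agents(3) agents(1) _ this]
      show ?thesis by simp
    qed
    also have "\<dots> = (\<integral>\<^sup>+x. (\<integral>\<^sup>+y. indicator {0<..<n} x * (ennreal (exp (- (y - x))) * indicator {x<..<n} y)
        \<partial>exponential_measure (1 / n\<^sup>2)) \<partial>exponential_measure (1 / n\<^sup>2))"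
    proof (intro nn_integral_cong)
      fix x y
      have "(\<integral>\<^sup>+z. of_bool (A x y z) \<partial>exponential_measure 1) =
          (\<integral>\<^sup>+z. indicator {0<..<n} x * indicator {x<..<n} y * indicator {y - x..} z \<partial>exponential_measure 1)"
        by (intro nn_integral_cong) (auto simp: A_def indicator_def)
      also have "\<dots> = indicator {0<..<n} x * indicator {x<..<n} y * emeasure (exponential_measure 1) {y - x..}"
        by (subst nn_integral_cmult) auto
      also have "\<dots> = indicator {0<..<n} x * (ennreal (exp (- (y - x))) * indicator {x<..<n} y)"
        using emeasure_exponential_Ici[of 1 "y - x"] by (cases "x < y") (auto simp: indicator_def)
      finally show "(\<integral>\<^sup>+z. of_bool (A x y z) \<partial>exponential_measure 1) =
        indicator {0<..<n} x * (ennreal (exp (- (y - x))) * indicator {x<..<n} y)" .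
    qed
    finally have PA_eq: "(\<integral>\<^sup>+\<omega>. indicator {\<omega>. ?A \<omega>} \<omega> \<partial>L) =
        (\<integral>\<^sup>+x. (\<integral>\<^sup>+y. indicator {0<..<n} x * (ennreal (exp (- (y - x))) * indicator {x<..<n} y)
        \<partial>exponential_measure (1 / n\<^sup>2)) \<partial>exponential_measure (1 / n\<^sup>2))" .
    have "(\<integral>\<^sup>+x. ennreal (1 - exp (- (n - x))) * indicator {0<..<n} x \<partial>lborel) =
        ennreal ((n - exp (- (n - n))) - (0 - exp (- (n - 0))))"
      using pos by (intro nn_integral_FTC_Ioo) (auto intro!: derivative_eq_intros)
    also have "\<dots> \<ge> ennreal (n - 1)"
      by (intro ennreal_leI) simp
    finally have "ennreal (1 / n\<^sup>2 * ?q) * (ennreal (1 / n\<^sup>2 * ?q) * ennreal (n - 1)) \<le>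
        ennreal (1 / n\<^sup>2 * ?q) * (ennreal (1 / n\<^sup>2 * ?q) *
          (\<integral>\<^sup>+x. ennreal (1 - exp (- (n - x))) * indicator {0<..<n} x \<partial>lborel))"
      by (intro mult_left_mono) auto
    also have "ennreal (1 / n\<^sup>2 * ?q) * (\<integral>\<^sup>+x. ennreal (1 - exp (- (n - x))) * indicator {0<..<n} x \<partial>lborel) =
        (\<integral>\<^sup>+x. ennreal (1 / n\<^sup>2 * ?q) * (ennreal (1 - exp (- (n - x))) * indicator {0<..<n} x) \<partial>lborel)"
      by (rule nn_integral_cmult[symmetric]) measurable
    also have "\<dots> = (\<integral>\<^sup>+x. (indicator {0<..<n} x * (ennreal (1 / n\<^sup>2 * ?q) * ennreal (1 - exp (- (n - x))))) * indicator {0<..<n} x \<partial>lborel)"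
      by (intro nn_integral_cong) (auto simp: indicator_def)
    also have "ennreal (1 / n\<^sup>2 * ?q) * \<dots> \<le>
        (\<integral>\<^sup>+x. indicator {0<..<n} x * (ennreal (1 / n\<^sup>2 * ?q) * ennreal (1 - exp (- (n - x)))) \<partial>exponential_measure (1 / n\<^sup>2))"
      unfolding q[symmetric] using pos by (intro nn_integral_exponential_ge) auto
    also have "\<dots> \<le> (\<integral>\<^sup>+\<omega>. indicator {\<omega>. ?A \<omega>} \<omega> \<partial>L)"
      unfolding PA_eq
    proof (intro nn_integral_mono)
      fix x
      show "indicator {0<..<n} x * (ennreal (1 / n\<^sup>2 * ?q) * ennreal (1 - exp (- (n - x)))) \<le>
        (\<integral>\<^sup>+y. indicator {0<..<n} x * (ennreal (exp (- (y - x))) * indicator {x<..<n} y)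
        \<partial>exponential_measure (1 / n\<^sup>2))"
      proof (cases "x \<in> {0<..<n}")
        case True
        have 1: "(\<integral>\<^sup>+y. ennreal (exp (- (y - x))) * indicator {x<..<n} y \<partial>lborel) =
            ennreal ((- exp (- (n - x))) - (- exp (- (x - x))))"
          using True by (intro nn_integral_FTC_Ioo) (auto intro!: derivative_eq_intros)
        have 2: "(\<integral>\<^sup>+y. ennreal (exp (- (y - x))) * indicator {x<..<n} y \<partial>lborel) =
            (\<integral>\<^sup>+y. ennreal (exp (- (y - x))) * indicator {x<..<n} y * indicator {0<..<n} y \<partial>lborel)"
          using True by (intro nn_integral_cong) (auto simp: indicator_def)
        have 3: "ennreal (1 / n\<^sup>2 * exp (- (1 / n\<^sup>2) * n)) *
            (\<integral>\<^sup>+y. ennreal (exp (- (y - x))) * indicator {x<..<n} y * indicator {0<..<n} y \<partial>lborel) \<le>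
            (\<integral>\<^sup>+y. ennreal (exp (- (y - x))) * indicator {x<..<n} y \<partial>exponential_measure (1 / n\<^sup>2))"
          using pos by (intro nn_integral_exponential_ge) auto
        show ?thesis using True 3[unfolded q, folded 2, unfolded 1] by simp
      qed simp
    qed
    finally have "ennreal (1 / n\<^sup>2 * ?q) * (ennreal (1 / n\<^sup>2 * ?q) * ennreal (n - 1)) \<le>
      (\<integral>\<^sup>+\<omega>. indicator {\<omega>. ?A \<omega>} \<omega> \<partial>L)" .
    moreover have "ennreal (1 / n\<^sup>2 * ?q) * (ennreal (1 / n\<^sup>2 * ?q) * ennreal (n - 1)) =
        ennreal ((1 / n\<^sup>2 * ?q) * ((1 / n\<^sup>2 * ?q) * (n - 1)))"
      using n by (simp add: ennreal_mult[symmetric])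
    moreover have "(1 / n\<^sup>2 * ?q) * ((1 / n\<^sup>2 * ?q) * (n - 1)) = (n - 1) / n ^ 4 * exp (- 2 / n)"
      unfolding qq[symmetric] by (simp add: power4_eq_xxxx power2_eq_square mult_ac)
    ultimately show ?thesis by (simp only:)
  qed
  \<comment> \<open>Only the scarce arrival contributes \<open>1 / n\<^sup>2\<close>. One factor
    \<open>exp (- (1 / n))\<close> comes from its density, the other from the companion surviving
    for the time \<open>n\<close>.\<close>
  have PB: "ennreal ((n - 1) / n\<^sup>2 * exp (- 2 / n)) \<le> (\<integral>\<^sup>+\<omega>. indicator {\<omega>. ?B \<omega>} \<omega> \<partial>L)"
  proof -
    have "(\<integral>\<^sup>+\<omega>. indicator {\<omega>. ?B \<omega>} \<omega> \<partial>L) = (\<integral>\<^sup>+\<omega>. of_bool (?B \<omega>) \<partial>L)"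
      by (simp add: indicator_def)
    also have "\<dots> = (\<integral>\<^sup>+x. (\<integral>\<^sup>+y. (\<integral>\<^sup>+z. of_bool (B x y z) \<partial>exponential_measure (1 / n\<^sup>2))
        \<partial>exponential_measure 1) \<partial>exponential_measure (1 / n\<^sup>2))"
    proof -
      have "(\<lambda>(x, y, z). of_bool (B x y z) :: ennreal) \<in> borel_measurable (borel \<Otimes>\<^sub>M borel \<Otimes>\<^sub>M borel)"
        unfolding B_def split_beta' by measurable
      from nn_integral_two_gaps_sojourn[OF agents(1) agents(2) agents(2) _ this]
      show ?thesis by simp
    qed
    also have "\<dots> = (\<integral>\<^sup>+x. (\<integral>\<^sup>+y. (ennreal ?q * indicator {0<..<n} x) * indicator {0<..<x} y
        \<partial>exponential_measure 1) \<partial>exponential_measure (1 / n\<^sup>2))"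
    proof (intro nn_integral_cong)
      fix x y
      have "(\<integral>\<^sup>+z. of_bool (B x y z) \<partial>exponential_measure (1 / n\<^sup>2)) =
          (\<integral>\<^sup>+z. indicator {0<..<n} x * indicator {0<..<x} y * indicator {n..} z \<partial>exponential_measure (1 / n\<^sup>2))"
        by (intro nn_integral_cong) (auto simp: B_def indicator_def)
      also have "\<dots> = indicator {0<..<n} x * indicator {0<..<x} y * emeasure (exponential_measure (1 / n\<^sup>2)) {n..}"
        by (subst nn_integral_cmult) auto
      also have "\<dots> = (ennreal ?q * indicator {0<..<n} x) * indicator {0<..<x} y"
        using emeasure_exponential_Ici[of "1 / n\<^sup>2" n] pos q by (simp add: mult_ac)
      finally show "(\<integral>\<^sup>+z. of_bool (B x y z) \<partial>exponential_measure (1 / n\<^sup>2)) =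
        (ennreal ?q * indicator {0<..<n} x) * indicator {0<..<x} y" .
    qed
    also have "\<dots> = (\<integral>\<^sup>+x. (ennreal ?q * indicator {0<..<n} x) * ennreal (1 - exp (- x)) \<partial>exponential_measure (1 / n\<^sup>2))"
    proof (rule nn_integral_cong)
      fix x
      have "(\<integral>\<^sup>+y. indicator {0<..<x} y \<partial>exponential_measure 1) = ennreal (1 - exp (- x))" if "0 < x"
      proof -
        have "(\<integral>\<^sup>+y. indicator {0<..<x} y \<partial>exponential_measure 1) =
            (\<integral>\<^sup>+y. ennreal (exponential_density 1 y) * indicator {0<..<x} y \<partial>lborel)"
          by (rule nn_integral_exponential_measure) auto
        also have "\<dots> = (\<integral>\<^sup>+y. ennreal (exp (- y)) * indicator {0<..<x} y \<partial>lborel)"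
          by (intro nn_integral_cong) (auto simp: exponential_density_def indicator_def)
        also have "\<dots> = ennreal ((- exp (- x)) - (- exp (- 0)))"
          using that by (intro nn_integral_FTC_Ioo) (auto intro!: derivative_eq_intros)
        finally show ?thesis by simp
      qed
      then show "(\<integral>\<^sup>+y. (ennreal ?q * indicator {0<..<n} x) * indicator {0<..<x} y \<partial>exponential_measure 1) =
          (ennreal ?q * indicator {0<..<n} x) * ennreal (1 - exp (- x))"
        by (subst nn_integral_cmult) (auto simp: indicator_def[of "{0<..<n}"])
    qed
    finally have PB_eq: "(\<integral>\<^sup>+\<omega>. indicator {\<omega>. ?B \<omega>} \<omega> \<partial>L) =
        (\<integral>\<^sup>+x. (ennreal ?q * indicator {0<..<n} x) * ennreal (1 - exp (- x)) \<partial>exponential_measure (1 / n\<^sup>2))" .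
    have "(\<integral>\<^sup>+x. ennreal (1 - exp (- x)) * indicator {0<..<n} x \<partial>lborel) =
        ennreal ((n + exp (- n)) - (0 + exp (- 0)))"
      using pos by (intro nn_integral_FTC_Ioo) (auto intro!: derivative_eq_intros)
    also have "\<dots> \<ge> ennreal (n - 1)"
      by (intro ennreal_leI) simp
    finally have "ennreal (1 / n\<^sup>2 * ?q) * (ennreal ?q * ennreal (n - 1)) \<le> ennreal (1 / n\<^sup>2 * ?q) * (ennreal ?q *
        (\<integral>\<^sup>+x. ennreal (1 - exp (- x)) * indicator {0<..<n} x \<partial>lborel))"
      by (intro mult_left_mono) auto
    also have "ennreal ?q * (\<integral>\<^sup>+x. ennreal (1 - exp (- x)) * indicator {0<..<n} x \<partial>lborel) =
        (\<integral>\<^sup>+x. ennreal ?q * (ennreal (1 - exp (- x)) * indicator {0<..<n} x) \<partial>lborel)"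
      by (rule nn_integral_cmult[symmetric]) measurable
    also have "\<dots> = (\<integral>\<^sup>+x. ((ennreal ?q * indicator {0<..<n} x) * ennreal (1 - exp (- x))) * indicator {0<..<n} x \<partial>lborel)"
      by (intro nn_integral_cong) (auto simp: indicator_def)
    also have "ennreal (1 / n\<^sup>2 * ?q) * \<dots> \<le> (\<integral>\<^sup>+\<omega>. indicator {\<omega>. ?B \<omega>} \<omega> \<partial>L)"
      unfolding PB_eq unfolding q[symmetric] using pos by (intro nn_integral_exponential_ge) auto
    finally have "ennreal (1 / n\<^sup>2 * ?q) * (ennreal ?q * ennreal (n - 1)) \<le> (\<integral>\<^sup>+\<omega>. indicator {\<omega>. ?B \<omega>} \<omega> \<partial>L)" .
    moreover have "ennreal (1 / n\<^sup>2 * ?q) * (ennreal ?q * ennreal (n - 1)) =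
        ennreal ((1 / n\<^sup>2 * ?q) * (?q * (n - 1)))"
      using n by (simp add: ennreal_mult[symmetric])
    moreover have "(1 / n\<^sup>2 * ?q) * (?q * (n - 1)) = (n - 1) / n\<^sup>2 * exp (- 2 / n)"
      unfolding qq[symmetric] by (simp add: mult_ac)
    ultimately show ?thesis by (simp only:)
  qed
  have "(n - 1) * exp (- 2 / n) * (2 - 1 / n\<^sup>2) / n\<^sup>2 =
      (n\<^sup>2 - 1) * ((n - 1) / n ^ 4 * exp (- 2 / n)) + (n - 1) / n\<^sup>2 * exp (- 2 / n)"
    using pos by (simp add: field_simps power4_eq_xxxx power2_eq_square)
  then have "ennreal ((n - 1) * exp (- 2 / n) * (2 - 1 / n\<^sup>2) / n\<^sup>2) =
      ennreal (n\<^sup>2 - 1) * ennreal ((n - 1) / n ^ 4 * exp (- 2 / n)) + ennreal ((n - 1) / n\<^sup>2 * exp (- 2 / n))"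
    using n by (simp add: ennreal_mult[symmetric] ennreal_plus[symmetric] del: ennreal_plus)
  also have "\<dots> \<le> ennreal (n\<^sup>2 - 1) * (\<integral>\<^sup>+\<omega>. indicator {\<omega>. ?A \<omega>} \<omega> \<partial>L) + (\<integral>\<^sup>+\<omega>. indicator {\<omega>. ?B \<omega>} \<omega> \<partial>L)"
    by (intro add_mono mult_left_mono PA PB) simp
  also have "\<dots> = (\<integral>\<^sup>+\<omega>. ennreal (n\<^sup>2 - 1) * indicator {\<omega>. ?A \<omega>} \<omega> + indicator {\<omega>. ?B \<omega>} \<omega> \<partial>L)"
  proof -
    have m: "(\<lambda>\<omega>. indicator {\<omega>. ?A \<omega>} \<omega> :: ennreal) \<in> borel_measurable L"
      "(\<lambda>\<omega>. indicator {\<omega>. ?B \<omega>} \<omega> :: ennreal) \<in> borel_measurable L"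
      unfolding A_def B_def indicator_def mem_Collect_eq by measurable
    show ?thesis
      using m by (subst nn_integral_add) (auto simp: nn_integral_cmult)
  qed
  also have "\<dots> \<le> offline_value n"
    unfolding offline_value_def nn_integral_Omega
  proof (rule nn_integral_mono_AE)
    show "AE \<omega> in L. ennreal (n\<^sup>2 - 1) * indicator {\<omega>. ?A \<omega>} \<omega> + indicator {\<omega>. ?B \<omega>} \<omega> \<le>
        ennreal (max_matching_weight (hard_instance n) \<omega> n) * indicator {\<omega>. regular \<omega>} \<omega>"
      using AE_regular by eventually_elim (rule pointwise)
  qed
  finally show ?thesis .
qed

end

theorem theorem2:
  fixes \<epsilon> :: real
  assumes "\<epsilon> > 0"
  shows "\<exists>(I :: nat matching_instance) off.
    valid_instance I \<and> homogeneous_departures I \<and> has_OFF I off \<and>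
    (\<forall>\<pi> V. markovian_policy I \<pi> \<and> has_reward_rate I \<pi> V \<longrightarrow> V < (1 / 2 + \<epsilon>) * off)"
proof -
  \<comment> \<open>The factor next to \<open>1 / 2 + \<epsilon>\<close> is the offline lower bound
    at horizon \<open>n\<close>, per unit of time and scaled by \<open>n\<^sup>2\<close>; it tends
    to 2. The online bound scaled in the same way is 1, less than
    \<open>1 + 2 * \<epsilon>\<close>.\<close>
  have "((\<lambda>n::real. (1 / 2 + \<epsilon>) * ((1 - 1 / n) * exp (- 2 / n) * (2 - 1 / n\<^sup>2))) \<longlongrightarrow> (1 / 2 + \<epsilon>) * 2) at_top"
    by (rule tendsto_mult[OF tendsto_const]) real_asymp
  then have "\<forall>\<^sub>F n in at_top. 1 < (1 / 2 + \<epsilon>) * ((1 - 1 / n) * exp (- 2 / n) * (2 - 1 / n\<^sup>2))"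
    using assms by (intro order_tendstoD(1)) auto
  with eventually_ge_at_top[of 1]
  have "\<forall>\<^sub>F n in at_top. 1 \<le> n \<and> 1 < (1 / 2 + \<epsilon>) * ((1 - 1 / n) * exp (- 2 / n) * (2 - 1 / n\<^sup>2))"
    by eventually_elim simp
  then obtain n :: real where n_large: "1 \<le> n" "1 < (1 / 2 + \<epsilon>) * ((1 - 1 / n) * exp (- 2 / n) * (2 - 1 / n\<^sup>2))"
    by (auto dest!: eventually_happens)
  interpret hard_model n by unfold_locales (rule n_large(1))
  let ?g = "(1 - 1 / n) * exp (- 2 / n) * (2 - 1 / n\<^sup>2)"
  obtain off where off: "has_OFF (hard_instance n) off" "\<And>t. 0 < t \<Longrightarrow> OFF_upto (hard_instance n) t \<le> off"
    using has_OFF_ex by blast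
  have "(n - 1) * exp (- 2 / n) * (2 - 1 / n\<^sup>2) / n\<^sup>2 \<le> enn2real (offline_value n)"
  proof -
    have "offline_value n < top"
      using offline_value_le[of n] n_large(1) by (simp add: le_less_trans)
    moreover have "0 \<le> (n - 1) * exp (- 2 / n) * (2 - 1 / n\<^sup>2) / n\<^sup>2"
    proof -
      have "1 \<le> n\<^sup>2" using n_large(1) by simp
      then have "1 / n\<^sup>2 \<le> 1" by (simp add: divide_le_eq)
      then have "0 \<le> 2 - 1 / n\<^sup>2" by linarith
      then show ?thesis using n_large(1) by (intro mult_nonneg_nonneg divide_nonneg_nonneg \<open>0 \<le> 2 - 1 / n\<^sup>2\<close>) auto
    qed
    ultimately show ?thesis
      using enn2real_mono[OF offline_value_ge] by simp
  qed
  \<comment> \<open>Dividing by the horizon gives the value per unit of time at \<open>n\<close>,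
    and the limit is at least the value at any horizon.\<close>
  from divide_right_mono[OF this, of n]
  have "((n - 1) * exp (- 2 / n) * (2 - 1 / n\<^sup>2) / n\<^sup>2) / n \<le> OFF_upto (hard_instance n) n"
    using n_large(1) by (simp add: OFF_upto_eq)
  also have "((n - 1) * exp (- 2 / n) * (2 - 1 / n\<^sup>2) / n\<^sup>2) / n = ?g * (1 / n\<^sup>2)"
    using n_large(1) by (simp add: field_simps)
  also have "OFF_upto (hard_instance n) n \<le> off"
    using n_large(1) by (intro off(2)) simp
  finally have off_ge: "?g * (1 / n\<^sup>2) \<le> off" .
  have "V < (1 / 2 + \<epsilon>) * off"
    if "markovian_policy (hard_instance n) \<pi>" "has_reward_rate (hard_instance n) \<pi> V" for \<pi> V
  proof -
    have "V \<le> 1 / n\<^sup>2" by (rule reward_rate_le[OF that])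
    also have "\<dots> < (1 / 2 + \<epsilon>) * ?g * (1 / n\<^sup>2)"
      using mult_strict_right_mono[OF n_large(2), of "1 / n\<^sup>2"] n_large(1) by simp
    also have "\<dots> \<le> (1 / 2 + \<epsilon>) * off"
      unfolding mult.assoc[of "1 / 2 + \<epsilon>"] using off_ge assms by (intro mult_left_mono) auto
    finally show ?thesis .
  qed
  then show ?thesis
    using valid homogeneous_hard_instance off(1) by blast
qed

end
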